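(* Let $R$ be a field or $R=\mathbb{Z}$, and let $M_1$, $M_2$ be connected closed manifolds. Then for the direct product $M_1\times M_2$: (1) A submodule $H\subseteq H^1(M_1\times M_2;R)$ is isotropic if and only if $\operatorname{rk}H=1$ or $H=H_i$, where $H_i\subseteq H^1(M_i;R)$ is an isotropic submodule for $M_i$, $i=1$ or $2$. (2) $\mathcal{H}(M_1\times M_2;R)=\{1\}\cup\mathcal{H}(M_1;R)\cup\mathcal{H}(M_2;R)$, except that, for $\{i,j\}=\{1,2\}$, $\mathcal{H}(M_1\times M_2;R)=\mathcal{H}(M_i;R)$ if $h(M_j;R)=0$, i.e., if either $b_1(M_j;R)=0$, or $b_1(M_j;R)=1$, $\operatorname{char}R=2$, and the cup product $\smile\colon H^1(M_j;R)\times H^1(M_j;R)\to H^2(M_j;R)$ is not identically zero. (3) $h(M_1\times M_2;R)=\max\{h(M_1;R),h(M_2;R)\}$.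
   Context: Modules over $R$ are vector spaces if $R$ is a field and abelian groups if $R=\mathbb{Z}$; submodule means subspace or subgroup, and rank $\operatorname{rk}$ means dimension or rank of an abelian group, respectively. For a closed manifold $M$, a submodule $H\subseteq H^1(M;R)$ is isotropic if $x\smile y=0$ in $H^2(M;R)$ for all $x,y\in H$, where $\smile\colon H^1(M;R)\times H^1(M;R)\to H^2(M;R)$ is the cup product; it is maximal isotropic if it is isotropic and not properly contained in another isotropic submodule of $H^1(M;R)$. Denote by $\mathcal{H}(M;R)$ the set of ranks of all maximal isotropic submodules of $H^1(M;R)$, and $h(M;R)=\max\mathcal{H}(M;R)$ (the isotropy index), i.e. the maximum rank of an isotropic submodule. $b_1(M;R)=\operatorname{rk}H_1(M;R)$. By the Künneth formula, $H^1(M_1\times M_2;R)$ is identified with $H^1(M_1;R)\oplus H^1(M_2;R)$, and each $H^1(M_i;R)$ is regarded as a submodule of it.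
   Formalization: If char R=2: in (1) "rk H=1" also requires x⌣x=0 for all x in H (else H¹(RP²) in RP²×S² fails); in (2) the "i.e." gains a third case: b_1(M_j;R)>1, char R=2 and x⌣x≠0 for every nonzero x in H¹(M_j;R) (e.g. RP²×RP²). *)

theory Defs
  imports
    "HOL-Analysis.Analysis"
    "HOL-Homology.Homology"
    "HOL-Algebra.Algebra"
    "HOL-Algebra.Algebraic_Closure_Type"
    "HOL-Library.Extended_Nat"
begin

section \<open>Closed manifolds\<close>

text \<open>Closed means compact and without boundary; the dimension may be any natural number.
  The underlying space is required to be nonempty, since \<^const>\<open>connected_space\<close>
  admits the empty space.\<close>

definition closed_manifold :: "nat \<Rightarrow> 'a topology \<Rightarrow> bool" where
  "closed_manifold n S \<longleftrightarrow>
     topspace S \<noteq> {} \<and> compact_space S \<and> Hausdorff_space S \<and> second_countable S \<and>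
     (\<forall>x\<in>topspace S. \<exists>U V. openin S U \<and> x \<in> U \<and> openin (Euclidean_space n) V \<and>
        subtopology S U homeomorphic_space subtopology (Euclidean_space n) V)"

definition connected_closed_manifold :: "'a topology \<Rightarrow> bool" where
  "connected_closed_manifold S \<longleftrightarrow> connected_space S \<and> (\<exists>n. closed_manifold n S)"


section \<open>Quotient modules and rank\<close>

text \<open>The coefficient ring is a type \<open>'r\<close>, viewed as a \<open>HOL-Algebra\<close> ring through
  \<^const>\<open>ring_of_type_algebra\<close>. The multiplicative fields \<open>mult\<close> and \<open>one\<close> of a
  module record play no role and are left unspecified.\<close>

definition quotient_module :: "('r, 'm) module \<Rightarrow> 'm set \<Rightarrow> ('r, 'm set) module" where
  "quotient_module M N =
     \<lparr>carrier = a_rcosets\<^bsub>M\<^esub> N, mult = undefined, one = undefined,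
      zero = N, add = set_add M,
      smult = (\<lambda>r C. \<Union>c\<in>C. N +>\<^bsub>M\<^esub> (r \<odot>\<^bsub>M\<^esub> c))\<rparr>"

definition lin_indep :: "('r::comm_ring_1, 'm) module \<Rightarrow> 'm set \<Rightarrow> bool" where
  "lin_indep M B \<longleftrightarrow>
     (\<forall>a. (\<Oplus>\<^bsub>M\<^esub>b\<in>B. a b \<odot>\<^bsub>M\<^esub> b) = \<zero>\<^bsub>M\<^esub> \<longrightarrow> (\<forall>b\<in>B. a b = 0))"

text \<open>The largest size of a linearly independent subset: the dimension if \<open>'r\<close> is a field,
  the rank of an abelian group if \<open>'r\<close> is the ring of integers.\<close>

definition module_rank :: "('r::comm_ring_1, 'm) module \<Rightarrow> 'm set \<Rightarrow> enat" where
  "module_rank M H = (SUP B\<in>{B. finite B \<and> B \<subseteq> H \<and> lin_indep M B}. enat (card B))"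


section \<open>Singular homology with coefficients\<close>

type_synonym 'a sing_simplex = "(nat \<Rightarrow> real) \<Rightarrow> 'a"

definition chain_module ::
    "nat \<Rightarrow> 'a topology \<Rightarrow> ('r::comm_ring_1, 'a sing_simplex \<Rightarrow>\<^sub>0 'r) module" where
  "chain_module n S =
     \<lparr>carrier = {c. Poly_Mapping.keys c \<subseteq> singular_simplex_set n S},
      mult = undefined, one = undefined,
      zero = 0, add = (+), smult = (\<lambda>r. Poly_Mapping.map (\<lambda>a. r * a))\<rparr>"

definition boundary ::
    "nat \<Rightarrow> ('a sing_simplex \<Rightarrow>\<^sub>0 'r::comm_ring_1) \<Rightarrow> ('a sing_simplex \<Rightarrow>\<^sub>0 'r)" where
  "boundary n c =
     (if n = 0 then 0
      else \<Sum>\<sigma>\<in>Poly_Mapping.keys c. \<Sum>k\<le>n.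
        Poly_Mapping.single (singular_face n k \<sigma>) ((-1) ^ k * Poly_Mapping.lookup c \<sigma>))"

definition homology ::
    "nat \<Rightarrow> 'a topology \<Rightarrow> ('r::comm_ring_1, ('a sing_simplex \<Rightarrow>\<^sub>0 'r) set) module" where
  "homology n S =
     quotient_module
       ((chain_module n S)\<lparr>carrier := {c \<in> carrier (chain_module n S). boundary n c = 0}\<rparr>)
       (boundary (Suc n) ` carrier (chain_module (Suc n) S))"

definition betti :: "'r::comm_ring_1 itself \<Rightarrow> nat \<Rightarrow> 'a topology \<Rightarrow> enat" where
  "betti _ n S =
     module_rank (homology n S)
       (carrier (homology n S :: ('r, ('a sing_simplex \<Rightarrow>\<^sub>0 'r) set) module))"


section \<open>Singular cohomology and the cup product\<close>

text \<open>An \<open>n\<close>-cochain is a function on singular \<open>n\<close>-simplices, extended by \<open>0\<close> to all other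
  elements of the type of simplices.\<close>

definition cochain_module ::
    "nat \<Rightarrow> 'a topology \<Rightarrow> ('r::comm_ring_1, 'a sing_simplex \<Rightarrow> 'r) module" where
  "cochain_module n S =
     \<lparr>carrier = {f. \<forall>\<sigma>. \<not> singular_simplex n S \<sigma> \<longrightarrow> f \<sigma> = 0},
      mult = undefined, one = undefined,
      zero = (\<lambda>\<sigma>. 0), add = (\<lambda>f g \<sigma>. f \<sigma> + g \<sigma>), smult = (\<lambda>r f \<sigma>. r * f \<sigma>)\<rparr>"

definition coboundary ::
    "nat \<Rightarrow> 'a topology \<Rightarrow> ('a sing_simplex \<Rightarrow> 'r::comm_ring_1) \<Rightarrow> 'a sing_simplex \<Rightarrow> 'r" where
  "coboundary n S f =
     (\<lambda>\<sigma>. if singular_simplex (Suc n) S \<sigma>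
          then \<Sum>k\<le>Suc n. (-1) ^ k * f (singular_face (Suc n) k \<sigma>) else 0)"

definition cocycles :: "nat \<Rightarrow> 'a topology \<Rightarrow> ('a sing_simplex \<Rightarrow> 'r::comm_ring_1) set" where
  "cocycles n S = {f \<in> carrier (cochain_module n S). coboundary n S f = (\<lambda>\<sigma>. 0)}"

definition coboundaries :: "nat \<Rightarrow> 'a topology \<Rightarrow> ('a sing_simplex \<Rightarrow> 'r::comm_ring_1) set" where
  "coboundaries n S =
     (if n = 0 then {\<lambda>\<sigma>. 0}
      else coboundary (n - 1) S ` carrier (cochain_module (n - 1) S))"

definition cohomology ::
    "nat \<Rightarrow> 'a topology \<Rightarrow> ('r::comm_ring_1, ('a sing_simplex \<Rightarrow> 'r) set) module" where
  "cohomology n S =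
     quotient_module ((cochain_module n S)\<lparr>carrier := cocycles n S\<rparr>) (coboundaries n S)"

text \<open>The face of a singular \<open>(p + q)\<close>-simplex spanned by its first \<open>p + 1\<close> vertices,
  respectively by its last \<open>q + 1\<close> vertices.\<close>

definition front_face :: "nat \<Rightarrow> 'a sing_simplex \<Rightarrow> 'a sing_simplex" where
  "front_face p \<sigma> = restrict \<sigma> (standard_simplex p)"

definition back_face :: "nat \<Rightarrow> nat \<Rightarrow> 'a sing_simplex \<Rightarrow> 'a sing_simplex" where
  "back_face p q \<sigma> =
     restrict (\<lambda>x. \<sigma> (\<lambda>i. if i < p then 0 else x (i - p))) (standard_simplex q)"

definition cochain_cup :: "nat \<Rightarrow> nat \<Rightarrow> 'a topology \<Rightarrow>
    ('a sing_simplex \<Rightarrow> 'r::comm_ring_1) \<Rightarrow> ('a sing_simplex \<Rightarrow> 'r) \<Rightarrow> 'a sing_simplex \<Rightarrow> 'r" where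
  "cochain_cup p q S f g =
     (\<lambda>\<sigma>. if singular_simplex (p + q) S \<sigma>
          then f (front_face p \<sigma>) * g (back_face p q \<sigma>) else 0)"

text \<open>Operations on cohomology classes are given as the union of the cosets obtained from all
  choices of representatives; for cocycle representatives these cosets all coincide.\<close>

definition cup :: "nat \<Rightarrow> nat \<Rightarrow> 'a topology \<Rightarrow>
    ('a sing_simplex \<Rightarrow> 'r::comm_ring_1) set \<Rightarrow> ('a sing_simplex \<Rightarrow> 'r) set \<Rightarrow>
    ('a sing_simplex \<Rightarrow> 'r) set" where
  "cup p q S x y =
     (\<Union>f\<in>x. \<Union>g\<in>y. coboundaries (p + q) S +>\<^bsub>cochain_module (p + q) S\<^esub> cochain_cup p q S f g)"

definition cochain_pullback :: "nat \<Rightarrow> 'a topology \<Rightarrow> ('a \<Rightarrow> 'b) \<Rightarrow>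
    ('b sing_simplex \<Rightarrow> 'r::comm_ring_1) \<Rightarrow> 'a sing_simplex \<Rightarrow> 'r" where
  "cochain_pullback n S \<phi> f =
     (\<lambda>\<sigma>. if singular_simplex n S \<sigma> then f (simplex_map n \<phi> \<sigma>) else 0)"

definition pullback :: "nat \<Rightarrow> 'a topology \<Rightarrow> ('a \<Rightarrow> 'b) \<Rightarrow>
    ('b sing_simplex \<Rightarrow> 'r::comm_ring_1) set \<Rightarrow> ('a sing_simplex \<Rightarrow> 'r) set" where
  "pullback n S \<phi> x =
     (\<Union>f\<in>x. coboundaries n S +>\<^bsub>cochain_module n S\<^esub> cochain_pullback n S \<phi> f)"


section \<open>Isotropic submodules\<close>

definition isotropic :: "'a topology \<Rightarrow> ('a sing_simplex \<Rightarrow> 'r::comm_ring_1) set set \<Rightarrow> bool" where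
  "isotropic S H \<longleftrightarrow>
     submodule H (ring_of_type_algebra :: 'r ring) (cohomology 1 S) \<and>
     (\<forall>x\<in>H. \<forall>y\<in>H. cup 1 1 S x y = \<zero>\<^bsub>cohomology 2 S\<^esub>)"

definition maximal_isotropic ::
    "'a topology \<Rightarrow> ('a sing_simplex \<Rightarrow> 'r::comm_ring_1) set set \<Rightarrow> bool" where
  "maximal_isotropic S H \<longleftrightarrow> isotropic S H \<and> (\<forall>H'. isotropic S H' \<longrightarrow> \<not> H \<subset> H')"

definition isotropic_ranks :: "'r::comm_ring_1 itself \<Rightarrow> 'a topology \<Rightarrow> enat set" where
  "isotropic_ranks _ S =
     {module_rank (cohomology 1 S) H | H :: ('a sing_simplex \<Rightarrow> 'r) set set. maximal_isotropic S H}"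

definition isotropy_index :: "'r::comm_ring_1 itself \<Rightarrow> 'a topology \<Rightarrow> enat" where
  "isotropy_index R S = Max (isotropic_ranks R S)"

end

theory Submission
  imports Defs
begin

text \<open>A class in \<open>H\<^sup>1\<close> of a path connected space is determined by its values on the loops at a
base point (\<open>vanishing_on_loops\<close>), so \<open>H\<^sup>1\<close> embeds into a module of functions and is torsion-free
over a domain. On a product, the loop \<open>(\<alpha>, \<beta>)\<close> is homologous to \<open>\<alpha> \<times> y\<^sub>0 + x\<^sub>0 \<times> \<beta>\<close>, which gives
the Kuenneth decomposition \<open>x = p\<^sub>1\<^sup>*a + p\<^sub>2\<^sup>*b\<close> in degree one (\<open>kunneth\<close>).

Let \<open>x' = p\<^sub>1\<^sup>*a' + p\<^sub>2\<^sup>*b'\<close> be a second class. Restricted to the two factors, \<open>x \<smile> x' = 0\<close> gives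
\<open>a \<smile> a' = 0\<close> and \<open>b \<smile> b' = 0\<close>. Evaluated on the torus \<open>\<alpha> \<times> \<beta>\<close>, which is cut into two triangles, it
gives \<open>a(\<alpha>) b'(\<beta>) = a'(\<alpha>) b(\<beta>)\<close> for all loops (\<open>torus\<close>). If \<open>a\<close> and \<open>b\<close> are both nonzero, these
equations make \<open>x'\<close> proportional to \<open>x\<close>; hence an isotropic submodule with such a mixed element
has rank one, and one without mixed elements lies in one of the two summands
(\<open>isotropic_trichotomy\<close>). Conversely, any two elements of a submodule of rank one are multiples of a
single element of it (by the Bezout identity), so only squares matter. The square of a cocycle \<open>f\<close> is the
coboundary of \<open>- q \<circ> f\<close> whenever \<open>q (a + b) = q a + q b + a b\<close>; such a \<open>q\<close> is \<open>a\<^sup>2/2\<close> over a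
field of characteristic other than 2 and \<open>a (a - 1) / 2\<close> over the integers
(\<open>cup_square\<close>). The claims on sets of ranks and on the isotropy index follow formally from this
classification and from the existence of maximal isotropic submodules; this formal part is
the locale \<open>product_form\<close>.

Compactness enters through finite rank, which makes the maximum of the set of ranks meaningful,
and through Betti numbers, which are defined by homology. Both follow from \<open>finitely_generated\<close>:
on a closed manifold there are finitely many edges such that, modulo boundaries, every singular edge is
the sum of an integer combination of these and of a term that depends only on its end points. Consequently
a cocycle that vanishes on the finitely many edges is a coboundary, and
a homology class that is not torsion is detected by some cocycle
(\<open>nonzero_cohomology_of_betti\<close>), so that \<open>H\<^sup>1\<close> vanishes exactly if the Betti number does.\<close>

section \<open>Coefficient rings\<close>

text \<open>The properties shared by the fields and the ring of integers on which the argument rests. The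
function \<open>q\<close> of \<open>half_square\<close> is a quadratic refinement of the multiplication: it makes squares
of one-dimensional cocycles exact. Of the rings considered here, only fields have characteristic 2.\<close>

locale coefficient_ring =
  fixes R :: "'r::comm_ring_1 itself"
  assumes no_zero_divisors: "a * b = (0::'r) \<Longrightarrow> a = 0 \<or> b = 0"
    and bezout: "l \<noteq> (0::'r) \<Longrightarrow> \<exists>d l' m' s t. l = d * l' \<and> m = d * m' \<and> s * l' + t * m' = 1"
    and half_square: "CHAR('r) \<noteq> 2 \<Longrightarrow> \<exists>q :: 'r \<Rightarrow> 'r. \<forall>a b. q (a + b) = q a + q b + a * b"
    and char_2_inverse: "CHAR('r) = 2 \<Longrightarrow> a \<noteq> (0::'r) \<Longrightarrow> \<exists>b. a * b = 1"

lemma coefficient_ring_field: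
  assumes "field (ring_of_type_algebra :: 'r::comm_ring_1 ring)"
  shows "coefficient_ring TYPE('r)"
proof -
  interpret F: field "ring_of_type_algebra :: 'r ring" by fact
  have inv: "\<exists>b. a * b = 1" if "a \<noteq> 0" for a :: 'r
  proof -
    have "a \<in> Units (ring_of_type_algebra :: 'r ring)"
      using F.field_Units that by (simp add: ring_of_type_algebra_def)
    then show ?thesis by (auto simp: Units_def ring_of_type_algebra_def)
  qed
  show ?thesis
  proof
    show "a = 0 \<or> b = 0" if "a * b = 0" for a b :: 'r
    proof (rule ccontr)
      assume "\<not> (a = 0 \<or> b = 0)"
      then obtain c where "a * c = 1" "b \<noteq> 0" using inv by blast
      then have "b = c * (a * b)" by (metis mult.assoc mult.commute mult_1)
      with that \<open>b \<noteq> 0\<close> show False by simp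
    qed
    show "\<exists>d l' m' s t. l = d * l' \<and> m = d * m' \<and> s * l' + t * m' = 1" if "l \<noteq> 0" for l m :: 'r
    proof -
      obtain c where c: "l * c = 1" using inv \<open>l \<noteq> 0\<close> by blast
      have "l = l * 1 \<and> m = l * (c * m) \<and> 1 * 1 + 0 * (c * m) = 1"
        using c by (simp add: mult.assoc[symmetric])
      then show ?thesis by blast
    qed
    show "\<exists>q :: 'r \<Rightarrow> 'r. \<forall>a b. q (a + b) = q a + q b + a * b" if "CHAR('r) \<noteq> 2"
    proof -
      have "(2 :: 'r) \<noteq> 0"
      proof
        assume "(2 :: 'r) = 0"
        then have "of_nat 2 = (0 :: 'r)" by simp
        then have "CHAR('r) dvd 2" by (simp only: of_nat_eq_0_iff_char_dvd)
        then have "CHAR('r) = 1 \<or> CHAR('r) = 2"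
          by (metis prime_nat_iff two_is_prime_nat)
        then show False using that by simp
      qed
      then obtain i :: 'r where i: "2 * i = 1" using inv by blast
      have "i * (a + b) * (a + b) = i * a * a + i * b * b + a * b" for a b
      proof -
        have "i * (a + b) * (a + b) = i * a * a + i * b * b + (2 * i) * (a * b)"
          by (simp add: algebra_simps)
        then show ?thesis by (simp add: i)
      qed
      then show ?thesis by (intro exI[of _ "\<lambda>a. i * a * a"]) simp
    qed
  qed (use inv in blast)
qed

lemma coefficient_ring_int:
  assumes "(ring_of_type_algebra :: 'r::comm_ring_1 ring) \<simeq> \<Z>"
  shows "coefficient_ring TYPE('r)"
proof -
  obtain h where h: "h \<in> ring_iso (ring_of_type_algebra :: 'r ring) \<Z>"
    using assms by (auto simp: is_ring_iso_def)
  then have bij: "bij h" and add: "\<And>x y. h (x + y) = h x + h y"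
    and mult: "\<And>x y. h (x * y) = h x * h y" and one: "h 1 = 1"
    by (auto simp: ring_iso_def ring_hom_def ring_of_type_algebra_def)
  have zero: "h 0 = 0" using add[of 0 0] by simp
  define g where "g = inv_into UNIV h"
  have hg: "h (g i) = i" for i using bij by (simp add: g_def bij_is_surj surj_f_inv_f)
  have inj: "h x = h y \<longleftrightarrow> x = y" for x y using bij by (auto simp: bij_def inj_def)
  show ?thesis
  proof
    show "a = 0 \<or> b = 0" if "a * b = 0" for a b :: 'r
      using that mult[of a b] zero inj by (metis mult_eq_0_iff)
    show "\<exists>d l' m' s t. l = d * l' \<and> m = d * m' \<and> s * l' + t * m' = 1" if "l \<noteq> 0" for l m :: 'r
    proof -
      have "gcd (h l) (h m) \<noteq> 0" using that inj[of l 0] zero by auto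
      then obtain l' m' where lm: "h l = gcd (h l) (h m) * l'" "h m = gcd (h l) (h m) * m'" "coprime l' m'"
        using gcd_coprime_exists[of "h l" "h m"] by (metis mult.commute)
      obtain s t where st: "s * l' + t * m' = 1"
        using bezout_int[of l' m'] lm(3) by auto
      have "l = g (gcd (h l) (h m)) * g l'" "m = g (gcd (h l) (h m)) * g m'" "g s * g l' + g t * g m' = 1"
        using lm st by (simp_all add: inj[symmetric] mult add one hg)
      then show ?thesis by blast
    qed
    show "\<exists>q :: 'r \<Rightarrow> 'r. \<forall>a b. q (a + b) = q a + q b + a * b"
    proof (intro exI allI)
      fix a b
      define T where "T = (\<lambda>m::int. m * (m - 1) div 2)"
      have T2: "2 * T m = m * (m - 1)" for m by (simp add: T_def)
      have "2 * T (m + n) = 2 * (T m + T n + m * n)" for m n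
        unfolding distrib_left T2 by (simp add: algebra_simps)
      from this[of m n for m n] have "T (m + n) = T m + T n + m * n" for m n by (metis mult_cancel_left zero_neq_numeral)
      then show "g (T (h (a + b))) = g (T (h a)) + g (T (h b)) + a * b"
        by (simp add: inj[symmetric] mult add hg)
    qed
    show "\<exists>b. a * b = 1" if "CHAR('r) = 2" for a :: 'r
    proof -
      have "of_nat 2 = (0 :: 'r)" using of_nat_CHAR[where 'a = 'r] that by simp
      then have "(1 :: 'r) + 1 = 0" by simp
      then have "h (1 + 1) = 0" by (simp only: zero)
      then have "h 1 + h 1 = 0" by (simp only: add)
      then show ?thesis by (simp add: one)
    qed
  qed
qed

section \<open>Modules separated by linear functionals\<close>

lemma ring_of_type_simps [simp]:
  "carrier (ring_of_type_algebra :: 'r::comm_ring_1 ring) = UNIV"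
  "add (ring_of_type_algebra :: 'r::comm_ring_1 ring) = (+)"
  "mult (ring_of_type_algebra :: 'r::comm_ring_1 ring) = (*)"
  "one (ring_of_type_algebra :: 'r::comm_ring_1 ring) = 1"
  "zero (ring_of_type_algebra :: 'r::comm_ring_1 ring) = 0"
  by (auto simp: ring_of_type_algebra_def)

text \<open>A module whose elements are separated by the linear functionals \<open>\<lambda>x. ev x l\<close>. In the application
\<open>l\<close> ranges over loops; linear dependence becomes an identity between functions, and
over a domain torsion-freeness comes for free.\<close>

locale evaluated_module = coefficient_ring R for R :: "'r::comm_ring_1 itself" +
  fixes V :: "('r, 'm) module" and ev :: "'m \<Rightarrow> 'l \<Rightarrow> 'r"
  assumes is_module: "module (ring_of_type_algebra :: 'r ring) V"
    and ev_inj: "x \<in> carrier V \<Longrightarrow> y \<in> carrier V \<Longrightarrow> ev x = ev y \<Longrightarrow> x = y"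
    and ev_add: "x \<in> carrier V \<Longrightarrow> y \<in> carrier V \<Longrightarrow> ev (x \<oplus>\<^bsub>V\<^esub> y) l = ev x l + ev y l"
    and ev_smult: "x \<in> carrier V \<Longrightarrow> ev (r \<odot>\<^bsub>V\<^esub> x) l = r * ev x l"
begin

sublocale M: module "ring_of_type_algebra :: 'r ring" V
  by (rule is_module)

lemma ev_zero [simp]: "ev \<zero>\<^bsub>V\<^esub> l = 0"
  using ev_add[of "\<zero>\<^bsub>V\<^esub>" "\<zero>\<^bsub>V\<^esub>" l] by simp

lemma ev_eq_0: "x \<in> carrier V \<Longrightarrow> (\<forall>l. ev x l = 0) \<longleftrightarrow> x = \<zero>\<^bsub>V\<^esub>"
  by (metis M.zero_closed ev_inj ev_zero ext)

lemma smult_in [simp]: "x \<in> carrier V \<Longrightarrow> r \<odot>\<^bsub>V\<^esub> x \<in> carrier V"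
  by simp

lemma ev_finsum: "finite B \<Longrightarrow> g \<in> B \<rightarrow> carrier V \<Longrightarrow> ev (finsum V g B) l = (\<Sum>b\<in>B. ev (g b) l)"
proof (induction rule: finite_induct)
  case (insert b B)
  then show ?case using ev_add[of "g b" "finsum V g B" l] by auto
qed simp

lemma lin_indep_iff:
  assumes "finite B" "B \<subseteq> carrier V"
  shows "lin_indep V B \<longleftrightarrow> (\<forall>a. (\<forall>l. (\<Sum>b\<in>B. a b * ev b l) = 0) \<longrightarrow> (\<forall>b\<in>B. a b = 0))"
proof -
  have "(\<Oplus>\<^bsub>V\<^esub>b\<in>B. a b \<odot>\<^bsub>V\<^esub> b) = \<zero>\<^bsub>V\<^esub> \<longleftrightarrow> (\<forall>l. (\<Sum>b\<in>B. a b * ev b l) = 0)" for a :: "'m \<Rightarrow> 'r"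
  proof -
    have g: "(\<lambda>b. a b \<odot>\<^bsub>V\<^esub> b) \<in> B \<rightarrow> carrier V" using assms by auto
    have "ev (\<Oplus>\<^bsub>V\<^esub>b\<in>B. a b \<odot>\<^bsub>V\<^esub> b) l = (\<Sum>b\<in>B. a b * ev b l)" for l
      unfolding ev_finsum[OF assms(1) g]
      by (rule sum.cong) (use assms ev_smult in auto)
    then show ?thesis using ev_eq_0[OF M.finsum_closed[OF g]] by simp
  qed
  then show ?thesis by (simp add: lin_indep_def)
qed

lemma lin_indep_singleton: "x \<in> carrier V \<Longrightarrow> lin_indep V {x} \<longleftrightarrow> x \<noteq> \<zero>\<^bsub>V\<^esub>"
proof -
  assume x: "x \<in> carrier V"
  have "lin_indep V {x} \<longleftrightarrow> (\<forall>a :: 'm \<Rightarrow> 'r. (\<forall>l. a x * ev x l = 0) \<longrightarrow> a x = 0)"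
    using lin_indep_iff[of "{x}"] x by simp
  also have "\<dots> \<longleftrightarrow> (\<exists>l. ev x l \<noteq> 0)"
  proof
    assume *: "\<forall>a :: 'm \<Rightarrow> 'r. (\<forall>l. a x * ev x l = 0) \<longrightarrow> a x = 0"
    show "\<exists>l. ev x l \<noteq> 0" using *[rule_format, of "\<lambda>_. 1"] by auto
  qed (use no_zero_divisors in blast)
  finally show ?thesis using ev_eq_0[OF x] by blast
qed

lemma rank_geI: "finite B \<Longrightarrow> B \<subseteq> H \<Longrightarrow> lin_indep V B \<Longrightarrow> enat (card B) \<le> module_rank V H"
  unfolding module_rank_def by (rule SUP_upper) auto

lemma rank_leI:
  "(\<And>B. finite B \<Longrightarrow> B \<subseteq> H \<Longrightarrow> lin_indep V B \<Longrightarrow> card B \<le> n) \<Longrightarrow> module_rank V H \<le> enat n"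
  unfolding module_rank_def by (rule SUP_least) auto

lemma rank_mono: "H \<subseteq> H' \<Longrightarrow> module_rank V H \<le> module_rank V H'"
  unfolding module_rank_def by (rule SUP_subset_mono) auto

lemma rank_eq_0_iff:
  assumes "H \<subseteq> carrier V"
  shows "module_rank V H = 0 \<longleftrightarrow> H \<subseteq> {\<zero>\<^bsub>V\<^esub>}"
proof
  assume 0: "module_rank V H = 0"
  show "H \<subseteq> {\<zero>\<^bsub>V\<^esub>}"
  proof
    fix x assume "x \<in> H"
    with 0 rank_geI[of "{x}" H] have "\<not> lin_indep V {x}" by (auto simp: zero_enat_def)
    then show "x \<in> {\<zero>\<^bsub>V\<^esub>}" using lin_indep_singleton \<open>x \<in> H\<close> assms by blast
  qed
next
  assume H: "H \<subseteq> {\<zero>\<^bsub>V\<^esub>}"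
  have "module_rank V H \<le> enat 0"
  proof (rule rank_leI)
    fix B assume B: "finite B" "B \<subseteq> H" "lin_indep V B"
    then have "B = {} \<or> B = {\<zero>\<^bsub>V\<^esub>}" using H by auto
    then show "card B \<le> 0" using B lin_indep_singleton[of "\<zero>\<^bsub>V\<^esub>"] by auto
  qed
  then show "module_rank V H = 0" by (simp add: zero_enat_def[symmetric])
qed

definition dependent :: "'m \<Rightarrow> 'm \<Rightarrow> bool" where
  "dependent x y \<longleftrightarrow> (\<exists>l m. (l \<noteq> 0 \<or> m \<noteq> 0) \<and> (\<forall>i. l * ev y i = m * ev x i))"

lemma rank_eq_1_iff:
  assumes "H \<subseteq> carrier V"
  shows "module_rank V H = 1 \<longleftrightarrow> \<not> H \<subseteq> {\<zero>\<^bsub>V\<^esub>} \<and> (\<forall>x\<in>H. \<forall>y\<in>H. dependent x y)"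
proof (intro iffI conjI ballI)
  assume 1: "module_rank V H = 1"
  then show "\<not> H \<subseteq> {\<zero>\<^bsub>V\<^esub>}" using rank_eq_0_iff[OF assms] by auto
  fix x y assume xy: "x \<in> H" "y \<in> H"
  show "dependent x y"
  proof (cases "x = y")
    case True
    then show ?thesis unfolding dependent_def by (intro exI[of _ 1]) auto
  next
    case False
    then have "\<not> lin_indep V {x, y}"
      using rank_geI[of "{x, y}" H] 1 xy by (auto simp: one_enat_def)
    then obtain a where a: "\<And>l. a x * ev x l + a y * ev y l = 0" "a x \<noteq> 0 \<or> a y \<noteq> 0"
      using lin_indep_iff[of "{x, y}"] subsetD[OF assms xy(1)] subsetD[OF assms xy(2)] False by auto
    have "a y * ev y l = (- a x) * ev x l" for l
      using a(1)[of l] by (simp add: add_eq_0_iff)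
    then show ?thesis unfolding dependent_def using a(2)
      by (intro exI[of _ "a y"] exI[of _ "- a x"]) auto
  qed
next
  assume *: "\<not> H \<subseteq> {\<zero>\<^bsub>V\<^esub>} \<and> (\<forall>x\<in>H. \<forall>y\<in>H. dependent x y)"
  then obtain x where x: "x \<in> H" "x \<noteq> \<zero>\<^bsub>V\<^esub>" by blast
  have "lin_indep V {x}" using x assms lin_indep_singleton by blast
  then have "enat 1 \<le> module_rank V H" using rank_geI[of "{x}" H] x by simp
  moreover have "module_rank V H \<le> enat 1"
  proof (rule rank_leI)
    fix B assume B: "finite B" "B \<subseteq> H" "lin_indep V B"
    show "card B \<le> 1"
    proof (rule ccontr)
      assume "\<not> card B \<le> 1"
      then obtain x y where xy: "x \<in> B" "y \<in> B" "x \<noteq> y"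
        by (metis One_nat_def card_le_Suc0_iff_eq B(1))
      then have "dependent x y" using * B by blast
      then obtain l m where lm: "l \<noteq> 0 \<or> m \<noteq> 0" "\<And>i. l * ev y i = m * ev x i"
        unfolding dependent_def by blast
      define a where "a = (\<lambda>b. if b = y then l else if b = x then - m else 0)"
      have "(\<Sum>b\<in>B. a b * ev b i) = (\<Sum>b\<in>{x, y}. a b * ev b i)" for i
        by (rule sum.mono_neutral_right) (use B xy in \<open>auto simp: a_def\<close>)
      then have "(\<Sum>b\<in>B. a b * ev b i) = 0" for i
        using xy(3) lm(2)[of i] by (simp add: a_def)
      moreover have "a x \<noteq> 0 \<or> a y \<noteq> 0" using lm(1) xy(3) by (auto simp: a_def)
      ultimately show False
        using B lin_indep_iff[of B] assms xy by blast
    qed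
  qed
  ultimately show "module_rank V H = 1" by (simp add: one_enat_def)
qed

lemma submodule_iff:
  "submodule H (ring_of_type_algebra :: 'r ring) V \<longleftrightarrow>
     H \<subseteq> carrier V \<and> \<zero>\<^bsub>V\<^esub> \<in> H \<and> (\<forall>x\<in>H. \<forall>y\<in>H. x \<oplus>\<^bsub>V\<^esub> y \<in> H) \<and> (\<forall>r. \<forall>x\<in>H. r \<odot>\<^bsub>V\<^esub> x \<in> H)"
  (is "?L \<longleftrightarrow> ?R")
proof
  assume L: ?L
  have "\<zero>\<^bsub>V\<^esub> \<in> H" using submodule.axioms(1)[OF L] subgroup.one_closed by fastforce
  then show ?R using M.submoduleE[OF L] by auto
next
  assume R: ?R
  show ?L
  proof (rule M.submoduleI)
    fix a assume a: "a \<in> H"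
    then have "a \<in> carrier V" using R by blast
    then have "(- 1) \<odot>\<^bsub>V\<^esub> a \<oplus>\<^bsub>V\<^esub> a = \<zero>\<^bsub>V\<^esub>"
      by (intro ev_inj) (auto simp: ev_add ev_smult)
    then have "\<ominus>\<^bsub>V\<^esub> a = (- 1) \<odot>\<^bsub>V\<^esub> a"
      using \<open>a \<in> carrier V\<close> by (intro M.minus_equality) auto
    then show "\<ominus>\<^bsub>V\<^esub> a \<in> H" using R a by simp
  qed (use R in auto)
qed

end

section \<open>Isotropic submodules for a symmetric relation\<close>

text \<open>Everything about ranks of maximal isotropic submodules is formal in the relation \<open>I x y\<close>, which stands
for \<open>x \<smile> y = 0\<close>; working with a relation keeps the second cohomology out of the algebra.\<close>

definition isotropic_for :: "('r::comm_ring_1, 'm) module \<Rightarrow> ('m \<Rightarrow> 'm \<Rightarrow> bool) \<Rightarrow> 'm set \<Rightarrow> bool" where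
  "isotropic_for V I H \<longleftrightarrow>
     submodule H (ring_of_type_algebra :: 'r ring) V \<and> (\<forall>x\<in>H. \<forall>y\<in>H. I x y)"

definition maximal_isotropic_for ::
    "('r::comm_ring_1, 'm) module \<Rightarrow> ('m \<Rightarrow> 'm \<Rightarrow> bool) \<Rightarrow> 'm set \<Rightarrow> bool" where
  "maximal_isotropic_for V I H \<longleftrightarrow>
     isotropic_for V I H \<and> (\<forall>H'. isotropic_for V I H' \<longrightarrow> \<not> H \<subset> H')"

definition isotropic_ranks_for ::
    "('r::comm_ring_1, 'm) module \<Rightarrow> ('m \<Rightarrow> 'm \<Rightarrow> bool) \<Rightarrow> enat set" where
  "isotropic_ranks_for V I = {module_rank V H | H. maximal_isotropic_for V I H}"

locale cup_form = evaluated_module R V ev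
  for R :: "'r::comm_ring_1 itself" and V :: "('r, 'm) module" and ev :: "'m \<Rightarrow> 'l \<Rightarrow> 'r" +
  fixes I :: "'m \<Rightarrow> 'm \<Rightarrow> bool"
  assumes I_sym: "x \<in> carrier V \<Longrightarrow> y \<in> carrier V \<Longrightarrow> I x y \<Longrightarrow> I y x"
    and I_add: "x \<in> carrier V \<Longrightarrow> x' \<in> carrier V \<Longrightarrow> y \<in> carrier V \<Longrightarrow>
      I x y \<Longrightarrow> I x' y \<Longrightarrow> I (x \<oplus>\<^bsub>V\<^esub> x') y"
    and I_smult: "x \<in> carrier V \<Longrightarrow> y \<in> carrier V \<Longrightarrow> I x y \<Longrightarrow> I (r \<odot>\<^bsub>V\<^esub> x) y"
    and I_zero: "x \<in> carrier V \<Longrightarrow> I \<zero>\<^bsub>V\<^esub> x"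
    and I_alternating: "x \<in> carrier V \<Longrightarrow> CHAR('r) \<noteq> 2 \<Longrightarrow> I x x"
    and finite_rank: "module_rank V (carrier V) \<noteq> \<infinity>"
begin

lemma I_smult2: "x \<in> carrier V \<Longrightarrow> y \<in> carrier V \<Longrightarrow> I x y \<Longrightarrow> I (r \<odot>\<^bsub>V\<^esub> x) (s \<odot>\<^bsub>V\<^esub> y)"
  by (meson I_smult I_sym smult_in)

lemma isotropic_subset: "isotropic_for V I H \<Longrightarrow> H \<subseteq> carrier V"
  by (simp add: isotropic_for_def submodule_iff)

lemma isotropic_zero: "isotropic_for V I {\<zero>\<^bsub>V\<^esub>}"
  using I_zero by (auto simp: isotropic_for_def submodule_iff intro!: ev_inj simp: ev_smult)

lemma isotropic_span:
  assumes "x \<in> carrier V" "I x x"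
  shows "isotropic_for V I (range (\<lambda>r. r \<odot>\<^bsub>V\<^esub> x))"
proof -
  have "\<zero>\<^bsub>V\<^esub> = 0 \<odot>\<^bsub>V\<^esub> x" using assms by (intro ev_inj) (auto simp: ev_smult)
  moreover have "r \<odot>\<^bsub>V\<^esub> x \<oplus>\<^bsub>V\<^esub> s \<odot>\<^bsub>V\<^esub> x = (r + s) \<odot>\<^bsub>V\<^esub> x" for r s
    using assms by (intro ev_inj) (auto simp: ev_smult ev_add algebra_simps)
  moreover have "r \<odot>\<^bsub>V\<^esub> (s \<odot>\<^bsub>V\<^esub> x) = (r * s) \<odot>\<^bsub>V\<^esub> x" for r s
    using assms by (intro ev_inj) (auto simp: ev_smult)
  ultimately show ?thesis
    using assms I_smult2 by (auto simp: isotropic_for_def submodule_iff)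
qed

lemma in_span: "x \<in> carrier V \<Longrightarrow> x \<in> range (\<lambda>r. r \<odot>\<^bsub>V\<^esub> x)"
  by (rule range_eqI[of _ _ 1]) (auto intro!: ev_inj simp: ev_smult)

text \<open>Zorn's lemma: two elements of the union of a chain lie in a common member, so isotropy and closure
under the module operations pass to the union. A submodule of maximal rank would not do
over the integers, where it can have proper extensions of the same rank.\<close>

lemma isotropic_extends_to_maximal:
  assumes "isotropic_for V I H"
  obtains H' where "maximal_isotropic_for V I H'" "H \<subseteq> H'"
proof -
  define A where "A = {K. isotropic_for V I K \<and> H \<subseteq> K}"
  have "\<exists>K\<in>A. \<forall>L\<in>A. K \<subseteq> L \<longrightarrow> L = K"
  proof (rule subset_Zorn_nonempty)
    show "A \<noteq> {}" using assms by (auto simp: A_def)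
    fix C assume C: "C \<noteq> {}" "subset.chain A C"
    have in_A: "K \<in> A" if "K \<in> C" for K using C(2) that by (auto simp: subset_chain_def)
    have joint: "\<exists>K\<in>C. x \<in> K \<and> y \<in> K" if "x \<in> \<Union>C" "y \<in> \<Union>C" for x y
      using that C(2) unfolding subset_chain_def by blast
    have closed: "isotropic_for V I K" "H \<subseteq> K" if "K \<in> C" for K
      using in_A[OF that] by (auto simp: A_def)
    have "submodule (\<Union>C) (ring_of_type_algebra :: 'r ring) V"
      unfolding submodule_iff
    proof (intro conjI ballI allI)
      show "\<Union>C \<subseteq> carrier V" using closed isotropic_subset by blast
      show "\<zero>\<^bsub>V\<^esub> \<in> \<Union>C" using C(1) closed by (auto simp: isotropic_for_def submodule_iff)
      show "r \<odot>\<^bsub>V\<^esub> x \<in> \<Union>C" if "x \<in> \<Union>C" for r x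
        using that closed by (auto simp: isotropic_for_def submodule_iff)
      show "x \<oplus>\<^bsub>V\<^esub> y \<in> \<Union>C" if "x \<in> \<Union>C" "y \<in> \<Union>C" for x y
      proof -
        obtain K where "K \<in> C" "x \<in> K" "y \<in> K" using joint[OF \<open>x \<in> \<Union>C\<close> \<open>y \<in> \<Union>C\<close>] by blast
        then show ?thesis using closed(1)[of K] by (auto simp: isotropic_for_def submodule_iff)
      qed
    qed
    moreover have "I x y" if "x \<in> \<Union>C" "y \<in> \<Union>C" for x y
    proof -
      obtain K where "K \<in> C" "x \<in> K" "y \<in> K" using joint[OF \<open>x \<in> \<Union>C\<close> \<open>y \<in> \<Union>C\<close>] by blast
      then show ?thesis using closed(1)[of K] by (auto simp: isotropic_for_def)
    qed
    moreover have "H \<subseteq> \<Union>C" using C(1) closed(2) by blast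
    ultimately show "\<Union>C \<in> A" by (auto simp: A_def isotropic_for_def)
  qed
  then obtain K where K: "isotropic_for V I K" "H \<subseteq> K"
      "\<And>L. isotropic_for V I L \<Longrightarrow> H \<subseteq> L \<Longrightarrow> K \<subseteq> L \<Longrightarrow> L = K"
    by (auto simp: A_def)
  have "\<not> K \<subset> L" if "isotropic_for V I L" for L
    using K(2) K(3)[OF that] by auto
  then have "maximal_isotropic_for V I K"
    using K(1) by (simp add: maximal_isotropic_for_def)
  then show thesis using that K(2) by simp
qed

lemma ranks_nonempty: "isotropic_ranks_for V I \<noteq> {}"
proof -
  obtain H where "maximal_isotropic_for V I H"
    by (rule isotropic_extends_to_maximal[OF isotropic_zero])
  then show ?thesis by (auto simp: isotropic_ranks_for_def)
qed

lemma ranks_finite: "finite (isotropic_ranks_for V I)"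
proof -
  obtain n where n: "module_rank V (carrier V) = enat n" using finite_rank by auto
  have "isotropic_ranks_for V I \<subseteq> {..enat n}"
    using rank_mono[OF isotropic_subset] n
    by (auto simp: isotropic_ranks_for_def maximal_isotropic_for_def)
  then show ?thesis using finite_subset finite_enat_bounded[of "{..enat n}" n] by auto
qed

text \<open>A maximal isotropic submodule of rank zero is the zero submodule, and a nonzero \<open>x\<close> with \<open>I x x\<close>
would span a larger isotropic one. Rank zero and positive ranks can therefore not occur together.\<close>

lemma zero_rank_iff:
  "0 \<in> isotropic_ranks_for V I \<longleftrightarrow> (\<forall>x\<in>carrier V. I x x \<longrightarrow> x = \<zero>\<^bsub>V\<^esub>)"
proof
  assume "0 \<in> isotropic_ranks_for V I"
  then obtain H where H: "maximal_isotropic_for V I H" "module_rank V H = 0"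
    by (auto simp: isotropic_ranks_for_def)
  then have iso: "isotropic_for V I H" by (simp add: maximal_isotropic_for_def)
  then have "H = {\<zero>\<^bsub>V\<^esub>}"
    using rank_eq_0_iff[OF isotropic_subset[OF iso]] H(2) by (auto simp: isotropic_for_def submodule_iff)
  then have max: "\<not> {\<zero>\<^bsub>V\<^esub>} \<subset> H'" if "isotropic_for V I H'" for H'
    using H(1) that by (simp add: maximal_isotropic_for_def)
  show "\<forall>x\<in>carrier V. I x x \<longrightarrow> x = \<zero>\<^bsub>V\<^esub>"
  proof (intro ballI impI)
    fix x assume x: "x \<in> carrier V" "I x x"
    have "\<not> {\<zero>\<^bsub>V\<^esub>} \<subset> range (\<lambda>r. r \<odot>\<^bsub>V\<^esub> x)" using max isotropic_span[OF x] by blast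
    moreover have "\<zero>\<^bsub>V\<^esub> \<in> range (\<lambda>r. r \<odot>\<^bsub>V\<^esub> x)"
      using isotropic_span[OF x] by (auto simp: isotropic_for_def submodule_iff)
    ultimately have "range (\<lambda>r. r \<odot>\<^bsub>V\<^esub> x) = {\<zero>\<^bsub>V\<^esub>}" by blast
    then show "x = \<zero>\<^bsub>V\<^esub>" using in_span[OF x(1)] by simp
  qed
next
  assume *: "\<forall>x\<in>carrier V. I x x \<longrightarrow> x = \<zero>\<^bsub>V\<^esub>"
  obtain H where H: "maximal_isotropic_for V I H"
    by (rule isotropic_extends_to_maximal[OF isotropic_zero])
  then have "H \<subseteq> {\<zero>\<^bsub>V\<^esub>}"
    using * isotropic_subset[of H] by (auto simp: maximal_isotropic_for_def isotropic_for_def)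
  then have "module_rank V H = 0"
    using rank_eq_0_iff[of H] by auto
  then show "0 \<in> isotropic_ranks_for V I"
    using H unfolding isotropic_ranks_for_def by force
qed

lemma anisotropic_ranks:
  assumes "\<forall>x\<in>carrier V. I x x \<longrightarrow> x = \<zero>\<^bsub>V\<^esub>"
  shows "isotropic_ranks_for V I = {0}"
proof -
  have "module_rank V H = 0" if "isotropic_for V I H" for H
  proof -
    have "H \<subseteq> {\<zero>\<^bsub>V\<^esub>}" using assms isotropic_subset[OF that] that by (auto simp: isotropic_for_def)
    then show ?thesis using rank_eq_0_iff[OF isotropic_subset[OF that]] by blast
  qed
  then have "isotropic_ranks_for V I \<subseteq> {0}"
    by (auto simp: isotropic_ranks_for_def maximal_isotropic_for_def)
  then show ?thesis using ranks_nonempty by blast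
qed

lemma index_eq_0_iff:
  "Max (isotropic_ranks_for V I) = 0 \<longleftrightarrow> (\<forall>x\<in>carrier V. I x x \<longrightarrow> x = \<zero>\<^bsub>V\<^esub>)"
proof
  assume "Max (isotropic_ranks_for V I) = 0"
  then have "0 \<in> isotropic_ranks_for V I" using Max_in[OF ranks_finite ranks_nonempty] by simp
  then show "\<forall>x\<in>carrier V. I x x \<longrightarrow> x = \<zero>\<^bsub>V\<^esub>" by (simp add: zero_rank_iff)
qed (simp add: anisotropic_ranks)

text \<open>If \<open>l y = m x\<close>, dividing by a greatest common divisor (\<open>H\<close> is torsion-free) gives
\<open>l' y = m' x\<close> with \<open>s l' + t m' = 1\<close>. Then \<open>z = s x + t y\<close> satisfies \<open>x = l' z\<close> and \<open>y = m' z\<close>,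
which reduces \<open>I x y\<close> to \<open>I z z\<close>.\<close>

lemma rank_1_isotropic:
  assumes H: "submodule H (ring_of_type_algebra :: 'r ring) V" and rank: "module_rank V H = 1"
    and sq: "CHAR('r) = 2 \<Longrightarrow> \<forall>x\<in>H. I x x"
  shows "isotropic_for V I H"
  unfolding isotropic_for_def
proof (intro conjI ballI H)
  have HV: "H \<subseteq> carrier V" using H by (simp add: submodule_iff)
  fix x y assume xy: "x \<in> H" "y \<in> H"
  then have c: "x \<in> carrier V" "y \<in> carrier V" using HV by auto
  show "I x y"
  proof (cases "x = \<zero>\<^bsub>V\<^esub>")
    case True
    then show ?thesis using I_zero c by simp
  next
    case False
    have "dependent x y" using rank_eq_1_iff[OF HV] rank xy by blast
    then obtain l m where lm: "l \<noteq> 0 \<or> m \<noteq> 0" "\<And>i. l * ev y i = m * ev x i"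
      unfolding dependent_def by blast
    have "l \<noteq> 0"
    proof
      assume "l = 0"
      then have "\<forall>i. ev x i = 0" using lm no_zero_divisors by (metis mult_zero_left)
      then show False using False ev_eq_0[OF c(1)] by blast
    qed
    then obtain d l' m' s t where d: "l = d * l'" "m = d * m'" "s * l' + t * m' = 1"
      using bezout[of l m] by blast
    have "d \<noteq> 0" using \<open>l \<noteq> 0\<close> d by auto
    have eq: "l' * ev y i = m' * ev x i" for i
    proof -
      have "d * (l' * ev y i - m' * ev x i) = 0"
        using lm(2)[of i] d by (simp add: algebra_simps)
      then show ?thesis using no_zero_divisors \<open>d \<noteq> 0\<close> by fastforce
    qed
    define z where "z = s \<odot>\<^bsub>V\<^esub> x \<oplus>\<^bsub>V\<^esub> t \<odot>\<^bsub>V\<^esub> y"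
    have z: "z \<in> H" using H xy by (auto simp: z_def submodule_iff)
    then have zc: "z \<in> carrier V" using HV by blast
    have "ev (l' \<odot>\<^bsub>V\<^esub> z) i = ev x i" for i
    proof -
      have "ev (l' \<odot>\<^bsub>V\<^esub> z) i = (s * l') * ev x i + t * (l' * ev y i)"
        using c zc by (simp add: z_def ev_smult ev_add algebra_simps)
      also have "\<dots> = (s * l' + t * m') * ev x i" by (simp add: eq algebra_simps)
      finally show ?thesis by (simp add: d)
    qed
    then have x: "x = l' \<odot>\<^bsub>V\<^esub> z" using c zc by (intro ev_inj) auto
    have "ev (m' \<odot>\<^bsub>V\<^esub> z) i = ev y i" for i
    proof -
      have "ev (m' \<odot>\<^bsub>V\<^esub> z) i = s * (m' * ev x i) + (t * m') * ev y i"
        using c zc by (simp add: z_def ev_smult ev_add algebra_simps)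
      also have "\<dots> = (s * l' + t * m') * ev y i" by (simp add: eq[symmetric] algebra_simps)
      finally show ?thesis by (simp add: d)
    qed
    then have y: "y = m' \<odot>\<^bsub>V\<^esub> z" using c zc by (intro ev_inj) auto
    have "I z z" using sq I_alternating z zc by blast
    then show ?thesis unfolding x y using zc by (intro I_smult2) auto
  qed
qed

text \<open>The index vanishes exactly if no nonzero \<open>x\<close> satisfies \<open>I x x\<close>. In characteristic other than 2 this
means that the module is zero. In characteristic 2 the coefficients form a field, so if any two
elements are dependent, a nonzero \<open>w\<close> with \<open>I w w\<close> would span the module and make \<open>I\<close> hold everywhere.\<close>

lemma index_eq_0_iff_betti:
  fixes b :: enat
  assumes b0: "b = 0 \<longleftrightarrow> carrier V \<subseteq> {\<zero>\<^bsub>V\<^esub>}"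
    and b1: "b = 1 \<Longrightarrow> \<forall>x\<in>carrier V. \<forall>y\<in>carrier V. dependent x y"
  shows "Max (isotropic_ranks_for V I) = 0 \<longleftrightarrow>
     b = 0 \<or> (b = 1 \<and> CHAR('r) = 2 \<and> (\<exists>x\<in>carrier V. \<exists>y\<in>carrier V. \<not> I x y)) \<or>
     (b > 1 \<and> CHAR('r) = 2 \<and> (\<forall>x\<in>carrier V. x \<noteq> \<zero>\<^bsub>V\<^esub> \<longrightarrow> \<not> I x x))"
    (is "?idx = 0 \<longleftrightarrow> ?B0 \<or> ?B1 \<or> ?B2")
proof
  assume "?idx = 0"
  then have *: "\<forall>x\<in>carrier V. I x x \<longrightarrow> x = \<zero>\<^bsub>V\<^esub>" by (simp add: index_eq_0_iff)
  show "?B0 \<or> ?B1 \<or> ?B2"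
  proof (cases "b = 0")
    case False
    then obtain x where x: "x \<in> carrier V" "x \<noteq> \<zero>\<^bsub>V\<^esub>" using b0 by blast
    then have nI: "\<not> I x x" using * by blast
    then have char: "CHAR('r) = 2" using I_alternating x by blast
    have "b = 1 \<or> b > 1"
      using False by (cases b) (auto simp: zero_enat_def one_enat_def)
    then show ?thesis using nI char x * by blast
  qed simp
next
  assume B: "?B0 \<or> ?B1 \<or> ?B2"
  show "?idx = 0"
    unfolding index_eq_0_iff
  proof (intro ballI impI)
    fix w assume w: "w \<in> carrier V" "I w w"
    from B consider ?B0 | ?B1 | ?B2 by blast
    then show "w = \<zero>\<^bsub>V\<^esub>"
    proof cases
      case 1
      then show ?thesis using b0 w by blast
    next
      case 2
      then have char: "CHAR('r) = 2" by blast
      obtain x y where xy: "x \<in> carrier V" "y \<in> carrier V" "\<not> I x y" using 2 by blast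
      show ?thesis
      proof (rule ccontr)
        assume w0: "w \<noteq> \<zero>\<^bsub>V\<^esub>"
        have multiple: "\<exists>r. z = r \<odot>\<^bsub>V\<^esub> w" if z: "z \<in> carrier V" for z
        proof -
          have "dependent w z" using b1 2 w z by blast
          then obtain l m where lm: "l \<noteq> 0 \<or> m \<noteq> 0" "\<And>i. l * ev z i = m * ev w i"
            unfolding dependent_def by blast
          have "l \<noteq> 0"
          proof
            assume "l = 0"
            then have "\<forall>i. ev w i = 0" using lm no_zero_divisors by (metis mult_zero_left)
            then show False using w0 ev_eq_0[OF w(1)] by blast
          qed
          then obtain l' where "l * l' = 1" using char_2_inverse[OF char] by blast
          then have "ev z i = l' * m * ev w i" for i
            by (metis lm(2) mult.assoc mult.commute mult_1)
          then have "z = (l' * m) \<odot>\<^bsub>V\<^esub> w"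
            using z w by (intro ev_inj) (auto simp: ev_smult)
          then show ?thesis by blast
        qed
        then show False using xy w I_smult2 by metis
      qed
    next
      case 3
      then show ?thesis using w by blast
    qed
  qed
qed

end

section \<open>The form of a product\<close>

text \<open>The algebraic shadow of a product of two spaces. The equation between the values of \<open>ev1\<close> and \<open>ev2\<close> in
\<open>I_sum\<close> is what remains of the component of the cup product in \<open>H\<^sup>1 \<otimes> H\<^sup>1\<close> of the factors.\<close>

locale product_form =
  V1: cup_form R V1 ev1 I1 + V2: cup_form R V2 ev2 I2 + V: cup_form R V ev I
  for R :: "'r::comm_ring_1 itself"
    and V1 :: "('r, 'm1) module" and ev1 :: "'m1 \<Rightarrow> 'l1 \<Rightarrow> 'r" and I1
    and V2 :: "('r, 'm2) module" and ev2 :: "'m2 \<Rightarrow> 'l2 \<Rightarrow> 'r" and I2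
    and V :: "('r, 'm) module" and ev :: "'m \<Rightarrow> 'l \<Rightarrow> 'r" and I +
  fixes p1 :: "'m1 \<Rightarrow> 'm" and p2 :: "'m2 \<Rightarrow> 'm"
  assumes p1_in [simp]: "a \<in> carrier V1 \<Longrightarrow> p1 a \<in> carrier V"
    and p2_in [simp]: "b \<in> carrier V2 \<Longrightarrow> p2 b \<in> carrier V"
    and p1_add: "a \<in> carrier V1 \<Longrightarrow> a' \<in> carrier V1 \<Longrightarrow> p1 (a \<oplus>\<^bsub>V1\<^esub> a') = p1 a \<oplus>\<^bsub>V\<^esub> p1 a'"
    and p2_add: "b \<in> carrier V2 \<Longrightarrow> b' \<in> carrier V2 \<Longrightarrow> p2 (b \<oplus>\<^bsub>V2\<^esub> b') = p2 b \<oplus>\<^bsub>V\<^esub> p2 b'"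
    and p1_smult: "a \<in> carrier V1 \<Longrightarrow> p1 (r \<odot>\<^bsub>V1\<^esub> a) = r \<odot>\<^bsub>V\<^esub> p1 a"
    and p2_smult: "b \<in> carrier V2 \<Longrightarrow> p2 (r \<odot>\<^bsub>V2\<^esub> b) = r \<odot>\<^bsub>V\<^esub> p2 b"
    and decompose: "x \<in> carrier V \<Longrightarrow> \<exists>a\<in>carrier V1. \<exists>b\<in>carrier V2. x = p1 a \<oplus>\<^bsub>V\<^esub> p2 b"
    and decompose_unique: "a \<in> carrier V1 \<Longrightarrow> b \<in> carrier V2 \<Longrightarrow> a' \<in> carrier V1 \<Longrightarrow> b' \<in> carrier V2 \<Longrightarrow>
      p1 a \<oplus>\<^bsub>V\<^esub> p2 b = p1 a' \<oplus>\<^bsub>V\<^esub> p2 b' \<Longrightarrow> a = a' \<and> b = b'"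
    and I_sum: "a \<in> carrier V1 \<Longrightarrow> b \<in> carrier V2 \<Longrightarrow> a' \<in> carrier V1 \<Longrightarrow> b' \<in> carrier V2 \<Longrightarrow>
      I (p1 a \<oplus>\<^bsub>V\<^esub> p2 b) (p1 a' \<oplus>\<^bsub>V\<^esub> p2 b') \<Longrightarrow>
      I1 a a' \<and> I2 b b' \<and> (\<forall>s t. ev1 a s * ev2 b' t = ev1 a' s * ev2 b t)"
    and I_p1: "a \<in> carrier V1 \<Longrightarrow> a' \<in> carrier V1 \<Longrightarrow> I1 a a' \<Longrightarrow> I (p1 a) (p1 a')"
    and I_p2: "b \<in> carrier V2 \<Longrightarrow> b' \<in> carrier V2 \<Longrightarrow> I2 b b' \<Longrightarrow> I (p2 b) (p2 b')"
    and I_square: "a \<in> carrier V1 \<Longrightarrow> b \<in> carrier V2 \<Longrightarrow> I1 a a \<Longrightarrow> I2 b b \<Longrightarrow>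
      I (p1 a \<oplus>\<^bsub>V\<^esub> p2 b) (p1 a \<oplus>\<^bsub>V\<^esub> p2 b)"
begin

lemma swap: "product_form V2 ev2 I2 V1 ev1 I1 V ev I p2 p1"
proof (unfold_locales, goal_cases)
  case (7 x)
  then show ?case using decompose V.M.a_comm by (metis p1_in p2_in)
next
  case (8 a b a' b')
  then show ?case using decompose_unique[of b a b' a'] V.M.a_comm by simp
next
  case (9 a b a' b')
  then have "I (p1 b \<oplus>\<^bsub>V\<^esub> p2 a) (p1 b' \<oplus>\<^bsub>V\<^esub> p2 a')" using V.M.a_comm by simp
  then show ?case using I_sum[of b a b' a'] 9 by (auto simp: mult.commute)
next
  case (12 a b)
  then show ?case using I_square[of b a] V.M.a_comm by simp
qed (simp_all add: p1_add p2_add p1_smult p2_smult I_p1 I_p2)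

lemma p1_zero: "p1 \<zero>\<^bsub>V1\<^esub> = \<zero>\<^bsub>V\<^esub>"
proof -
  have "p1 \<zero>\<^bsub>V1\<^esub> \<oplus>\<^bsub>V\<^esub> p1 \<zero>\<^bsub>V1\<^esub> = p1 \<zero>\<^bsub>V1\<^esub>"
    using p1_add[of "\<zero>\<^bsub>V1\<^esub>" "\<zero>\<^bsub>V1\<^esub>"] by simp
  then have "ev (p1 \<zero>\<^bsub>V1\<^esub>) l = 0" for l
    using V.ev_add[of "p1 \<zero>\<^bsub>V1\<^esub>" "p1 \<zero>\<^bsub>V1\<^esub>" l] by simp
  then show ?thesis using V.ev_eq_0[of "p1 \<zero>\<^bsub>V1\<^esub>"] by simp
qed

lemma p2_zero: "p2 \<zero>\<^bsub>V2\<^esub> = \<zero>\<^bsub>V\<^esub>"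
  by (rule product_form.p1_zero[OF swap])

lemma p1_inj: "inj_on p1 (carrier V1)"
proof (rule inj_onI)
  fix a a' assume "a \<in> carrier V1" "a' \<in> carrier V1" "p1 a = p1 a'"
  then show "a = a'" using decompose_unique[of a "\<zero>\<^bsub>V2\<^esub>" a' "\<zero>\<^bsub>V2\<^esub>"] by (auto simp: p2_zero)
qed

lemma p1_image_psubset:
  assumes "H \<subseteq> carrier V1" "K \<subseteq> carrier V1"
  shows "p1 ` H \<subset> p1 ` K \<longleftrightarrow> H \<subset> K"
  using inj_on_image_subset_iff[OF p1_inj assms] inj_on_image_subset_iff[OF p1_inj assms(2,1)]
  by (auto simp: psubset_eq)

text \<open>The map \<open>\<lambda>a. ev (p1 a)\<close> is another separating evaluation on the first factor. Linear
independence can be tested with any such evaluation, so \<open>p1\<close> preserves and reflects it.\<close>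

lemma rank_image:
  assumes "H \<subseteq> carrier V1"
  shows "module_rank V (p1 ` H) = module_rank V1 H"
proof -
  interpret E: evaluated_module R V1 "\<lambda>a. ev (p1 a)"
  proof
    fix x y assume "x \<in> carrier V1" "y \<in> carrier V1" "ev (p1 x) = ev (p1 y)"
    then show "x = y" using p1_inj V.ev_inj by (meson inj_onD p1_in)
  qed (simp_all add: p1_add p1_smult V.ev_add V.ev_smult)
  have indep: "lin_indep V (p1 ` B) \<longleftrightarrow> lin_indep V1 B" if B: "finite B" "B \<subseteq> H" for B
  proof -
    have inj: "inj_on p1 B" using p1_inj B assms by (meson inj_on_subset)
    have "lin_indep V (p1 ` B) \<longleftrightarrow>
        (\<forall>a. (\<forall>l. (\<Sum>b\<in>B. a (p1 b) * ev (p1 b) l) = 0) \<longrightarrow> (\<forall>b\<in>B. a (p1 b) = 0))"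
      using B assms by (subst V.lin_indep_iff) (auto simp: sum.reindex[OF inj])
    also have "\<dots> \<longleftrightarrow> (\<forall>a. (\<forall>l. (\<Sum>b\<in>B. a b * ev (p1 b) l) = 0) \<longrightarrow> (\<forall>b\<in>B. a b = 0))"
    proof (intro iffI allI)
      fix a :: "'m1 \<Rightarrow> 'r"
      assume *: "\<forall>a. (\<forall>l. (\<Sum>b\<in>B. a (p1 b) * ev (p1 b) l) = 0) \<longrightarrow> (\<forall>b\<in>B. a (p1 b) = 0)"
      have eq: "a (the_inv_into B p1 (p1 b)) = a b" if "b \<in> B" for b
        using the_inv_into_f_f[OF inj that] by simp
      show "(\<forall>l. (\<Sum>b\<in>B. a b * ev (p1 b) l) = 0) \<longrightarrow> (\<forall>b\<in>B. a b = 0)"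
        using *[rule_format, of "\<lambda>x. a (the_inv_into B p1 x)"] by (simp add: eq)
    next
      fix a :: "'m \<Rightarrow> 'r"
      assume "\<forall>a. (\<forall>l. (\<Sum>b\<in>B. a b * ev (p1 b) l) = 0) \<longrightarrow> (\<forall>b\<in>B. a b = 0)"
      from this[rule_format, of "\<lambda>b. a (p1 b)"]
      show "(\<forall>l. (\<Sum>b\<in>B. a (p1 b) * ev (p1 b) l) = 0) \<longrightarrow> (\<forall>b\<in>B. a (p1 b) = 0)" by blast
    qed
    also have "\<dots> \<longleftrightarrow> lin_indep V1 B"
      using B assms by (subst E.lin_indep_iff) auto
    finally show ?thesis .
  qed
  have card: "card (p1 ` B) = card B" if "B \<subseteq> H" for B
    using card_image inj_on_subset[OF p1_inj] that assms by blast
  show ?thesis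
  proof (rule antisym)
    show "module_rank V1 H \<le> module_rank V (p1 ` H)"
      unfolding module_rank_def[of V1]
    proof (rule SUP_least)
      fix B assume "B \<in> {B. finite B \<and> B \<subseteq> H \<and> lin_indep V1 B}"
      then show "enat (card B) \<le> module_rank V (p1 ` H)"
        using V.rank_geI[of "p1 ` B" "p1 ` H"] indep card by auto
    qed
    show "module_rank V (p1 ` H) \<le> module_rank V1 H"
      unfolding module_rank_def[of V]
    proof (rule SUP_least)
      fix C assume C: "C \<in> {B. finite B \<and> B \<subseteq> p1 ` H \<and> lin_indep V B}"
      then obtain B where B: "B \<subseteq> H" "finite B" "C = p1 ` B"
        by (metis (no_types, lifting) finite_subset_image mem_Collect_eq)
      then show "enat (card C) \<le> module_rank V1 H"
        using V1.rank_geI[of B H] indep card C by auto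
    qed
  qed
qed

lemma isotropic_image:
  assumes "isotropic_for V1 I1 H"
  shows "isotropic_for V I (p1 ` H)"
proof -
  have H: "H \<subseteq> carrier V1" "\<zero>\<^bsub>V1\<^esub> \<in> H" "\<And>x y. x \<in> H \<Longrightarrow> y \<in> H \<Longrightarrow> x \<oplus>\<^bsub>V1\<^esub> y \<in> H"
      "\<And>r x. x \<in> H \<Longrightarrow> r \<odot>\<^bsub>V1\<^esub> x \<in> H" "\<And>x y. x \<in> H \<Longrightarrow> y \<in> H \<Longrightarrow> I1 x y"
    using assms by (auto simp: isotropic_for_def V1.submodule_iff)
  have "submodule (p1 ` H) (ring_of_type_algebra :: 'r ring) V"
    unfolding V.submodule_iff
  proof (intro conjI ballI allI)
    show "p1 ` H \<subseteq> carrier V" using H(1) by auto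
    show "\<zero>\<^bsub>V\<^esub> \<in> p1 ` H" using H(2) p1_zero by (metis image_eqI)
    fix x assume "x \<in> p1 ` H"
    then obtain a where a: "a \<in> H" "x = p1 a" by blast
    then have ac: "a \<in> carrier V1" using H(1) by blast
    show "r \<odot>\<^bsub>V\<^esub> x \<in> p1 ` H" for r
      using p1_smult[OF ac] a H(4) by (metis image_eqI)
    fix y assume "y \<in> p1 ` H"
    then obtain b where b: "b \<in> H" "y = p1 b" by blast
    then have "b \<in> carrier V1" using H(1) by blast
    then show "x \<oplus>\<^bsub>V\<^esub> y \<in> p1 ` H"
      using p1_add[OF ac] a b H(3) by (metis image_eqI)
  qed
  then show ?thesis using H I_p1 by (auto simp: isotropic_for_def subset_iff)
qed

lemma isotropic_preimage:
  assumes "isotropic_for V I H" "H \<subseteq> p1 ` carrier V1"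
  obtains H1 where "isotropic_for V1 I1 H1" "H = p1 ` H1"
proof -
  define H1 where "H1 = {a \<in> carrier V1. p1 a \<in> H}"
  have H: "\<zero>\<^bsub>V\<^esub> \<in> H" "\<And>x y. x \<in> H \<Longrightarrow> y \<in> H \<Longrightarrow> x \<oplus>\<^bsub>V\<^esub> y \<in> H"
      "\<And>r x. x \<in> H \<Longrightarrow> r \<odot>\<^bsub>V\<^esub> x \<in> H" "\<And>x y. x \<in> H \<Longrightarrow> y \<in> H \<Longrightarrow> I x y"
    using assms by (auto simp: isotropic_for_def V.submodule_iff)
  have "I1 a a'" if "a \<in> H1" "a' \<in> H1" for a a'
    using I_sum[of a "\<zero>\<^bsub>V2\<^esub>" a' "\<zero>\<^bsub>V2\<^esub>"] that H(4) by (simp add: H1_def p2_zero)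
  then have "isotropic_for V1 I1 H1"
    unfolding isotropic_for_def V1.submodule_iff
    using H by (auto simp: H1_def p1_zero p1_add p1_smult)
  moreover have "H = p1 ` H1" using assms(2) by (auto simp: H1_def)
  ultimately show thesis using that by blast
qed

text \<open>With \<open>s\<close> and \<open>t\<close> chosen so that \<open>a\<close> and \<open>b\<close> do not vanish there, put \<open>l = a(s)\<close> and \<open>m = a'(s)\<close>.
The torus equations then say \<open>l b' = m b\<close>, and after multiplication by \<open>b(t)\<close> also \<open>l a' = m a\<close>.\<close>

lemma mixed_dependent:
  assumes c: "a \<in> carrier V1" "b \<in> carrier V2" "y \<in> carrier V"
    and I: "I (p1 a \<oplus>\<^bsub>V\<^esub> p2 b) y" and nz: "a \<noteq> \<zero>\<^bsub>V1\<^esub>" "b \<noteq> \<zero>\<^bsub>V2\<^esub>"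
  obtains l m where "l \<noteq> 0" "\<And>i. l * ev y i = m * ev (p1 a \<oplus>\<^bsub>V\<^esub> p2 b) i"
proof -
  obtain a' b' where y: "a' \<in> carrier V1" "b' \<in> carrier V2" "y = p1 a' \<oplus>\<^bsub>V\<^esub> p2 b'"
    using decompose c(3) by blast
  have T: "ev1 a s * ev2 b' t = ev1 a' s * ev2 b t" for s t
    using I_sum[of a b a' b'] c y I by blast
  obtain s where s: "ev1 a s \<noteq> 0" using V1.ev_eq_0[OF c(1)] nz by blast
  obtain t where t: "ev2 b t \<noteq> 0" using V2.ev_eq_0[OF c(2)] nz by blast
  define l where "l = ev1 a s"
  define m where "m = ev1 a' s"
  have e2: "l * ev2 b' u = m * ev2 b u" for u using T[of s u] by (simp add: l_def m_def)
  have e1: "l * ev1 a' u = m * ev1 a u" for u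
  proof -
    have "ev2 b t * (l * ev1 a' u) = l * (ev1 a' u * ev2 b t)" by (simp add: mult_ac)
    also have "\<dots> = ev1 a u * (l * ev2 b' t)" by (simp add: T[symmetric] mult_ac)
    also have "\<dots> = ev2 b t * (m * ev1 a u)" by (simp add: e2 mult_ac)
    finally have "ev2 b t * (l * ev1 a' u - m * ev1 a u) = 0" by (simp add: algebra_simps)
    then show ?thesis using V1.no_zero_divisors t by fastforce
  qed
  have "l \<odot>\<^bsub>V1\<^esub> a' = m \<odot>\<^bsub>V1\<^esub> a" using c y e1 by (intro V1.ev_inj) (auto simp: V1.ev_smult)
  then have 1: "l \<odot>\<^bsub>V\<^esub> p1 a' = m \<odot>\<^bsub>V\<^esub> p1 a" using p1_smult c y by metis
  have "l \<odot>\<^bsub>V2\<^esub> b' = m \<odot>\<^bsub>V2\<^esub> b" using c y e2 by (intro V2.ev_inj) (auto simp: V2.ev_smult)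
  then have 2: "l \<odot>\<^bsub>V\<^esub> p2 b' = m \<odot>\<^bsub>V\<^esub> p2 b" using p2_smult c y by metis
  have "l * ev y i = m * ev (p1 a \<oplus>\<^bsub>V\<^esub> p2 b) i" for i
  proof -
    have "l * ev (p1 a') i = m * ev (p1 a) i" "l * ev (p2 b') i = m * ev (p2 b) i"
      using 1 2 c y V.ev_smult by (metis p1_in) (metis 2 c y V.ev_smult p2_in)
    then show ?thesis using c y by (simp add: V.ev_add algebra_simps)
  qed
  moreover have "l \<noteq> 0" using s by (simp add: l_def)
  ultimately show thesis using that by blast
qed

lemma mixed_rank_1:
  assumes H: "isotropic_for V I H"
    and c: "a \<in> carrier V1" "b \<in> carrier V2" "p1 a \<oplus>\<^bsub>V\<^esub> p2 b \<in> H"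
    and nz: "a \<noteq> \<zero>\<^bsub>V1\<^esub>" "b \<noteq> \<zero>\<^bsub>V2\<^esub>"
  shows "module_rank V H = 1"
proof -
  define x where "x = p1 a \<oplus>\<^bsub>V\<^esub> p2 b"
  have HV: "H \<subseteq> carrier V" by (rule V.isotropic_subset[OF H])
  have "x \<noteq> \<zero>\<^bsub>V\<^esub>"
  proof
    assume "x = \<zero>\<^bsub>V\<^esub>"
    then have "p1 a \<oplus>\<^bsub>V\<^esub> p2 b = p1 \<zero>\<^bsub>V1\<^esub> \<oplus>\<^bsub>V\<^esub> p2 \<zero>\<^bsub>V2\<^esub>"
      by (simp add: x_def p1_zero p2_zero)
    then show False using decompose_unique[of a b "\<zero>\<^bsub>V1\<^esub>" "\<zero>\<^bsub>V2\<^esub>"] c nz by simp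
  qed
  moreover have "V.dependent y z" if yz: "y \<in> H" "z \<in> H" for y z
  proof -
    have I: "I x y" "I x z" using H c yz by (auto simp: isotropic_for_def x_def)
    obtain l m where y: "l \<noteq> 0" "\<And>i. l * ev y i = m * ev x i"
      using mixed_dependent[OF c(1,2) _ _ nz] I yz HV unfolding x_def by blast
    obtain l' m' where z: "l' \<noteq> 0" "\<And>i. l' * ev z i = m' * ev x i"
      using mixed_dependent[OF c(1,2) _ _ nz] I yz HV unfolding x_def by blast
    show ?thesis
    proof (cases "m = 0")
      case True
      then have "l * ev y i = 0" for i using y by simp
      then have "0 * ev z i = 1 * ev y i" for i using V1.no_zero_divisors y(1) by auto
      then show ?thesis unfolding V.dependent_def by (metis zero_neq_one)
    next
      case False
      have "(m * l') * ev z i = (m' * l) * ev y i" for i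
      proof -
        have "(m * l') * ev z i = m * (l' * ev z i)" by (simp add: mult_ac)
        also have "\<dots> = m' * (m * ev x i)" by (simp add: z mult_ac)
        also have "\<dots> = (m' * l) * ev y i" by (simp add: y(2)[symmetric] mult_ac)
        finally show ?thesis .
      qed
      moreover have "m * l' \<noteq> 0" using False z(1) V1.no_zero_divisors by blast
      ultimately show ?thesis unfolding V.dependent_def by blast
    qed
  qed
  ultimately show ?thesis using V.rank_eq_1_iff[OF HV] c x_def by blast
qed

text \<open>If neither inclusion holds, \<open>H\<close> contains elements with nonzero second and with nonzero first component. Either
one of them is mixed, or their sum is.\<close>

lemma isotropic_trichotomy:
  assumes H: "isotropic_for V I H"
  shows "module_rank V H = 1 \<or> H \<subseteq> p1 ` carrier V1 \<or> H \<subseteq> p2 ` carrier V2"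
proof (rule ccontr)
  assume *: "\<not> ?thesis"
  have HV: "H \<subseteq> carrier V" by (rule V.isotropic_subset[OF H])
  obtain x y where x: "x \<in> H" "x \<notin> p1 ` carrier V1" and y: "y \<in> H" "y \<notin> p2 ` carrier V2"
    using * by blast
  obtain a b where ab: "a \<in> carrier V1" "b \<in> carrier V2" "x = p1 a \<oplus>\<^bsub>V\<^esub> p2 b"
    using decompose x HV by blast
  obtain a' b' where ab': "a' \<in> carrier V1" "b' \<in> carrier V2" "y = p1 a' \<oplus>\<^bsub>V\<^esub> p2 b'"
    using decompose y HV by blast
  have b0: "b \<noteq> \<zero>\<^bsub>V2\<^esub>" using x ab by (auto simp: p2_zero)
  have a'0: "a' \<noteq> \<zero>\<^bsub>V1\<^esub>" using y ab' by (auto simp: p1_zero)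
  have a0: "a = \<zero>\<^bsub>V1\<^esub>" using mixed_rank_1[OF H ab(1,2) _ _ b0] * ab x by blast
  have b'0: "b' = \<zero>\<^bsub>V2\<^esub>" using mixed_rank_1[OF H ab'(1,2) _ a'0] * ab' y by blast
  have "x = p2 b" using ab a0 by (simp add: p1_zero)
  moreover have "y = p1 a'" using ab' b'0 by (simp add: p2_zero)
  moreover have "y \<oplus>\<^bsub>V\<^esub> x \<in> H" using H x y by (simp add: isotropic_for_def V.submodule_iff)
  ultimately have "module_rank V H = 1"
    using mixed_rank_1[OF H ab'(1) ab(2) _ a'0 b0] by simp
  then show False using * by blast
qed

lemma isotropic_classification:
  assumes H: "submodule H (ring_of_type_algebra :: 'r ring) V"
  shows "isotropic_for V I H \<longleftrightarrow>
     (module_rank V H = 1 \<and> (CHAR('r) = 2 \<longrightarrow> (\<forall>x\<in>H. I x x))) \<or>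
     (\<exists>H1. isotropic_for V1 I1 H1 \<and> H = p1 ` H1) \<or> (\<exists>H2. isotropic_for V2 I2 H2 \<and> H = p2 ` H2)"
    (is "_ \<longleftrightarrow> ?rank1 \<or> ?H1 \<or> ?H2")
proof
  assume iso: "isotropic_for V I H"
  show "?rank1 \<or> ?H1 \<or> ?H2"
    using isotropic_trichotomy[OF iso]
  proof (elim disjE)
    assume "module_rank V H = 1"
    then show ?thesis using iso by (auto simp: isotropic_for_def)
  next
    assume "H \<subseteq> p1 ` carrier V1"
    then show ?thesis using isotropic_preimage[OF iso] by metis
  next
    assume "H \<subseteq> p2 ` carrier V2"
    then show ?thesis using product_form.isotropic_preimage[OF swap iso] by metis
  qed
next
  assume "?rank1 \<or> ?H1 \<or> ?H2"
  then show "isotropic_for V I H"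
    using V.rank_1_isotropic[OF H] isotropic_image product_form.isotropic_image[OF swap] by blast
qed

text \<open>Every element of an isotropic submodule that contains some \<open>p1 a\<close> with \<open>a \<noteq> 0\<close> has second component
zero, by the torus equation. The assumption that \<open>H\<close> is nonzero matters: the
image of the zero submodule lies in the image of every isotropic submodule of the second factor.\<close>

lemma maximal_image:
  assumes max: "maximal_isotropic_for V1 I1 H" and nz: "\<not> H \<subseteq> {\<zero>\<^bsub>V1\<^esub>}"
  shows "maximal_isotropic_for V I (p1 ` H)"
  unfolding maximal_isotropic_for_def
proof (intro conjI allI impI)
  have iso: "isotropic_for V1 I1 H" using max by (simp add: maximal_isotropic_for_def)
  then show "isotropic_for V I (p1 ` H)" by (rule isotropic_image)
  fix K assume K: "isotropic_for V I K"
  show "\<not> p1 ` H \<subset> K"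
  proof
    assume sub: "p1 ` H \<subset> K"
    obtain a where a: "a \<in> H" "a \<noteq> \<zero>\<^bsub>V1\<^esub>" using nz by blast
    have ac: "a \<in> carrier V1" using V1.isotropic_subset[OF iso] a by blast
    have "K \<subseteq> p1 ` carrier V1"
    proof
      fix y assume y: "y \<in> K"
      then obtain a' b' where ab': "a' \<in> carrier V1" "b' \<in> carrier V2" "y = p1 a' \<oplus>\<^bsub>V\<^esub> p2 b'"
        using decompose V.isotropic_subset[OF K] by blast
      have "p1 a \<in> K" using sub a by blast
      then have "I (p1 a \<oplus>\<^bsub>V\<^esub> p2 \<zero>\<^bsub>V2\<^esub>) y" using K y ac by (simp add: isotropic_for_def p2_zero)
      then have T: "ev1 a s * ev2 b' t = 0" for s t
        using I_sum[of a "\<zero>\<^bsub>V2\<^esub>" a' b'] ac ab' by simp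
      obtain s where "ev1 a s \<noteq> 0" using V1.ev_eq_0[OF ac] a by blast
      then have "\<forall>t. ev2 b' t = 0" using T V1.no_zero_divisors by blast
      then have "b' = \<zero>\<^bsub>V2\<^esub>" using V2.ev_eq_0 ab' by blast
      then show "y \<in> p1 ` carrier V1" using ab' by (simp add: p2_zero)
    qed
    then obtain H' where H': "isotropic_for V1 I1 H'" "K = p1 ` H'"
      using isotropic_preimage[OF K] by blast
    have "\<not> H \<subset> H'" using max H'(1) by (simp add: maximal_isotropic_for_def)
    moreover have "H \<subset> H'"
      using sub p1_image_psubset[OF V1.isotropic_subset[OF iso] V1.isotropic_subset[OF H'(1)]] H'(2)
      by simp
    ultimately show False by blast
  qed
qed

lemma maximal_preimage:
  assumes max: "maximal_isotropic_for V I (p1 ` H)" and iso: "isotropic_for V1 I1 H"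
  shows "maximal_isotropic_for V1 I1 H"
  unfolding maximal_isotropic_for_def
proof (intro conjI allI impI iso)
  fix K assume K: "isotropic_for V1 I1 K"
  have "\<not> p1 ` H \<subset> p1 ` K"
    using max isotropic_image[OF K] by (simp add: maximal_isotropic_for_def)
  then show "\<not> H \<subset> K"
    using p1_image_psubset[OF V1.isotropic_subset[OF iso] V1.isotropic_subset[OF K]] by simp
qed

lemma ranks_image_subset:
  assumes "Max (isotropic_ranks_for V1 I1) \<noteq> 0"
  shows "isotropic_ranks_for V1 I1 \<subseteq> isotropic_ranks_for V I"
proof
  fix r assume "r \<in> isotropic_ranks_for V1 I1"
  then obtain H where H: "maximal_isotropic_for V1 I1 H" "r = module_rank V1 H"
    by (auto simp: isotropic_ranks_for_def)
  have sub: "H \<subseteq> carrier V1"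
    using H V1.isotropic_subset by (simp add: maximal_isotropic_for_def)
  have "0 \<notin> isotropic_ranks_for V1 I1"
    using assms by (simp add: V1.index_eq_0_iff V1.zero_rank_iff)
  then have "r \<noteq> 0" using H by (auto simp: isotropic_ranks_for_def)
  then have "\<not> H \<subseteq> {\<zero>\<^bsub>V1\<^esub>}" using H V1.rank_eq_0_iff[OF sub] by simp
  then have "maximal_isotropic_for V I (p1 ` H)" using maximal_image H by blast
  then show "r \<in> isotropic_ranks_for V I"
    using rank_image[OF sub] H by (force simp: isotropic_ranks_for_def)
qed

lemma maximal_cases:
  assumes max: "maximal_isotropic_for V I H"
  shows "module_rank V H = 1 \<or> (\<exists>H1. maximal_isotropic_for V1 I1 H1 \<and> H = p1 ` H1)
      \<or> (\<exists>H2. maximal_isotropic_for V2 I2 H2 \<and> H = p2 ` H2)"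
proof -
  have iso: "isotropic_for V I H" using max by (simp add: maximal_isotropic_for_def)
  then have "submodule H (ring_of_type_algebra :: 'r ring) V" by (simp add: isotropic_for_def)
  then show ?thesis
    using isotropic_classification iso max maximal_preimage product_form.maximal_preimage[OF swap]
    by metis
qed

text \<open>The rank one is realised by any maximal isotropic submodule that contains \<open>p1 a + p2 b\<close>, where \<open>a\<close> and
\<open>b\<close> are nonzero with vanishing squares; they exist because neither index is zero.\<close>

lemma ranks_product:
  assumes nz: "Max (isotropic_ranks_for V1 I1) \<noteq> 0" "Max (isotropic_ranks_for V2 I2) \<noteq> 0"
  shows "isotropic_ranks_for V I = {1} \<union> isotropic_ranks_for V1 I1 \<union> isotropic_ranks_for V2 I2"
proof
  show "isotropic_ranks_for V I \<subseteq> {1} \<union> isotropic_ranks_for V1 I1 \<union> isotropic_ranks_for V2 I2"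
  proof
    fix r assume "r \<in> isotropic_ranks_for V I"
    then obtain H where H: "maximal_isotropic_for V I H" "r = module_rank V H"
      by (auto simp: isotropic_ranks_for_def)
    have "r = module_rank V1 H1" if "maximal_isotropic_for V1 I1 H1" "H = p1 ` H1" for H1
      using that rank_image H V1.isotropic_subset by (simp add: maximal_isotropic_for_def)
    moreover have "r = module_rank V2 H2" if "maximal_isotropic_for V2 I2 H2" "H = p2 ` H2" for H2
      using that product_form.rank_image[OF swap] H V2.isotropic_subset
      by (simp add: maximal_isotropic_for_def)
    ultimately show "r \<in> {1} \<union> isotropic_ranks_for V1 I1 \<union> isotropic_ranks_for V2 I2"
      using maximal_cases[OF H(1)] H(2) by (auto simp: isotropic_ranks_for_def)
  qed
  obtain a where a: "a \<in> carrier V1" "I1 a a" "a \<noteq> \<zero>\<^bsub>V1\<^esub>"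
    using nz(1) by (auto simp: V1.index_eq_0_iff)
  obtain b where b: "b \<in> carrier V2" "I2 b b" "b \<noteq> \<zero>\<^bsub>V2\<^esub>"
    using nz(2) by (auto simp: V2.index_eq_0_iff)
  define x where "x = p1 a \<oplus>\<^bsub>V\<^esub> p2 b"
  have x: "x \<in> carrier V" "I x x" using a b I_square by (auto simp: x_def)
  obtain H where H: "maximal_isotropic_for V I H" "range (\<lambda>r. r \<odot>\<^bsub>V\<^esub> x) \<subseteq> H"
    by (rule V.isotropic_extends_to_maximal[OF V.isotropic_span[OF x]])
  have "x \<in> H" using V.in_span[OF x(1)] H(2) by blast
  then have "module_rank V H = 1"
    using mixed_rank_1[of H a b] a b H by (simp add: maximal_isotropic_for_def x_def)
  then have "1 \<in> isotropic_ranks_for V I"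
    using H(1) unfolding isotropic_ranks_for_def by force
  then show "{1} \<union> isotropic_ranks_for V1 I1 \<union> isotropic_ranks_for V2 I2 \<subseteq> isotropic_ranks_for V I"
    using ranks_image_subset product_form.ranks_image_subset[OF swap] nz by blast
qed

text \<open>The second component \<open>b\<close> of an element of an isotropic submodule satisfies \<open>I2 b b\<close>, hence is zero. So all
isotropic submodules of the product come from the first factor, including the zero one.\<close>

lemma ranks_anisotropic_factor:
  assumes "Max (isotropic_ranks_for V2 I2) = 0"
  shows "isotropic_ranks_for V I = isotropic_ranks_for V1 I1"
proof -
  have an: "b = \<zero>\<^bsub>V2\<^esub>" if "b \<in> carrier V2" "I2 b b" for b
    using assms that by (simp add: V2.index_eq_0_iff)
  have "maximal_isotropic_for V I K \<longleftrightarrow> (\<exists>H. maximal_isotropic_for V1 I1 H \<and> K = p1 ` H)" for K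
  proof -
    have sub: "L \<subseteq> p1 ` carrier V1" if L: "isotropic_for V I L" for L
    proof
      fix y assume y: "y \<in> L"
      then obtain a b where ab: "a \<in> carrier V1" "b \<in> carrier V2" "y = p1 a \<oplus>\<^bsub>V\<^esub> p2 b"
        using decompose V.isotropic_subset[OF L] by blast
      then have "I2 b b" using I_sum[of a b a b] L y by (simp add: isotropic_for_def)
      then have "b = \<zero>\<^bsub>V2\<^esub>" using an ab by blast
      then show "y \<in> p1 ` carrier V1" using ab by (simp add: p2_zero)
    qed
    show ?thesis
    proof
      assume K: "maximal_isotropic_for V I K"
      then have iso: "isotropic_for V I K" by (simp add: maximal_isotropic_for_def)
      obtain H where "isotropic_for V1 I1 H" "K = p1 ` H"
        by (rule isotropic_preimage[OF iso sub[OF iso]])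
      then show "\<exists>H. maximal_isotropic_for V1 I1 H \<and> K = p1 ` H" using K maximal_preimage by blast
    next
      assume "\<exists>H. maximal_isotropic_for V1 I1 H \<and> K = p1 ` H"
      then obtain H where H: "maximal_isotropic_for V1 I1 H" "K = p1 ` H" by blast
      then have iso: "isotropic_for V1 I1 H" by (simp add: maximal_isotropic_for_def)
      show "maximal_isotropic_for V I K"
        unfolding maximal_isotropic_for_def
      proof (intro conjI allI impI)
        show "isotropic_for V I K" using isotropic_image[OF iso] H by simp
        fix L assume L: "isotropic_for V I L"
        obtain H' where H': "isotropic_for V1 I1 H'" "L = p1 ` H'"
          by (rule isotropic_preimage[OF L sub[OF L]])
        have "\<not> H \<subset> H'" using H H' by (simp add: maximal_isotropic_for_def)
        then show "\<not> K \<subset> L"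
          using p1_image_psubset[OF V1.isotropic_subset[OF iso] V1.isotropic_subset[OF H'(1)]] H H'
          by simp
      qed
    qed
  qed
  moreover have "module_rank V (p1 ` H) = module_rank V1 H" if "maximal_isotropic_for V1 I1 H" for H
    using that rank_image V1.isotropic_subset by (simp add: maximal_isotropic_for_def)
  ultimately show ?thesis unfolding isotropic_ranks_for_def by (metis (no_types, lifting))
qed

lemma index_product:
  "Max (isotropic_ranks_for V I) = max (Max (isotropic_ranks_for V1 I1)) (Max (isotropic_ranks_for V2 I2))"
proof -
  consider "Max (isotropic_ranks_for V2 I2) = 0" | "Max (isotropic_ranks_for V1 I1) = 0"
    | "Max (isotropic_ranks_for V1 I1) \<noteq> 0" "Max (isotropic_ranks_for V2 I2) \<noteq> 0" by blast
  then show ?thesis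
  proof cases
    case 1
    then show ?thesis by (simp add: ranks_anisotropic_factor)
  next
    case 2
    then show ?thesis by (simp add: product_form.ranks_anisotropic_factor[OF swap])
  next
    case 3
    have "1 \<le> Max (isotropic_ranks_for V1 I1)" using 3(1) by (simp add: one_eSuc ileI1)
    then show ?thesis
      using ranks_product[OF 3] V1.ranks_finite V1.ranks_nonempty V2.ranks_finite V2.ranks_nonempty
      by (simp add: Max_Un Max_insert max.assoc[symmetric] max_absorb2)
  qed
qed

end

section \<open>Singular simplices from paths and triangles\<close>

definition vertex :: "nat \<Rightarrow> nat \<Rightarrow> real" where
  "vertex i = (\<lambda>j. if j = i then 1 else 0)"

definition path_simplex :: "(real \<Rightarrow> 'a) \<Rightarrow> 'a sing_simplex" where
  "path_simplex g = restrict (\<lambda>x. g (x 1)) (standard_simplex 1)"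

definition point_simplex :: "'a \<Rightarrow> 'a sing_simplex" where
  "point_simplex x = restrict (\<lambda>_. x) (standard_simplex 0)"

definition triangle_simplex ::
    "('e::real_vector \<Rightarrow> 'a) \<Rightarrow> 'e \<Rightarrow> 'e \<Rightarrow> 'e \<Rightarrow> 'a sing_simplex" where
  "triangle_simplex f a b c =
     restrict (\<lambda>x. f (x 0 *\<^sub>R a + x 1 *\<^sub>R b + x 2 *\<^sub>R c)) (standard_simplex 2)"

lemma standard_simplex_1_iff:
  "x \<in> standard_simplex 1 \<longleftrightarrow> 0 \<le> x 1 \<and> x 1 \<le> 1 \<and> x = (\<lambda>i. if i = 0 then 1 - x 1 else if i = 1 then x 1 else 0)"
proof -
  have "x \<in> standard_simplex 1 \<longleftrightarrow> (\<forall>i. 0 \<le> x i \<and> x i \<le> 1) \<and> (\<forall>i>1. x i = 0) \<and> x 0 + x 1 = 1"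
    by (simp add: standard_simplex_def)
  also have "\<dots> \<longleftrightarrow> 0 \<le> x 1 \<and> x 1 \<le> 1 \<and> x 0 = 1 - x 1 \<and> (\<forall>i>1. x i = 0)"
  proof (intro iffI conjI allI; elim conjE)
    fix i :: nat assume *: "0 \<le> x 1" "x 1 \<le> 1" "x 0 = 1 - x 1" "\<forall>i>1. x i = 0"
    consider "i = 0" | "i = 1" | "i > 1" by linarith
    then show "0 \<le> x i" "x i \<le> 1" using * by (cases; simp)+
  qed auto
  also have "(x 0 = 1 - x 1 \<and> (\<forall>i>1. x i = 0)) \<longleftrightarrow>
      x = (\<lambda>i. if i = 0 then 1 - x 1 else if i = 1 then x 1 else 0)"
  proof (intro iffI conjI allI impI)
    assume *: "x 0 = 1 - x 1 \<and> (\<forall>i>1. x i = 0)"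
    show "x = (\<lambda>i. if i = 0 then 1 - x 1 else if i = 1 then x 1 else 0)"
    proof
      fix i :: nat
      consider "i = 0" | "i = 1" | "i > 1" by linarith
      then show "x i = (if i = 0 then 1 - x 1 else if i = 1 then x 1 else 0)"
        using * by (cases; simp)
    qed
  next
    assume *: "x = (\<lambda>i. if i = 0 then 1 - x 1 else if i = 1 then x 1 else 0)"
    show "x 0 = 1 - x 1" by (subst *) simp
    show "x i = 0" if "i > 1" for i using that by (subst *) simp
  qed
  finally show ?thesis by blast
qed

definition edge_point :: "real \<Rightarrow> nat \<Rightarrow> real" where
  "edge_point t = (\<lambda>i. if i = 0 then 1 - t else if i = 1 then t else 0)"

lemma edge_point_in: "t \<in> {0..1} \<Longrightarrow> edge_point t \<in> standard_simplex 1"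
  unfolding standard_simplex_1_iff edge_point_def by simp

lemma edge_point_1 [simp]: "edge_point t (Suc 0) = t" "edge_point t 0 = 1 - t"
  by (simp_all add: edge_point_def)

lemma standard_simplex_1_edge_point: "x \<in> standard_simplex 1 \<Longrightarrow> x = edge_point (x 1) \<and> x 1 \<in> {0..1}"
  unfolding standard_simplex_1_iff edge_point_def by auto

lemma vertex_edge_point: "vertex 0 = edge_point 0" "vertex 1 = edge_point 1"
  by (auto simp: vertex_def edge_point_def fun_eq_iff)

lemma path_simplex_edge_point: "t \<in> {0..1} \<Longrightarrow> path_simplex g (edge_point t) = g t"
  using edge_point_in[of t] by (simp add: path_simplex_def)

lemma path_simplex_ends [simp]:
  "path_simplex g (vertex 0) = g 0" "path_simplex g (vertex (Suc 0)) = g 1"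
  using path_simplex_edge_point[of 0 g] path_simplex_edge_point[of 1 g] vertex_edge_point by simp_all

lemma path_simplex_cong:
  "(\<And>t. 0 \<le> t \<Longrightarrow> t \<le> 1 \<Longrightarrow> g t = h t) \<Longrightarrow> path_simplex g = path_simplex h"
  unfolding path_simplex_def by (rule restrict_ext) (use standard_simplex_1_edge_point in force)

lemma continuous_map_simplex_coordinate:
  "continuous_map (subtopology (powertop_real UNIV) (standard_simplex p)) euclideanreal (\<lambda>x. x i)"
  by (intro continuous_map_from_subtopology continuous_map_product_projection) simp

lemma singular_path_simplex:
  assumes "pathin S g"
  shows "singular_simplex 1 S (path_simplex g)"
proof -
  have "continuous_map (subtopology (powertop_real UNIV) (standard_simplex 1))
          (subtopology euclideanreal {0..1}) (\<lambda>x. x 1)"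
    using continuous_map_simplex_coordinate[of 1 1]
    by (auto simp: continuous_map_in_subtopology standard_simplex_def)
  from continuous_map_compose[OF this assms[unfolded pathin_def]]
  have "continuous_map (subtopology (powertop_real UNIV) (standard_simplex 1)) S (\<lambda>x. g (x 1))"
    by (simp add: o_def)
  then show ?thesis
    unfolding singular_simplex_def path_simplex_def
    by (auto elim: continuous_map_eq)
qed

lemma singular_simplex_1_path:
  assumes "singular_simplex 1 S \<sigma>"
  shows "pathin S (\<lambda>t. \<sigma> (edge_point t))" "\<sigma> = path_simplex (\<lambda>t. \<sigma> (edge_point t))"
proof -
  have "continuous_map (subtopology euclideanreal {0..1}) (powertop_real UNIV) edge_point"
    unfolding continuous_map_componentwise_UNIV
  proof
    fix k :: nat
    consider "k = 0" | "k = 1" | "k > 1" by linarith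
    then show "continuous_map (subtopology euclideanreal {0..1}) euclideanreal (\<lambda>x. edge_point x k)"
      by cases (auto simp: edge_point_def intro!: continuous_intros)
  qed
  then have "continuous_map (subtopology euclideanreal {0..1})
      (subtopology (powertop_real UNIV) (standard_simplex 1)) edge_point"
    using edge_point_in by (auto simp: continuous_map_in_subtopology)
  then show "pathin S (\<lambda>t. \<sigma> (edge_point t))"
    using assms continuous_map_compose unfolding pathin_def singular_simplex_def o_def by blast
  show "\<sigma> = path_simplex (\<lambda>t. \<sigma> (edge_point t))"
  proof
    fix x
    show "\<sigma> x = path_simplex (\<lambda>t. \<sigma> (edge_point t)) x"
    proof (cases "x \<in> standard_simplex 1")
      case True
      then show ?thesis using standard_simplex_1_edge_point[OF True]
        by (metis path_simplex_edge_point)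
    next
      case False
      then show ?thesis using assms by (auto simp: singular_simplex_def path_simplex_def extensional_def)
    qed
  qed
qed

lemma singular_simplex_1_iff: "singular_simplex 1 S \<sigma> \<longleftrightarrow> (\<exists>g. pathin S g \<and> \<sigma> = path_simplex g)"
  using singular_simplex_1_path singular_path_simplex by metis

lemma singular_point_simplex: "x \<in> topspace S \<Longrightarrow> singular_simplex 0 S (point_simplex x)"
  unfolding singular_simplex_def point_simplex_def
  by (auto intro: continuous_map_eq[of _ _ "\<lambda>_. x"])

lemma standard_simplex_0_vertex: "standard_simplex 0 = {vertex 0}"
  by (auto simp: standard_simplex_0 vertex_def)

lemma face_path_simplex:
  "singular_face 1 0 (path_simplex g) = point_simplex (g 1)"
  "singular_face 1 1 (path_simplex g) = point_simplex (g 0)"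
proof -
  have "simplical_face 0 (vertex 0) = edge_point 1" "simplical_face 1 (vertex 0) = edge_point 0"
    by (auto simp: simplical_face_def vertex_def edge_point_def fun_eq_iff)
  then show "singular_face 1 0 (path_simplex g) = point_simplex (g 1)"
    "singular_face 1 1 (path_simplex g) = point_simplex (g 0)"
    by (simp_all add: singular_face_def point_simplex_def standard_simplex_0_vertex
        path_simplex_edge_point restrict_def cong: if_cong)
qed

lemma face_1:
  assumes "singular_simplex 1 S \<sigma>"
  shows "singular_face 1 0 \<sigma> = point_simplex (\<sigma> (vertex 1))"
    "singular_face 1 1 \<sigma> = point_simplex (\<sigma> (vertex 0))"
  using face_path_simplex singular_simplex_1_path(2)[OF assms] vertex_edge_point by metis+

lemma simplex_1_ends_in:
  assumes "singular_simplex 1 S \<sigma>"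
  shows "\<sigma> (vertex 0) \<in> topspace S" "\<sigma> (vertex 1) \<in> topspace S"
  using assms by (auto simp: singular_simplex_def continuous_map_def vertex_def Pi_iff)

lemma triangle_simplex_faces:
  "singular_face 2 0 (triangle_simplex f a b c) = path_simplex (f \<circ> linepath b c)"
  "singular_face 2 1 (triangle_simplex f a b c) = path_simplex (f \<circ> linepath a c)"
  "singular_face 2 2 (triangle_simplex f a b c) = path_simplex (f \<circ> linepath a b)"
proof -
  have *: "simplical_face k x \<in> standard_simplex 2" if "x \<in> standard_simplex (Suc 0)" "k \<le> 2" for k and x :: "nat \<Rightarrow> real"
    using that simplical_face_in_standard_simplex[of 2 k x] by simp
  have x: "x 0 = 1 - x (Suc 0)" if "x \<in> standard_simplex 1" for x
    using standard_simplex_1_edge_point[OF that] by (metis One_nat_def edge_point_1)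
  show "singular_face 2 0 (triangle_simplex f a b c) = path_simplex (f \<circ> linepath b c)"
    unfolding singular_face_def path_simplex_def triangle_simplex_def
    by (simp, rule restrict_ext) (use * x in \<open>simp add: linepath_def\<close>, simp add: simplical_face_def)
  show "singular_face 2 1 (triangle_simplex f a b c) = path_simplex (f \<circ> linepath a c)"
    unfolding singular_face_def path_simplex_def triangle_simplex_def
    by (simp, rule restrict_ext) (use * x in \<open>simp add: linepath_def\<close>, simp add: simplical_face_def)
  show "singular_face 2 2 (triangle_simplex f a b c) = path_simplex (f \<circ> linepath a b)"
    unfolding singular_face_def path_simplex_def triangle_simplex_def
    by (simp, rule restrict_ext) (use * x in \<open>simp add: linepath_def\<close>, simp add: simplical_face_def)
qed

lemma singular_triangle_simplex:
  fixes a b c :: "'e::real_normed_vector"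
  assumes f: "continuous_map (top_of_set C) S f" and C: "convex C" "a \<in> C" "b \<in> C" "c \<in> C"
  shows "singular_simplex 2 S (triangle_simplex f a b c)"
proof -
  define p where "p = (\<lambda>x::nat \<Rightarrow> real. x 0 *\<^sub>R a + x 1 *\<^sub>R b + x 2 *\<^sub>R c)"
  have coord: "continuous_on (standard_simplex 2) (\<lambda>x::nat \<Rightarrow> real. x i)" for i
    by (rule continuous_on_subset[OF continuous_on_product_coordinates]) simp
  have "continuous_on (standard_simplex 2) p"
    unfolding p_def by (intro continuous_intros coord)
  moreover have "p x \<in> C" if "x \<in> standard_simplex 2" for x
  proof -
    have "x 0 + x 1 + x 2 = 1" "x 0 \<ge> 0" "x 1 \<ge> 0" "x 2 \<ge> 0"
      using that by (auto simp: standard_simplex_def numeral_2_eq_2)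
    then have "p x \<in> convex hull {a, b, c}" unfolding convex_hull_3 p_def by blast
    moreover have "convex hull {a, b, c} \<subseteq> C" by (rule hull_minimal) (use C in auto)
    ultimately show ?thesis by blast
  qed
  ultimately have "continuous_map (subtopology (powertop_real UNIV) (standard_simplex 2)) (top_of_set C) p"
    by (auto simp: euclidean_product_topology)
  from continuous_map_compose[OF this f]
  show ?thesis
    unfolding singular_simplex_def triangle_simplex_def
    by (auto simp: p_def o_def elim: continuous_map_eq)
qed

definition path_join :: "(real \<Rightarrow> 'a) \<Rightarrow> (real \<Rightarrow> 'a) \<Rightarrow> real \<Rightarrow> 'a" where
  "path_join g h = (\<lambda>x. if x \<le> 1/2 then g (2 * x) else h (2 * x - 1))"

lemma pathin_path_join:
  assumes "pathin S g" "pathin S h" "g 1 = h 0"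
  shows "pathin S (path_join g h)"
  unfolding pathin_def path_join_def
proof (rule continuous_map_cases_le)
  have "continuous_map (subtopology euclideanreal {0..1/2}) S (g \<circ> (\<lambda>x. 2 * x))"
    by (rule continuous_map_compose[OF _ assms(1)[unfolded pathin_def]])
      (auto intro!: continuous_intros simp: continuous_map_in_subtopology)
  then show "continuous_map (subtopology (subtopology euclideanreal {0..1})
      {x \<in> topspace (subtopology euclideanreal {0..1}). x \<le> 1/2}) S (\<lambda>x. g (2 * x))"
    unfolding subtopology_subtopology o_def
    by (rule continuous_map_from_subtopology_mono) auto
  have "continuous_map (subtopology euclideanreal {1/2..1}) S (h \<circ> (\<lambda>x. 2 * x - 1))"
    by (rule continuous_map_compose[OF _ assms(2)[unfolded pathin_def]])
      (auto intro!: continuous_intros simp: continuous_map_in_subtopology)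
  then show "continuous_map (subtopology (subtopology euclideanreal {0..1})
      {x \<in> topspace (subtopology euclideanreal {0..1}). 1/2 \<le> x}) S (\<lambda>x. h (2 * x - 1))"
    unfolding subtopology_subtopology o_def
    by (rule continuous_map_from_subtopology_mono) auto
  fix x :: real assume "x = 1/2"
  then have "2 * x = 1" "2 * x - 1 = 0" by simp_all
  then show "g (2 * x) = h (2 * x - 1)" using assms(3) by (simp only:)
qed (auto intro: continuous_intros)

section \<open>Functions on paths that are additive on triangles\<close>

text \<open>The common setting for two objects: a cocycle \<open>f\<close> (with \<open>L = {0}\<close>), and the map that sends an edge to the
chain it represents (with \<open>L\<close> the group of boundaries). It turns homologies between paths into
statements that serve cohomology and homology alike.\<close>

locale triangle_additive =
  fixes S :: "'a topology" and u :: "'a sing_simplex \<Rightarrow> 'c::ab_group_add" and L :: "'c set"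
  assumes zero: "0 \<in> L" and diff: "x \<in> L \<Longrightarrow> y \<in> L \<Longrightarrow> x - y \<in> L"
    and additive: "singular_simplex 2 S \<tau> \<Longrightarrow>
      u (singular_face 2 0 \<tau>) - u (singular_face 2 1 \<tau>) + u (singular_face 2 2 \<tau>) \<in> L"
begin

lemma neg: "x \<in> L \<Longrightarrow> - x \<in> L"
  using diff[OF zero, of x] by simp

lemma add: "x \<in> L \<Longrightarrow> y \<in> L \<Longrightarrow> x + y \<in> L"
  using diff[OF _ neg, of x y] by simp

lemma triangle:
  fixes a b c :: "'e::real_normed_vector"
  assumes "continuous_map (top_of_set C) S f" "convex C" "a \<in> C" "b \<in> C" "c \<in> C"
  shows "u (path_simplex (f \<circ> linepath a b)) + u (path_simplex (f \<circ> linepath b c))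
      - u (path_simplex (f \<circ> linepath a c)) \<in> L"
  using additive[OF singular_triangle_simplex[OF assms]]
  unfolding triangle_simplex_faces by (simp add: algebra_simps)

lemma constant_path:
  assumes "x \<in> topspace S"
  shows "u (path_simplex (\<lambda>_. x)) \<in> L"
  using triangle[of UNIV "\<lambda>_::real. x" 0 0 0] assms by (simp add: o_def)

lemma subdivide:
  assumes "pathin S g" "a \<in> {0..1}" "b \<in> {0..1}" "c \<in> {0..1}"
  shows "u (path_simplex (g \<circ> linepath a b)) + u (path_simplex (g \<circ> linepath b c))
      - u (path_simplex (g \<circ> linepath a c)) \<in> L"
  using triangle[of "{0..1}" g a b c] assms by (simp add: pathin_def)

lemma join:
  assumes "pathin S g" "pathin S h" "g 1 = h 0"
  shows "u (path_simplex g) + u (path_simplex h) - u (path_simplex (path_join g h)) \<in> L"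
proof -
  have "path_simplex ((path_join g h) \<circ> linepath 0 (1/2)) = path_simplex g"
    by (rule path_simplex_cong) (auto simp: path_join_def linepath_def)
  moreover have "path_simplex ((path_join g h) \<circ> linepath (1/2) 1) = path_simplex h"
  proof (rule path_simplex_cong)
    fix t :: real assume t: "0 \<le> t" "t \<le> 1"
    have eq: "linepath (1/2) 1 t = (1 + t) / 2" by (simp add: linepath_def field_simps)
    show "((path_join g h) \<circ> linepath (1/2) 1) t = h t"
      unfolding o_def eq using t assms(3) by (cases "t = 0") (auto simp: path_join_def)
  qed
  moreover have "path_simplex ((path_join g h) \<circ> linepath 0 1) = path_simplex (path_join g h)"
    by (simp add: o_def linepath_def)
  ultimately show ?thesis
    using subdivide[OF pathin_path_join[OF assms], of 0 "1/2" 1] by simp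
qed

text \<open>Both ways round a square agree, since both agree with its diagonal.\<close>

lemma square:
  assumes "continuous_map (top_of_set ({0..1} \<times> {0..1})) S f"
  shows "u (path_simplex (\<lambda>t. f (t, 0))) + u (path_simplex (\<lambda>t. f (1, t)))
      - (u (path_simplex (\<lambda>t. f (0, t))) + u (path_simplex (\<lambda>t. f (t, 1)))) \<in> L"
proof -
  have conv: "convex ({0..1::real} \<times> {0..1::real})" by (intro convex_Times) auto
  have 1: "f \<circ> linepath (0, 0) (1, 0) = (\<lambda>t. f (t, 0))" "f \<circ> linepath (1, 0) (1, 1) = (\<lambda>t. f (1, t))"
    "f \<circ> linepath (0, 0) (0, 1) = (\<lambda>t. f (0, t))" "f \<circ> linepath (0, 1) (1, 1) = (\<lambda>t. f (t, 1))"
    by (auto simp: fun_eq_iff linepath_def)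
  show ?thesis
    using diff[OF triangle[OF assms conv, of "(0, 0)" "(1, 0)" "(1, 1)"]
        triangle[OF assms conv, of "(0, 0)" "(0, 1)" "(1, 1)"]]
    unfolding 1 by (simp add: algebra_simps)
qed

end

section \<open>Contractible neighbourhoods in a manifold\<close>

definition contracts_to :: "'a topology \<Rightarrow> 'a set \<Rightarrow> 'a \<Rightarrow> bool" where
  "contracts_to S W c \<longleftrightarrow>
     (\<exists>k. continuous_map (prod_topology (top_of_set {0..1::real}) (subtopology S W)) (subtopology S W) k
        \<and> (\<forall>y\<in>W. k (0, y) = c \<and> k (1, y) = y))"

lemma open_Euclidean_contains_box:
  assumes "openin (Euclidean_space n) B" "p \<in> B"
  obtains e where "e > 0"
    "{z. (\<forall>i\<ge>n. z i = 0) \<and> (\<forall>i<n. \<bar>z i - p i\<bar> < e)} \<subseteq> B"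
proof -
  obtain T where T: "openin (powertop_real UNIV) T" "B = T \<inter> {x. \<forall>i\<ge>n. x i = 0}"
    using assms(1) unfolding Euclidean_space_def openin_subtopology by blast
  then obtain U where U: "\<And>i. open (U i)" "p \<in> Pi\<^sub>E UNIV U" "Pi\<^sub>E UNIV U \<subseteq> T"
    using assms(2) unfolding openin_product_topology_alt by fastforce
  have "\<exists>e>0. ball (p i) e \<subseteq> U i" for i
    using U(1)[of i] U(2) by (auto simp: open_contains_ball PiE_iff)
  then obtain e where e: "\<And>i. e i > 0" "\<And>i. ball (p i) (e i) \<subseteq> U i" by metis
  define d where "d = Min (insert 1 (e ` {..<n}))"
  have "d > 0" unfolding d_def by (subst Min_gr_iff) (use e(1) in auto)
  moreover have "{z. (\<forall>i\<ge>n. z i = 0) \<and> (\<forall>i<n. \<bar>z i - p i\<bar> < d)} \<subseteq> B"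
  proof clarsimp
    fix z assume z: "\<forall>i\<ge>n. z i = 0" "\<forall>i<n. \<bar>z i - p i\<bar> < d"
    have "z i \<in> U i" for i
    proof (cases "i < n")
      case True
      then have "d \<le> e i" unfolding d_def by (intro Min_le) auto
      then have "z i \<in> ball (p i) (e i)" using z True by (auto simp: dist_real_def abs_minus_commute)
      then show ?thesis using e by blast
    next
      case False
      then have "z i = p i" using z T assms(2) by auto
      then show ?thesis using U(2) by (auto simp: PiE_iff)
    qed
    then have "z \<in> Pi\<^sub>E UNIV U" by (auto simp: PiE_iff)
    then show "z \<in> B" using U T z by blast
  qed
  ultimately show thesis using that by blast
qed

text \<open>In a chart, a box around the image of \<open>x\<close> is contracted to its centre along straight lines; the coordinate
functions beyond the dimension are zero and stay zero. Since the neighbourhood can be chosen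
inside any given open set, this provides local path connectedness as well.\<close>

lemma manifold_contractible_neighbourhood:
  assumes "closed_manifold n S" "openin S G" "x \<in> G"
  obtains W where "openin S W" "x \<in> W" "W \<subseteq> G" "contracts_to S W x"
proof -
  have "x \<in> topspace S" using assms openin_subset by blast
  then obtain U V where U: "openin S U" "x \<in> U" "openin (Euclidean_space n) V"
      "subtopology S U homeomorphic_space subtopology (Euclidean_space n) V"
    using assms(1) unfolding closed_manifold_def by blast
  obtain f g where fg: "homeomorphic_maps (subtopology S U) (subtopology (Euclidean_space n) V) f g"
    using U(4) unfolding homeomorphic_space_def by blast
  have US: "U \<subseteq> topspace S" and VE: "V \<subseteq> topspace (Euclidean_space n)"
    using U openin_subset by auto
  have f: "continuous_map (subtopology S U) (subtopology (Euclidean_space n) V) f"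
    and g: "continuous_map (subtopology (Euclidean_space n) V) (subtopology S U) g"
    and gf: "\<And>y. y \<in> U \<Longrightarrow> g (f y) = y" and fg': "\<And>z. z \<in> V \<Longrightarrow> f (g z) = z"
    using fg US VE unfolding homeomorphic_maps_def by (auto simp: topspace_subtopology_subset)
  have f0: "f y i = 0" if "y \<in> U" "i \<ge> n" for y i
  proof -
    have "f y \<in> topspace (Euclidean_space n)"
      using f that US unfolding continuous_map_def by (auto simp: topspace_subtopology_subset)
    then show ?thesis using that by (simp add: topspace_Euclidean_space)
  qed
  define B where "B = f ` (U \<inter> G)"
  have "open_map (subtopology S U) (subtopology (Euclidean_space n) V) f"
    using fg homeomorphic_imp_open_map homeomorphic_maps_map by blast
  moreover have "openin (subtopology S U) (U \<inter> G)"
    using U(1) assms(2) by (simp add: openin_subtopology_Int2)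
  ultimately have "openin (subtopology (Euclidean_space n) V) B"
    unfolding B_def open_map_def by blast
  then have B: "openin (Euclidean_space n) B" "B \<subseteq> V"
    using U(3) by (simp_all add: openin_open_subtopology)
  define p where "p = f x"
  have "p \<in> B" using U assms by (auto simp: B_def p_def)
  then obtain e where e: "e > 0" and box: "{z. (\<forall>i\<ge>n. z i = 0) \<and> (\<forall>i<n. \<bar>z i - p i\<bar> < e)} \<subseteq> B"
    using open_Euclidean_contains_box[OF B(1)] by blast
  define W where "W = (U \<inter> G) \<inter> \<Inter>((\<lambda>i. {y \<in> U. f y i \<in> {p i - e<..<p i + e}}) ` {..<n})"
  have W_iff: "y \<in> W \<longleftrightarrow> y \<in> U \<and> y \<in> G \<and> (\<forall>i<n. \<bar>f y i - p i\<bar> < e)" for y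
    unfolding W_def by (auto simp: abs_less_iff; force)
  have coord: "continuous_map (subtopology S U) euclideanreal (\<lambda>y. f y i)" for i
  proof -
    have "continuous_map (subtopology S U) (powertop_real UNIV) f"
      using f unfolding Euclidean_space_def by (simp add: continuous_map_in_subtopology)
    then show ?thesis by (simp add: continuous_map_componentwise_UNIV)
  qed
  have "openin S W"
    unfolding W_def
  proof (rule openin_Int_Inter)
    fix Y assume "Y \<in> (\<lambda>i. {y \<in> U. f y i \<in> {p i - e<..<p i + e}}) ` {..<n}"
    then obtain i where Y: "Y = {y \<in> U. f y i \<in> {p i - e<..<p i + e}}" by blast
    have "openin (subtopology S U) {y \<in> topspace (subtopology S U). f y i \<in> {p i - e<..<p i + e}}"
      by (rule openin_continuous_map_preimage[OF coord]) simp
    moreover have "{y \<in> topspace (subtopology S U). f y i \<in> {p i - e<..<p i + e}} = Y"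
      using US unfolding Y by auto
    ultimately show "openin S Y" by (simp add: openin_open_subtopology[OF U(1)])
  qed (use U assms in auto)
  define k where "k = (\<lambda>(s::real, y). g (\<lambda>i. (1 - s) * p i + s * f y i))"
  have k_box: "(\<lambda>i. (1 - s) * p i + s * f y i) \<in> B"
      "\<forall>i<n. \<bar>((1 - s) * p i + s * f y i) - p i\<bar> < e" if "s \<in> {0..1}" "y \<in> W" for s y
  proof -
    have "\<bar>((1 - s) * p i + s * f y i) - p i\<bar> < e" if "i < n" for i
    proof -
      have "((1 - s) * p i + s * f y i) - p i = s * (f y i - p i)" by (simp add: algebra_simps)
      then have "\<bar>((1 - s) * p i + s * f y i) - p i\<bar> = s * \<bar>f y i - p i\<bar>"
        using \<open>s \<in> {0..1}\<close> by (simp add: abs_mult)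
      also have "\<dots> \<le> \<bar>f y i - p i\<bar>" using \<open>s \<in> {0..1}\<close> by (simp add: mult_left_le_one_le)
      also have "\<dots> < e" using \<open>y \<in> W\<close> that W_iff by blast
      finally show ?thesis .
    qed
    then show "\<forall>i<n. \<bar>((1 - s) * p i + s * f y i) - p i\<bar> < e" by blast
    moreover have "(1 - s) * p i + s * f y i = 0" if "i \<ge> n" for i
      using f0[OF _ that] U(2) \<open>y \<in> W\<close> W_iff by (simp add: p_def)
    ultimately show "(\<lambda>i. (1 - s) * p i + s * f y i) \<in> B" by (intro subsetD[OF box]) simp
  qed
  have k_in: "k (s, y) \<in> W" if "s \<in> {0..1}" "y \<in> W" for s y
  proof -
    have "f (k (s, y)) = (\<lambda>i. (1 - s) * p i + s * f y i)"
      using k_box(1)[OF that] B(2) fg' by (auto simp: k_def)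
    moreover have "k (s, y) \<in> U \<inter> G"
      using k_box(1)[OF that] gf by (auto simp: k_def B_def)
    ultimately show ?thesis using k_box(2)[OF that] by (simp add: W_iff)
  qed
  have WU: "W \<subseteq> U" by (auto simp: W_iff)
  have cont_k: "continuous_map (prod_topology (top_of_set {0..1::real}) (subtopology S W)) S k"
  proof -
    let ?X = "prod_topology (top_of_set {0..1::real}) (subtopology S W)"
    have 1: "continuous_map ?X euclideanreal fst"
      using continuous_map_fst[of "top_of_set {0..1::real}" "subtopology S W"]
      by (simp add: continuous_map_in_subtopology)
    have "continuous_map (subtopology S W) euclideanreal (\<lambda>y. f y i)" for i
      using continuous_map_from_subtopology[OF coord, of W i] WU
      by (simp add: subtopology_subtopology Int_absorb1)
    from continuous_map_compose[OF continuous_map_snd this]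
    have 2: "continuous_map ?X euclideanreal (\<lambda>z. f (snd z) i)" for i by (simp add: o_def)
    have "continuous_map ?X (powertop_real UNIV) (\<lambda>z i. (1 - fst z) * p i + fst z * f (snd z) i)"
      unfolding continuous_map_componentwise_UNIV
      by (intro allI continuous_intros 1 2)
    moreover have "(\<lambda>z i. (1 - fst z) * p i + fst z * f (snd z) i) \<in> topspace ?X \<rightarrow> V"
      using k_box(1) B(2) by auto
    ultimately have "continuous_map ?X (subtopology (Euclidean_space n) V)
        (\<lambda>z i. (1 - fst z) * p i + fst z * f (snd z) i)"
      using VE unfolding Euclidean_space_def subtopology_subtopology
      by (auto simp: continuous_map_in_subtopology)
    from continuous_map_compose[OF this g] show ?thesis
      by (simp add: continuous_map_in_subtopology k_def o_def case_prod_beta')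
  qed
  have WS: "W \<subseteq> topspace S" using WU US by blast
  have "contracts_to S W x"
    unfolding contracts_to_def
  proof (intro exI[of _ k] conjI ballI)
    show "continuous_map (prod_topology (top_of_set {0..1::real}) (subtopology S W)) (subtopology S W) k"
      using cont_k k_in by (auto simp: continuous_map_in_subtopology)
    fix y assume "y \<in> W"
    then show "k (0, y) = x" "k (1, y) = y"
      using gf WU U(2) by (auto simp: k_def p_def)
  qed
  moreover have "x \<in> W" using U assms e by (simp add: W_iff p_def)
  moreover have "W \<subseteq> G" by (auto simp: W_iff)
  ultimately show thesis using that \<open>openin S W\<close> by blast
qed

lemma pathin_contraction:
  assumes k: "continuous_map (prod_topology (top_of_set {0..1::real}) (subtopology S W)) (subtopology S W) k"
    and "y \<in> W" "W \<subseteq> topspace S"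
  shows "pathin (subtopology S W) (\<lambda>s. k (s, y))"
proof -
  have "continuous_map (top_of_set {0..1}) (prod_topology (top_of_set {0..1::real}) (subtopology S W))
      (\<lambda>s. (s, y))"
    using assms(2,3) by (intro continuous_map_pairedI) auto
  from continuous_map_compose[OF this k] show ?thesis by (simp add: pathin_def o_def)
qed

lemma contracts_to_path_connectedin:
  assumes "contracts_to S W c" "W \<subseteq> topspace S"
  shows "path_connectedin S W"
proof -
  obtain k where k: "continuous_map (prod_topology (top_of_set {0..1::real}) (subtopology S W)) (subtopology S W) k"
      "\<And>y. y \<in> W \<Longrightarrow> k (0, y) = c \<and> k (1, y) = y"
    using assms unfolding contracts_to_def by blast
  have "path_component_of (subtopology S W) c y" if "y \<in> W" for y
    using pathin_contraction[OF k(1) that assms(2)] k(2)[OF that] unfolding path_component_of_def by blast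
  then have "path_component_of (subtopology S W) y z" if "y \<in> W" "z \<in> W" for y z
    using that path_component_of_sym path_component_of_trans by metis
  then have "path_connected_space (subtopology S W)"
    unfolding path_connected_space_def path_component_of_def[symmetric]
    using assms(2) by (simp add: topspace_subtopology_subset)
  then show ?thesis using assms(2) by (simp add: path_connectedin_def)
qed

lemma manifold_locally_path_connected:
  assumes "closed_manifold n S"
  shows "locally_path_connected_space S"
  unfolding locally_path_connected_space
proof (intro allI impI)
  fix V x assume "openin S V \<and> x \<in> V"
  then obtain W where W: "openin S W" "x \<in> W" "W \<subseteq> V" "contracts_to S W x"
    using manifold_contractible_neighbourhood[OF assms] by metis
  then have "path_connectedin S W"
    using contracts_to_path_connectedin openin_subset by metis
  then show "\<exists>U. openin S U \<and> path_connectedin S U \<and> x \<in> U \<and> U \<subseteq> V" using W by blast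
qed

lemma connected_closed_manifold_path_connected:
  "connected_closed_manifold S \<Longrightarrow> path_connected_space S"
  using manifold_locally_path_connected path_connected_eq_connected_space
  unfolding connected_closed_manifold_def by blast

section \<open>Finite generation of the first homology\<close>

text \<open>Shrink the cover to finitely many closed sets \<open>F x \<subseteq> U x\<close> that still cover \<open>S\<close>, and let \<open>W z\<close> be the
intersection of all \<open>U x\<close> with \<open>z \<in> F x\<close> and all complements of \<open>F x\<close> with \<open>z \<notin> F x\<close>. If
\<open>W z\<close> and \<open>W z'\<close> share a point, which lies in some \<open>F x\<close>, then neither of the two can avoid \<open>F x\<close>, so
both are contained in \<open>U x\<close>.\<close>

lemma star_refinement:
  assumes compact: "compact_space S" and Haus: "Hausdorff_space S"
    and cover: "\<And>x. x \<in> topspace S \<Longrightarrow> openin S (U x) \<and> x \<in> U x"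
  obtains T W where "finite T" "T \<subseteq> topspace S" "\<And>z. z \<in> topspace S \<Longrightarrow> openin S (W z) \<and> z \<in> W z"
    "\<And>z z'. W z \<inter> W z' \<noteq> {} \<Longrightarrow> \<exists>x\<in>T. W z \<union> W z' \<subseteq> U x"
proof -
  have "neighbourhood_base_of (closedin S) S"
    using compact Haus by (simp add: neighbourhood_base_of_closedin compact_imp_locally_compact_space
        locally_compact_Hausdorff_imp_regular_space)
  then have "\<exists>G F. openin S G \<and> closedin S F \<and> x \<in> G \<and> G \<subseteq> F \<and> F \<subseteq> U x" if "x \<in> topspace S" for x
    using cover[OF that] unfolding neighbourhood_base_of by blast
  then obtain G F where GF: "\<And>x. x \<in> topspace S \<Longrightarrow>
      openin S (G x) \<and> closedin S (F x) \<and> x \<in> G x \<and> G x \<subseteq> F x \<and> F x \<subseteq> U x"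
    by metis
  have "\<exists>\<F>. finite \<F> \<and> \<F> \<subseteq> G ` topspace S \<and> topspace S \<subseteq> \<Union>\<F>"
    using compact[unfolded compact_space_alt, rule_format, of "G ` topspace S"] GF by blast
  then obtain T where T: "finite T" "T \<subseteq> topspace S" "topspace S \<subseteq> \<Union>(G ` T)"
    by (metis finite_subset_image)
  define W where "W z = topspace S \<inter> \<Inter>((\<lambda>x. if z \<in> F x then U x else topspace S - F x) ` T)" for z
  have "openin S (W z) \<and> z \<in> W z" if "z \<in> topspace S" for z
  proof
    show "openin S (W z)"
      unfolding W_def
      by (rule openin_Int_Inter) (use T GF cover in \<open>auto intro!: openin_diff\<close>)
    show "z \<in> W z" using that GF T by (auto simp: W_def)
  qed
  moreover have "\<exists>x\<in>T. W z \<union> W z' \<subseteq> U x" if meet: "W z \<inter> W z' \<noteq> {}" for z z'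
  proof -
    obtain y where y: "y \<in> W z" "y \<in> W z'" using meet by blast
    then have "y \<in> topspace S" by (simp add: W_def)
    then obtain x where x: "x \<in> T" "y \<in> F x" using T GF by blast
    have "z \<in> F x" using y(1) x unfolding W_def by (auto split: if_splits)
    moreover have "z' \<in> F x" using y(2) x unfolding W_def by (auto split: if_splits)
    ultimately have "W z \<union> W z' \<subseteq> U x" using x(1) unfolding W_def by auto
    then show ?thesis using x(1) by blast
  qed
  ultimately show thesis using that[of T W] T by blast
qed

context triangle_additive
begin

text \<open>Contracting a path \<open>g\<close> in \<open>W\<close> sweeps out a square whose sides are \<open>g\<close>, the constant path at \<open>c\<close> and the
tracks \<open>l\<close> of the two end points. So \<open>l\<close> acts as a primitive of \<open>u\<close> on \<open>W\<close>.\<close>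

lemma contraction_primitive:
  assumes W: "contracts_to S W c" "W \<subseteq> topspace S" and c: "c \<in> topspace S"
  obtains l where "\<And>y. y \<in> W \<Longrightarrow> singular_simplex 1 S (l y)"
    "\<And>g. pathin S g \<Longrightarrow> g ` {0..1} \<subseteq> W \<Longrightarrow> u (path_simplex g) - u (l (g 1)) + u (l (g 0)) \<in> L"
proof -
  obtain k where k: "continuous_map (prod_topology (top_of_set {0..1::real}) (subtopology S W)) (subtopology S W) k"
      "\<And>y. y \<in> W \<Longrightarrow> k (0, y) = c \<and> k (1, y) = y"
    using W unfolding contracts_to_def by blast
  define l where "l y = path_simplex (\<lambda>s. k (s, y))" for y
  have "singular_simplex 1 S (l y)" if "y \<in> W" for y
    unfolding l_def using pathin_contraction[OF k(1) that W(2)] singular_path_simplex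
    by (auto simp: pathin_subtopology)
  moreover have "u (path_simplex g) - u (l (g 1)) + u (l (g 0)) \<in> L"
    if g: "pathin S g" "g ` {0..1} \<subseteq> W" for g
  proof -
    define f where "f = (\<lambda>z::real \<times> real. k (fst z, g (snd z)))"
    have eq: "top_of_set ({0..1} \<times> {0..1}) = prod_topology (top_of_set {0..1::real}) (top_of_set {0..1::real})"
      by (simp add: subtopology_Times)
    have "continuous_map (top_of_set {0..1}) (subtopology S W) g"
      using g by (auto simp: pathin_def continuous_map_in_subtopology)
    then have "continuous_map (top_of_set ({0..1} \<times> {0..1}))
        (prod_topology (top_of_set {0..1::real}) (subtopology S W)) (\<lambda>z. (fst z, g (snd z)))"
      unfolding eq
      by (intro continuous_map_pairedI continuous_map_fst
          continuous_map_compose[OF continuous_map_snd, unfolded o_def])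
    from continuous_map_compose[OF this k(1)]
    have "continuous_map (top_of_set ({0..1} \<times> {0..1})) S f"
      by (simp add: f_def o_def continuous_map_in_subtopology)
    from square[OF this]
    have sq: "u (path_simplex (\<lambda>t. f (t, 0))) + u (path_simplex (\<lambda>t. f (1, t)))
      - (u (path_simplex (\<lambda>t. f (0, t))) + u (path_simplex (\<lambda>t. f (t, 1)))) \<in> L" .
    have "path_simplex (\<lambda>t. f (1, t)) = path_simplex g"
      by (rule path_simplex_cong) (use g k(2) in \<open>auto simp: f_def image_subset_iff\<close>)
    moreover have "path_simplex (\<lambda>t. f (0, t)) = path_simplex (\<lambda>_. c)"
      by (rule path_simplex_cong) (use g k(2) in \<open>auto simp: f_def image_subset_iff\<close>)
    ultimately show ?thesis
      using add[OF sq constant_path[OF c]]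
      by (simp add: f_def l_def algebra_simps)
  qed
  ultimately show thesis using that by blast
qed

text \<open>Each contractible set \<open>U x\<close> carries a primitive \<open>p x\<close> of \<open>u\<close>. Choose finitely many path connected open sets
\<open>P z\<close> covering \<open>S\<close> such that the union of any two that meet lies in a single \<open>U x\<close>; give
\<open>P z\<close> the primitive of some \<open>U (i z)\<close> that contains it. Where \<open>P z\<close> and \<open>P z'\<close> meet, both primitives
differ from that of the common set \<open>U j\<close> by constants, because a path inside \<open>P z\<close> computes the increments of both.
Hence they differ from each other by a constant, which can be read off at one chosen
point of the intersection; the set \<open>E\<close> collects the edges that express these finitely many constants.
Modulo \<open>L'\<close>, all the local primitives thus agree with the single \<open>l\<close>, and a path is subdivided into pieces
that stay inside one of the \<open>P z\<close>.\<close>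

lemma finitely_generated:
  assumes compact: "compact_space S" and Haus: "Hausdorff_space S"
    and lpc: "locally_path_connected_space S"
    and contr: "\<And>x. x \<in> topspace S \<Longrightarrow> \<exists>W. openin S W \<and> x \<in> W \<and> contracts_to S W x"
  obtains E l where "finite E" "\<And>e. e \<in> E \<Longrightarrow> singular_simplex 1 S e"
    "\<And>y. y \<in> topspace S \<Longrightarrow> singular_simplex 1 S (l y)"
    "\<And>L' \<sigma>. triangle_additive S u L' \<Longrightarrow> L \<subseteq> L' \<Longrightarrow> u ` E \<subseteq> L' \<Longrightarrow> singular_simplex 1 S \<sigma> \<Longrightarrow>
       u \<sigma> - u (l (\<sigma> (vertex 1))) + u (l (\<sigma> (vertex 0))) \<in> L'"
proof -
  obtain U where U: "\<And>x. x \<in> topspace S \<Longrightarrow> openin S (U x) \<and> x \<in> U x \<and> contracts_to S (U x) x"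
    using contr by metis
  have "\<exists>l. (\<forall>y\<in>U x. singular_simplex 1 S (l y)) \<and> (\<forall>g. pathin S g \<longrightarrow> g ` {0..1} \<subseteq> U x \<longrightarrow>
      u (path_simplex g) - u (l (g 1)) + u (l (g 0)) \<in> L)" if "x \<in> topspace S" for x
  proof -
    have "contracts_to S (U x) x" "U x \<subseteq> topspace S" using U[OF that] openin_subset by auto
    from contraction_primitive[OF this that]
    obtain l where "\<And>y. y \<in> U x \<Longrightarrow> singular_simplex 1 S (l y)"
        "\<And>g. pathin S g \<Longrightarrow> g ` {0..1} \<subseteq> U x \<Longrightarrow> u (path_simplex g) - u (l (g 1)) + u (l (g 0)) \<in> L"
      by blast
    then show ?thesis by blast
  qed
  then obtain p where p_simplex: "\<And>x y. x \<in> topspace S \<Longrightarrow> y \<in> U x \<Longrightarrow> singular_simplex 1 S (p x y)"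
    and p: "\<And>x g. x \<in> topspace S \<Longrightarrow> pathin S g \<Longrightarrow> g ` {0..1} \<subseteq> U x \<Longrightarrow>
      u (path_simplex g) - u (p x (g 1)) + u (p x (g 0)) \<in> L"
    by metis
  obtain T W where T: "finite T" "T \<subseteq> topspace S"
    and W: "\<And>z. z \<in> topspace S \<Longrightarrow> openin S (W z) \<and> z \<in> W z"
    and star: "\<And>z z'. W z \<inter> W z' \<noteq> {} \<Longrightarrow> \<exists>x\<in>T. W z \<union> W z' \<subseteq> U x"
    using star_refinement[OF compact Haus, of U] U by blast
  have "\<exists>P. openin S P \<and> path_connectedin S P \<and> z \<in> P \<and> P \<subseteq> W z" if "z \<in> topspace S" for z
    using lpc W[OF that] unfolding locally_path_connected_space by blast
  then obtain P where P: "\<And>z. z \<in> topspace S \<Longrightarrow>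
      openin S (P z) \<and> path_connectedin S (P z) \<and> z \<in> P z \<and> P z \<subseteq> W z" by metis
  have "\<exists>\<F>. finite \<F> \<and> \<F> \<subseteq> P ` topspace S \<and> topspace S \<subseteq> \<Union>\<F>"
    using compact[unfolded compact_space_alt, rule_format, of "P ` topspace S"] P by blast
  then obtain Z where Z: "finite Z" "Z \<subseteq> topspace S" "topspace S \<subseteq> \<Union>(P ` Z)"
    by (metis finite_subset_image)
  have starP: "\<exists>x\<in>T. P z \<union> P z' \<subseteq> U x" if "z \<in> Z" "z' \<in> Z" "y \<in> P z" "y \<in> P z'" for z z' y
    using star[of z z'] P[of z] P[of z'] that Z(2) by blast
  have "\<exists>x. x \<in> T \<and> P z \<subseteq> U x" if "z \<in> Z" for z
    using starP[OF that that] P[of z] Z(2) that by blast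
  then obtain i where i: "\<And>z. z \<in> Z \<Longrightarrow> i z \<in> T \<and> P z \<subseteq> U (i z)"
    by metis
  have iS: "i z \<in> topspace S" if "z \<in> Z" for z using i[OF that] T(2) by blast
  have "\<exists>z. z \<in> Z \<and> y \<in> P z" if "y \<in> topspace S" for y using Z(3) that by blast
  then obtain a where a: "\<And>y. y \<in> topspace S \<Longrightarrow> a y \<in> Z \<and> y \<in> P (a y)"
    by metis
  define m where "m z z' = (SOME x. x \<in> P z \<inter> P z')" for z z'
  have m: "m z z' \<in> P z \<and> m z z' \<in> P z'" if "y \<in> P z" "y \<in> P z'" for y z z'
    using someI[of "\<lambda>x. x \<in> P z \<inter> P z'" y] that unfolding m_def by blast
  define D where "D = {d \<in> Z \<times> Z. P (fst d) \<inter> P (snd d) \<noteq> {}}"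
  define E where "E = (\<lambda>d. p (i (fst d)) (m (fst d) (snd d))) ` D \<union> (\<lambda>d. p (i (snd d)) (m (fst d) (snd d))) ` D"
  define l where "l y = p (i (a y)) y" for y
  have "finite D" unfolding D_def using Z(1) by simp
  then have "finite E" unfolding E_def by blast
  moreover have "singular_simplex 1 S e" if e_in: "e \<in> E" for e
  proof -
    have vertex: "singular_simplex 1 S (p (i w) (m z z'))"
      if d: "(z, z') \<in> D" and w: "w = z \<or> w = z'" for z z' w
    proof -
      obtain y where "y \<in> P z" "y \<in> P z'" using d by (auto simp: D_def)
      then have "m z z' \<in> P w" using m w by blast
      moreover have "w \<in> Z" using d w by (auto simp: D_def)
      ultimately show ?thesis using i[of w] p_simplex[OF iS] by blast
    qed
    show ?thesis using e_in vertex by (auto simp: E_def)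
  qed
  moreover have "singular_simplex 1 S (l y)" if "y \<in> topspace S" for y
    unfolding l_def using a[OF that] i iS p_simplex by blast
  moreover have "u \<sigma> - u (l (\<sigma> (vertex 1))) + u (l (\<sigma> (vertex 0))) \<in> L'"
    if L': "triangle_additive S u L'" "L \<subseteq> L'" "u ` E \<subseteq> L'" and \<sigma>: "singular_simplex 1 S \<sigma>" for L' \<sigma>
  proof -
    interpret K: triangle_additive S u L' by (rule L'(1))
    \<comment> \<open>the primitives of two members of the cover agree modulo \<open>L'\<close> where both are defined\<close>
    have switch: "u (p (i z) y) - u (p (i z') y) \<in> L'"
      if z: "z \<in> Z" "z' \<in> Z" and y: "y \<in> P z" "y \<in> P z'" for z z' y
    proof -
      define x where "x = m z z'"
      have x: "x \<in> P z" "x \<in> P z'" using m[OF y] by (simp_all add: x_def)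
      obtain j where j: "j \<in> T" "P z \<union> P z' \<subseteq> U j" using starP[OF z y] by blast
      then have jS: "j \<in> topspace S" using T(2) by blast
      have path: "u (p j y) - u (p j x) - (u (p (i w) y) - u (p (i w) x)) \<in> L'"
        if w: "w \<in> Z" "x \<in> P w" "y \<in> P w" "P w \<subseteq> U j" for w
      proof -
        have "path_connectedin S (P w)" using P Z(2) w(1) by blast
        then obtain q where q: "pathin S q" "q \<in> {0..1} \<rightarrow> P w" "q 0 = x" "q 1 = y"
          using w unfolding path_connectedin by blast
        then have "q ` {0..1} \<subseteq> P w" by blast
        then have "u (path_simplex q) - u (p j y) + u (p j x) \<in> L'"
            "u (path_simplex q) - u (p (i w) y) + u (p (i w) x) \<in> L'"
          using p[OF jS q(1)] p[OF iS[OF w(1)] q(1)] i[OF w(1)] w(4) q(3,4) L'(2) by blast+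
        from K.diff[OF this(2,1)] show ?thesis by (simp add: algebra_simps)
      qed
      have d_in: "(z, z') \<in> D" using z y by (auto simp: D_def)
      have "u (p (i z) x) \<in> L'" "u (p (i z') x) \<in> L'"
        using L'(3) d_in unfolding E_def x_def by force+
      note 1 = K.diff[OF this]
      have "u (p (i z) y) - u (p (i z) x) - (u (p (i z') y) - u (p (i z') x)) \<in> L'"
        using K.diff[OF path[of z'] path[of z]] z x y j(2) by (simp add: algebra_simps)
      from K.add[OF this 1] show ?thesis by (simp add: algebra_simps)
    qed
    obtain g where g: "pathin S g" "\<sigma> = path_simplex g" using \<sigma> singular_simplex_1_iff by blast
    have gS: "g t \<in> topspace S" if "t \<in> {0..1}" for t
      using g(1) that by (auto simp: pathin_def continuous_map_def)
    define Q where "Q s t \<longleftrightarrow> (s \<in> {0..1} \<longrightarrow> t \<in> {0..1} \<longrightarrow>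
        u (path_simplex (g \<circ> linepath s t)) - u (l (g t)) + u (l (g s)) \<in> L')" for s t
    have "Q 0 1"
    proof (rule Bolzano[of 0 1 Q], goal_cases le trans local)
      case (trans r s t)
      show ?case
        unfolding Q_def
      proof (intro impI)
        assume "r \<in> {0..1::real}" "t \<in> {0..1::real}"
        moreover from this have s: "s \<in> {0..1}" using trans by auto
        ultimately have "u (path_simplex (g \<circ> linepath r s)) - u (l (g s)) + u (l (g r)) \<in> L'"
            "u (path_simplex (g \<circ> linepath s t)) - u (l (g t)) + u (l (g s)) \<in> L'"
            "u (path_simplex (g \<circ> linepath r s)) + u (path_simplex (g \<circ> linepath s t))
              - u (path_simplex (g \<circ> linepath r t)) \<in> L'"
          using trans(1,2) K.subdivide[OF g(1)] unfolding Q_def by blast+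
        from K.diff[OF K.add[OF this(1,2)] this(3)]
        show "u (path_simplex (g \<circ> linepath r t)) - u (l (g t)) + u (l (g r)) \<in> L'"
          by (simp add: algebra_simps)
      qed
    next
      case (local x)
      then have x: "x \<in> {0..1}" by simp
      define z where "z = a (g x)"
      have z: "z \<in> Z" "g x \<in> P z" using a[OF gS[OF x]] by (simp_all add: z_def)
      then have zS: "openin S (P z)" using P Z(2) by blast
      have "openin (top_of_set {0..1}) {t \<in> topspace (top_of_set {0..1}). g t \<in> P z}"
        using openin_continuous_map_preimage[OF g(1)[unfolded pathin_def] zS] .
      then obtain O' where O': "open O'" "{t \<in> {0..1}. g t \<in> P z} = {0..1} \<inter> O'"
        by (auto simp: openin_open)
      then have "x \<in> O'" using x z by blast
      then obtain d where d: "d > 0" "ball x d \<subseteq> O'" using O'(1) open_contains_ball by blast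
      have "Q s t" if st: "s \<le> x" "x \<le> t" "t - s < d" for s t
        unfolding Q_def
      proof (intro impI)
        assume s: "s \<in> {0..1::real}" and t: "t \<in> {0..1::real}"
        have in_P: "g r \<in> P z" if "s \<le> r" "r \<le> t" for r
        proof -
          have "r \<in> ball x d" using that st by (auto simp: dist_real_def)
          then have "r \<in> {0..1} \<inter> O'" using d(2) that s t by auto
          then show ?thesis using O'(2) by blast
        qed
        have line: "linepath s t r \<in> {s..t}" if "r \<in> {0..1}" for r
          using that linepath_in_path[of r s t] closed_segment_eq_real_ivl[of s t] st by auto
        have "continuous_map (top_of_set {0..1}) (top_of_set {0..1}) (linepath s t)"
          using line s t by (force simp: continuous_map_in_subtopology intro: continuous_intros)
        then have path: "pathin S (g \<circ> linepath s t)"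
          using g(1) continuous_map_compose unfolding pathin_def by blast
        have img: "(g \<circ> linepath s t) ` {0..1} \<subseteq> U (i z)"
          using line in_P i[OF z(1)] by fastforce
        have 1: "u (path_simplex (g \<circ> linepath s t)) - u (p (i z) (g t)) + u (p (i z) (g s)) \<in> L'"
          using p[OF iS[OF z(1)] path img] L'(2) by (auto simp: linepath_0' linepath_1')
        have 2: "u (p (i z) (g t)) - u (l (g t)) \<in> L'" "u (p (i z) (g s)) - u (l (g s)) \<in> L'"
          using switch[OF z(1)] a[OF gS[OF t]] a[OF gS[OF s]] in_P st unfolding l_def by auto
        from K.add[OF 1 K.diff[OF 2]]
        show "u (path_simplex (g \<circ> linepath s t)) - u (l (g t)) + u (l (g s)) \<in> L'"
          by (simp add: algebra_simps)
      qed
      then show ?case using d(1) by blast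
    qed simp
    moreover have "g \<circ> linepath 0 1 = g" by (simp add: fun_eq_iff linepath_def)
    ultimately show ?thesis unfolding Q_def g(2) by simp
  qed
  ultimately show thesis using that[of E l] by blast
qed

end

section \<open>Quotient modules\<close>

text \<open>Homology and cohomology are both given as a \<open>quotient_module\<close>. This locale provides the module
laws and the linear map to classes once for both.\<close>

locale quotient_data = M: module "ring_of_type_algebra :: 'r::comm_ring_1 ring" M
  for M :: "('r::comm_ring_1, 'm) module" +
  fixes N :: "'m set"
  assumes N_sub: "N \<subseteq> carrier M" and N_zero: "\<zero>\<^bsub>M\<^esub> \<in> N"
    and N_add: "x \<in> N \<Longrightarrow> y \<in> N \<Longrightarrow> x \<oplus>\<^bsub>M\<^esub> y \<in> N" and N_smult: "x \<in> N \<Longrightarrow> r \<odot>\<^bsub>M\<^esub> x \<in> N"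
begin

definition cl :: "'m \<Rightarrow> 'm set" where
  "cl x = (\<lambda>n. n \<oplus>\<^bsub>M\<^esub> x) ` N"

abbreviation Q :: "('r, 'm set) module" where "Q \<equiv> quotient_module M N"

lemma coset_eq: "N +>\<^bsub>M\<^esub> x = cl x"
  by (auto simp: cl_def a_r_coset_def')

lemma carrier_Q: "carrier Q = cl ` carrier M"
  by (auto simp: quotient_module_def A_RCOSETS_def' coset_eq)

lemma zero_Q: "\<zero>\<^bsub>Q\<^esub> = cl \<zero>\<^bsub>M\<^esub>"
  using N_sub by (force simp: quotient_module_def cl_def subset_iff image_iff)

lemma neg: "x \<in> carrier M \<Longrightarrow> \<ominus>\<^bsub>M\<^esub> x = (- 1) \<odot>\<^bsub>M\<^esub> x"
proof -
  assume x: "x \<in> carrier M"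
  have "(- 1) \<odot>\<^bsub>M\<^esub> x \<oplus>\<^bsub>M\<^esub> x = ((- 1) + 1) \<odot>\<^bsub>M\<^esub> x"
    using x M.smult_l_distr[of "- 1" 1 x] M.smult_one[OF x] by simp
  also have "\<dots> = \<zero>\<^bsub>M\<^esub>" using M.smult_l_null[OF x] by simp
  finally show ?thesis using x by (intro M.minus_equality) auto
qed

lemma N_neg: "x \<in> N \<Longrightarrow> \<ominus>\<^bsub>M\<^esub> x \<in> N"
  using neg N_smult N_sub by (metis subsetD)

lemma self_in_cl: "x \<in> carrier M \<Longrightarrow> x \<in> cl x"
  using N_zero by (force simp: cl_def image_iff)

lemma cl_absorb: "n \<in> N \<Longrightarrow> x \<in> carrier M \<Longrightarrow> cl (n \<oplus>\<^bsub>M\<^esub> x) = cl x"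
proof -
  assume n: "n \<in> N" and x: "x \<in> carrier M"
  have nc: "n \<in> carrier M" using n N_sub by blast
  show ?thesis
  proof (intro equalityI subsetI)
    fix y assume "y \<in> cl (n \<oplus>\<^bsub>M\<^esub> x)"
    then obtain m where m: "m \<in> N" "y = m \<oplus>\<^bsub>M\<^esub> (n \<oplus>\<^bsub>M\<^esub> x)" by (auto simp: cl_def)
    then have "y = (m \<oplus>\<^bsub>M\<^esub> n) \<oplus>\<^bsub>M\<^esub> x" using N_sub nc x by (simp add: M.a_assoc subset_iff)
    then show "y \<in> cl x" using N_add[OF m(1) n] by (auto simp: cl_def)
  next
    fix y assume "y \<in> cl x"
    then obtain m where m: "m \<in> N" "y = m \<oplus>\<^bsub>M\<^esub> x" by (auto simp: cl_def)
    have mc: "m \<in> carrier M" using m N_sub by blast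
    have "y = (m \<oplus>\<^bsub>M\<^esub> \<ominus>\<^bsub>M\<^esub> n) \<oplus>\<^bsub>M\<^esub> (n \<oplus>\<^bsub>M\<^esub> x)"
      using m mc nc x by (simp add: M.a_assoc M.r_neg1)
    then show "y \<in> cl (n \<oplus>\<^bsub>M\<^esub> x)" using N_add[OF m(1) N_neg[OF n]] by (auto simp: cl_def)
  qed
qed

lemma cl_eq_iff:
  assumes "x \<in> carrier M" "y \<in> carrier M"
  shows "cl x = cl y \<longleftrightarrow> (\<exists>n\<in>N. x = n \<oplus>\<^bsub>M\<^esub> y)"
proof
  assume "cl x = cl y"
  then have "x \<in> cl y" using self_in_cl[OF assms(1)] by simp
  then show "\<exists>n\<in>N. x = n \<oplus>\<^bsub>M\<^esub> y" by (auto simp: cl_def)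
qed (use cl_absorb assms in blast)

lemma cl_eq_zero_iff: "x \<in> carrier M \<Longrightarrow> cl x = \<zero>\<^bsub>Q\<^esub> \<longleftrightarrow> x \<in> N"
proof -
  assume x: "x \<in> carrier M"
  have "cl x = \<zero>\<^bsub>Q\<^esub> \<longleftrightarrow> (\<exists>n\<in>N. x = n \<oplus>\<^bsub>M\<^esub> \<zero>\<^bsub>M\<^esub>)"
    unfolding zero_Q by (rule cl_eq_iff) (use x in auto)
  also have "\<dots> \<longleftrightarrow> x \<in> N" using N_sub by (auto simp: subset_iff)
  finally show ?thesis .
qed

lemma add_Q:
  assumes "x \<in> carrier M" "y \<in> carrier M"
  shows "cl x \<oplus>\<^bsub>Q\<^esub> cl y = cl (x \<oplus>\<^bsub>M\<^esub> y)"
proof -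
  have "cl x \<oplus>\<^bsub>Q\<^esub> cl y = {a \<oplus>\<^bsub>M\<^esub> b | a b. a \<in> cl x \<and> b \<in> cl y}"
    by (auto simp: quotient_module_def set_add_def')
  also have "\<dots> = cl (x \<oplus>\<^bsub>M\<^esub> y)"
  proof (intro equalityI subsetI)
    fix z assume "z \<in> {a \<oplus>\<^bsub>M\<^esub> b | a b. a \<in> cl x \<and> b \<in> cl y}"
    then obtain m n where mn: "m \<in> N" "n \<in> N" "z = (m \<oplus>\<^bsub>M\<^esub> x) \<oplus>\<^bsub>M\<^esub> (n \<oplus>\<^bsub>M\<^esub> y)"
      by (auto simp: cl_def)
    then have "z = (m \<oplus>\<^bsub>M\<^esub> n) \<oplus>\<^bsub>M\<^esub> (x \<oplus>\<^bsub>M\<^esub> y)"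
      using assms N_sub by (simp add: M.a_ac subset_iff)
    then show "z \<in> cl (x \<oplus>\<^bsub>M\<^esub> y)" using N_add mn by (auto simp: cl_def)
  next
    fix z assume "z \<in> cl (x \<oplus>\<^bsub>M\<^esub> y)"
    then obtain m where m: "m \<in> N" "z = m \<oplus>\<^bsub>M\<^esub> (x \<oplus>\<^bsub>M\<^esub> y)" by (auto simp: cl_def)
    then have "z = (m \<oplus>\<^bsub>M\<^esub> x) \<oplus>\<^bsub>M\<^esub> y" using assms N_sub by (simp add: M.a_assoc subset_iff)
    then show "z \<in> {a \<oplus>\<^bsub>M\<^esub> b | a b. a \<in> cl x \<and> b \<in> cl y}"
      using m(1) self_in_cl[OF assms(2)] by (auto simp: cl_def)
  qed
  finally show ?thesis .
qed

lemma smult_Q: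
  assumes "x \<in> carrier M"
  shows "r \<odot>\<^bsub>Q\<^esub> cl x = cl (r \<odot>\<^bsub>M\<^esub> x)"
proof -
  have "cl (r \<odot>\<^bsub>M\<^esub> c) = cl (r \<odot>\<^bsub>M\<^esub> x)" if c: "c \<in> cl x" for c
  proof -
    obtain n where n: "n \<in> N" "c = n \<oplus>\<^bsub>M\<^esub> x" using c by (auto simp: cl_def)
    then have "r \<odot>\<^bsub>M\<^esub> c = r \<odot>\<^bsub>M\<^esub> n \<oplus>\<^bsub>M\<^esub> r \<odot>\<^bsub>M\<^esub> x"
      using assms N_sub M.smult_r_distr by auto
    then show ?thesis using cl_absorb[OF N_smult[OF n(1)]] assms by simp
  qed
  moreover have "r \<odot>\<^bsub>Q\<^esub> cl x = (\<Union>c\<in>cl x. cl (r \<odot>\<^bsub>M\<^esub> c))"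
    by (simp add: quotient_module_def coset_eq)
  moreover have "cl x \<noteq> {}" using self_in_cl[OF assms] by blast
  ultimately show ?thesis by simp
qed

lemma module_Q: "module (ring_of_type_algebra :: 'r ring) Q"
proof (rule moduleI)
  show "cring (ring_of_type_algebra :: 'r ring)" by (rule M.is_cring)
  show "abelian_group Q"
  proof (rule abelian_groupI)
    show "\<exists>y\<in>carrier Q. y \<oplus>\<^bsub>Q\<^esub> x = \<zero>\<^bsub>Q\<^esub>" if x: "x \<in> carrier Q" for x
    proof -
      obtain a where a: "a \<in> carrier M" "x = cl a" using x by (auto simp: carrier_Q)
      then have "cl (\<ominus>\<^bsub>M\<^esub> a) \<oplus>\<^bsub>Q\<^esub> x = \<zero>\<^bsub>Q\<^esub>" by (simp add: add_Q zero_Q M.l_neg)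
      then show ?thesis using a by (auto simp: carrier_Q)
    qed
  qed (auto simp: carrier_Q add_Q zero_Q M.a_ac)
qed (auto simp: carrier_Q add_Q smult_Q M.smult_l_distr[simplified] M.smult_r_distr[simplified]
    M.smult_assoc1[simplified] M.smult_one[simplified])

end

section \<open>Cochains in low degrees\<close>

lemma module_cochain: "module (ring_of_type_algebra :: 'r::comm_ring_1 ring) (cochain_module n S)"
proof (rule moduleI)
  show "cring (ring_of_type_algebra :: 'r ring)" by (rule cring_from_type_algebra)
  show "abelian_group (cochain_module n S :: ('r, 'a sing_simplex \<Rightarrow> 'r) module)"
  proof (rule abelian_groupI)
    show "\<exists>y\<in>carrier (cochain_module n S). y \<oplus>\<^bsub>cochain_module n S\<^esub> x = \<zero>\<^bsub>cochain_module n S\<^esub>"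
      if "x \<in> carrier (cochain_module n S)" for x :: "'a sing_simplex \<Rightarrow> 'r"
      by (rule bexI[of _ "\<lambda>\<sigma>. - x \<sigma>"]) (use that in \<open>auto simp: cochain_module_def\<close>)
  qed (auto simp: cochain_module_def algebra_simps)
qed (auto simp: cochain_module_def algebra_simps)

lemma vertex_face:
  assumes "singular_simplex 2 S \<tau>"
  shows "singular_face 2 0 \<tau> (vertex 0) = \<tau> (vertex 1)" "singular_face 2 0 \<tau> (vertex 1) = \<tau> (vertex 2)"
    "singular_face 2 1 \<tau> (vertex 0) = \<tau> (vertex 0)" "singular_face 2 1 \<tau> (vertex 1) = \<tau> (vertex 2)"
    "singular_face 2 2 \<tau> (vertex 0) = \<tau> (vertex 0)" "singular_face 2 2 \<tau> (vertex 1) = \<tau> (vertex 1)"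
proof -
  have v: "vertex 0 \<in> standard_simplex (Suc 0)" "vertex (Suc 0) \<in> standard_simplex (Suc 0)"
    by (simp_all add: vertex_def)
  have "simplical_face 0 (vertex 0) = vertex 1" "simplical_face 0 (vertex 1) = vertex 2"
    "simplical_face 1 (vertex 0) = vertex 0" "simplical_face 1 (vertex 1) = vertex 2"
    "simplical_face 2 (vertex 0) = vertex 0" "simplical_face 2 (vertex 1) = vertex 1"
    by (auto simp: simplical_face_def vertex_def fun_eq_iff)
  then show "singular_face 2 0 \<tau> (vertex 0) = \<tau> (vertex 1)" "singular_face 2 0 \<tau> (vertex 1) = \<tau> (vertex 2)"
    "singular_face 2 1 \<tau> (vertex 0) = \<tau> (vertex 0)" "singular_face 2 1 \<tau> (vertex 1) = \<tau> (vertex 2)"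
    "singular_face 2 2 \<tau> (vertex 0) = \<tau> (vertex 0)" "singular_face 2 2 \<tau> (vertex 1) = \<tau> (vertex 1)"
    using v by (simp_all add: singular_face_def)
qed

lemma singular_face_2:
  assumes "singular_simplex 2 S \<tau>"
  shows "singular_simplex 1 S (singular_face 2 0 \<tau>)" "singular_simplex 1 S (singular_face 2 1 \<tau>)"
    "singular_simplex 1 S (singular_face 2 2 \<tau>)"
  using singular_simplex_singular_face[OF assms] by force+

lemma coboundary_0:
  "coboundary 0 S h = (\<lambda>\<sigma>. if singular_simplex 1 S \<sigma>
     then h (point_simplex (\<sigma> (vertex 1))) - h (point_simplex (\<sigma> (vertex 0))) else 0)"
  by (rule ext) (use face_1 in \<open>force simp: coboundary_def\<close>)

lemma coboundary_1:
  "coboundary 1 S f = (\<lambda>\<tau>. if singular_simplex 2 S \<tau>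
     then f (singular_face 2 0 \<tau>) - f (singular_face 2 1 \<tau>) + f (singular_face 2 2 \<tau>) else 0)"
  by (rule ext) (simp add: coboundary_def numeral_2_eq_2)

lemma in_cocycles_1:
  "f \<in> cocycles 1 S \<longleftrightarrow> (\<forall>\<sigma>. \<not> singular_simplex 1 S \<sigma> \<longrightarrow> f \<sigma> = 0) \<and> (\<forall>\<tau>. singular_simplex 2 S \<tau> \<longrightarrow>
     f (singular_face 2 0 \<tau>) - f (singular_face 2 1 \<tau>) + f (singular_face 2 2 \<tau>) = 0)"
  unfolding cocycles_def coboundary_1 by (auto simp: cochain_module_def fun_eq_iff)

lemma cocycle_triangle_additive:
  assumes "f \<in> cocycles 1 S"
  shows "triangle_additive S f {0}"
  using assms in_cocycles_1[of f S] by unfold_locales auto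

text \<open>A 0-cochain is a function on points, and the boundary of an edge is the difference of its end points.\<close>

lemma in_coboundaries_1:
  "f \<in> coboundaries 1 S \<longleftrightarrow>
     (\<exists>h. f = (\<lambda>\<sigma>. if singular_simplex 1 S \<sigma> then h (\<sigma> (vertex 1)) - h (\<sigma> (vertex 0)) else 0))"
proof
  assume "f \<in> coboundaries 1 S"
  then obtain g where "f = coboundary 0 S g" by (auto simp: coboundaries_def)
  then show "\<exists>h. f = (\<lambda>\<sigma>. if singular_simplex 1 S \<sigma> then h (\<sigma> (vertex 1)) - h (\<sigma> (vertex 0)) else 0)"
    unfolding coboundary_0 by (intro exI[of _ "\<lambda>x. g (point_simplex x)"]) simp
next
  assume "\<exists>h. f = (\<lambda>\<sigma>. if singular_simplex 1 S \<sigma> then h (\<sigma> (vertex 1)) - h (\<sigma> (vertex 0)) else 0)"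
  then obtain h where h: "f = (\<lambda>\<sigma>. if singular_simplex 1 S \<sigma> then h (\<sigma> (vertex 1)) - h (\<sigma> (vertex 0)) else 0)"
    by blast
  define g where "g \<sigma> = (if singular_simplex 0 S \<sigma> then h (\<sigma> (vertex 0)) else 0)" for \<sigma>
  have p: "point_simplex x (vertex 0) = x" for x :: 'a
    by (simp add: point_simplex_def standard_simplex_0_vertex)
  have "f = coboundary 0 S g"
    unfolding coboundary_0 h
    by (rule ext) (auto simp: g_def p singular_point_simplex simplex_1_ends_in simp del: One_nat_def)
  moreover have "g \<in> carrier (cochain_module 0 S)" by (simp add: cochain_module_def g_def)
  ultimately show "f \<in> coboundaries 1 S" by (auto simp: coboundaries_def)
qed

lemma in_coboundaries_2:
  "F \<in> coboundaries 2 S \<longleftrightarrow> (\<exists>g. F = (\<lambda>\<tau>. if singular_simplex 2 S \<tau>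
     then g (singular_face 2 0 \<tau>) - g (singular_face 2 1 \<tau>) + g (singular_face 2 2 \<tau>) else 0))"
proof -
  have "F \<in> coboundaries 2 S \<longleftrightarrow> (\<exists>g\<in>carrier (cochain_module 1 S). F = coboundary 1 S g)"
    by (auto simp: coboundaries_def)
  also have "\<dots> \<longleftrightarrow> (\<exists>g. F = coboundary 1 S g)"
  proof
    assume "\<exists>g. F = coboundary 1 S g"
    then obtain g where g: "F = coboundary 1 S g" by blast
    define g' where "g' \<sigma> = (if singular_simplex 1 S \<sigma> then g \<sigma> else 0)" for \<sigma>
    have "F = coboundary 1 S g'"
      unfolding g coboundary_1 by (rule ext) (simp add: g'_def singular_face_2 del: One_nat_def)
    moreover have "g' \<in> carrier (cochain_module 1 S)" by (simp add: cochain_module_def g'_def)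
    ultimately show "\<exists>g\<in>carrier (cochain_module 1 S). F = coboundary 1 S g" by blast
  qed blast
  finally show ?thesis unfolding coboundary_1 .
qed

lemma coboundaries_subset_cocycles: "coboundaries 1 S \<subseteq> cocycles 1 S"
proof
  fix f assume "f \<in> coboundaries 1 S"
  then obtain h where "f = (\<lambda>\<sigma>. if singular_simplex 1 S \<sigma> then h (\<sigma> (vertex 1)) - h (\<sigma> (vertex 0)) else 0)"
    using in_coboundaries_1 by blast
  then show "f \<in> cocycles 1 S"
    unfolding in_cocycles_1 by (simp add: singular_face_2 vertex_face del: One_nat_def)
qed

lemma cocycles_closed:
  "(\<lambda>\<sigma>. 0) \<in> cocycles 1 S"
  "f \<in> cocycles 1 S \<Longrightarrow> g \<in> cocycles 1 S \<Longrightarrow> (\<lambda>\<sigma>. f \<sigma> + g \<sigma>) \<in> cocycles 1 S"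
  "f \<in> cocycles 1 S \<Longrightarrow> (\<lambda>\<sigma>. r * f \<sigma>) \<in> cocycles 1 S"
proof -
  show "(\<lambda>\<sigma>. 0) \<in> cocycles 1 S" unfolding in_cocycles_1 by simp
  show "(\<lambda>\<sigma>. f \<sigma> + g \<sigma>) \<in> cocycles 1 S" if "f \<in> cocycles 1 S" "g \<in> cocycles 1 S"
    unfolding in_cocycles_1
  proof (intro conjI allI impI)
    fix \<tau> assume "singular_simplex 2 S \<tau>"
    then have "f (singular_face 2 0 \<tau>) - f (singular_face 2 1 \<tau>) + f (singular_face 2 2 \<tau>) = 0"
      "g (singular_face 2 0 \<tau>) - g (singular_face 2 1 \<tau>) + g (singular_face 2 2 \<tau>) = 0"
      using that unfolding in_cocycles_1 by blast+
    then have "(f (singular_face 2 0 \<tau>) - f (singular_face 2 1 \<tau>) + f (singular_face 2 2 \<tau>))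
        + (g (singular_face 2 0 \<tau>) - g (singular_face 2 1 \<tau>) + g (singular_face 2 2 \<tau>)) = 0" by simp
    then show "f (singular_face 2 0 \<tau>) + g (singular_face 2 0 \<tau>) - (f (singular_face 2 1 \<tau>) + g (singular_face 2 1 \<tau>)) +
         (f (singular_face 2 2 \<tau>) + g (singular_face 2 2 \<tau>)) = 0" by (simp add: algebra_simps)
  qed (use that[unfolded in_cocycles_1] in simp)
  show "(\<lambda>\<sigma>. r * f \<sigma>) \<in> cocycles 1 S" if "f \<in> cocycles 1 S"
    using that unfolding in_cocycles_1
    by (simp flip: right_diff_distrib distrib_left)
qed

lemma coboundaries_closed:
  "(\<lambda>\<sigma>. 0) \<in> coboundaries 1 S"
  "f \<in> coboundaries 1 S \<Longrightarrow> g \<in> coboundaries 1 S \<Longrightarrow> (\<lambda>\<sigma>. f \<sigma> + g \<sigma>) \<in> coboundaries 1 S"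
  "f \<in> coboundaries 1 S \<Longrightarrow> (\<lambda>\<sigma>. r * f \<sigma>) \<in> coboundaries 1 S"
proof -
  show "(\<lambda>\<sigma>. 0) \<in> coboundaries 1 S"
    unfolding in_coboundaries_1 by (intro exI[of _ "\<lambda>_. 0"]) auto
  show "(\<lambda>\<sigma>. f \<sigma> + g \<sigma>) \<in> coboundaries 1 S" if fg: "f \<in> coboundaries 1 S" "g \<in> coboundaries 1 S"
  proof -
    obtain h k where "f = (\<lambda>\<sigma>. if singular_simplex 1 S \<sigma> then h (\<sigma> (vertex 1)) - h (\<sigma> (vertex 0)) else 0)"
      "g = (\<lambda>\<sigma>. if singular_simplex 1 S \<sigma> then k (\<sigma> (vertex 1)) - k (\<sigma> (vertex 0)) else 0)"
      using fg unfolding in_coboundaries_1 by blast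
    then show ?thesis unfolding in_coboundaries_1 by (intro exI[of _ "\<lambda>x. h x + k x"]) auto
  qed
  show "(\<lambda>\<sigma>. r * f \<sigma>) \<in> coboundaries 1 S" if f: "f \<in> coboundaries 1 S"
  proof -
    obtain h where "f = (\<lambda>\<sigma>. if singular_simplex 1 S \<sigma> then h (\<sigma> (vertex 1)) - h (\<sigma> (vertex 0)) else 0)"
      using f unfolding in_coboundaries_1 by blast
    then show ?thesis unfolding in_coboundaries_1
      by (intro exI[of _ "\<lambda>x. r * h x"]) (auto simp: algebra_simps)
  qed
qed

lemma coboundaries_2_closed:
  "(\<lambda>\<sigma>. 0) \<in> coboundaries 2 S"
  "F \<in> coboundaries 2 S \<Longrightarrow> G \<in> coboundaries 2 S \<Longrightarrow> (\<lambda>\<sigma>. F \<sigma> + G \<sigma>) \<in> coboundaries 2 S"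
  "F \<in> coboundaries 2 S \<Longrightarrow> (\<lambda>\<sigma>. r * F \<sigma>) \<in> coboundaries 2 S"
proof -
  show "(\<lambda>\<sigma>. 0) \<in> coboundaries 2 S"
    unfolding in_coboundaries_2 by (intro exI[of _ "\<lambda>_. 0"]) auto
  show "(\<lambda>\<sigma>. F \<sigma> + G \<sigma>) \<in> coboundaries 2 S" if FG: "F \<in> coboundaries 2 S" "G \<in> coboundaries 2 S"
  proof -
    obtain f g where "F = (\<lambda>\<tau>. if singular_simplex 2 S \<tau>
          then f (singular_face 2 0 \<tau>) - f (singular_face 2 1 \<tau>) + f (singular_face 2 2 \<tau>) else 0)"
       "G = (\<lambda>\<tau>. if singular_simplex 2 S \<tau>
          then g (singular_face 2 0 \<tau>) - g (singular_face 2 1 \<tau>) + g (singular_face 2 2 \<tau>) else 0)"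
      using FG unfolding in_coboundaries_2 by blast
    then show ?thesis unfolding in_coboundaries_2 by (intro exI[of _ "\<lambda>x. f x + g x"]) auto
  qed
  show "(\<lambda>\<sigma>. r * F \<sigma>) \<in> coboundaries 2 S" if F: "F \<in> coboundaries 2 S"
  proof -
    obtain f where "F = (\<lambda>\<tau>. if singular_simplex 2 S \<tau>
          then f (singular_face 2 0 \<tau>) - f (singular_face 2 1 \<tau>) + f (singular_face 2 2 \<tau>) else 0)"
      using F unfolding in_coboundaries_2 by blast
    then show ?thesis unfolding in_coboundaries_2
      by (intro exI[of _ "\<lambda>x. r * f x"]) (auto simp: algebra_simps)
  qed
qed

lemma cocycle_quotient:
  "quotient_data ((cochain_module 1 S)\<lparr>carrier := cocycles 1 S\<rparr> :: ('r::comm_ring_1, 'a sing_simplex \<Rightarrow> 'r) module)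
     (coboundaries 1 S)"
proof -
  interpret C: module "ring_of_type_algebra :: 'r ring" "cochain_module 1 S :: ('r, 'a sing_simplex \<Rightarrow> 'r) module"
    by (rule module_cochain)
  have sub: "submodule (cocycles 1 S) (ring_of_type_algebra :: 'r ring)
      (cochain_module 1 S :: ('r, 'a sing_simplex \<Rightarrow> 'r) module)"
  proof (rule C.submoduleI)
    fix f :: "'a sing_simplex \<Rightarrow> 'r" assume f: "f \<in> cocycles 1 S"
    have "\<ominus>\<^bsub>cochain_module 1 S\<^esub> f = (\<lambda>\<sigma>. (- 1) * f \<sigma>)"
      using f by (intro C.minus_equality) (auto simp: cochain_module_def cocycles_def)
    then show "\<ominus>\<^bsub>cochain_module 1 S\<^esub> f \<in> cocycles 1 S" using cocycles_closed(3)[OF f] by metis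
  next
    show "\<zero>\<^bsub>cochain_module 1 S\<^esub> \<in> (cocycles 1 S :: ('a sing_simplex \<Rightarrow> 'r) set)"
      using cocycles_closed(1)[of S] by (simp add: cochain_module_def)
    show "f \<oplus>\<^bsub>cochain_module 1 S\<^esub> g \<in> cocycles 1 S" if "f \<in> cocycles 1 S" "g \<in> cocycles 1 S"
      for f g :: "'a sing_simplex \<Rightarrow> 'r"
      using cocycles_closed(2)[OF that] by (simp add: cochain_module_def)
    show "r \<odot>\<^bsub>cochain_module 1 S\<^esub> f \<in> cocycles 1 S" if "f \<in> cocycles 1 S"
      for r and f :: "'a sing_simplex \<Rightarrow> 'r"
      using cocycles_closed(3)[OF that] by (simp add: cochain_module_def)
  qed (simp add: cocycles_def)
  interpret M: module "ring_of_type_algebra :: 'r ring"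
      "(cochain_module 1 S)\<lparr>carrier := cocycles 1 S\<rparr> :: ('r, 'a sing_simplex \<Rightarrow> 'r) module"
    by (rule submodule.submodule_is_module[OF sub module_cochain])
  show ?thesis
    by unfold_locales
      (use coboundaries_subset_cocycles coboundaries_closed in \<open>auto simp: cochain_module_def\<close>)
qed

section \<open>Cohomology classes of degree one\<close>

definition coh_class :: "'a topology \<Rightarrow> ('a sing_simplex \<Rightarrow> 'r::comm_ring_1) \<Rightarrow> ('a sing_simplex \<Rightarrow> 'r) set" where
  "coh_class S f = (\<lambda>b \<sigma>. b \<sigma> + f \<sigma>) ` coboundaries 1 S"

lemma cochain_simps:
  "f \<oplus>\<^bsub>cochain_module n S\<^esub> g = (\<lambda>\<sigma>. f \<sigma> + g \<sigma>)"
  "r \<odot>\<^bsub>cochain_module n S\<^esub> f = (\<lambda>\<sigma>. r * f \<sigma>)"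
  "\<zero>\<^bsub>cochain_module n S\<^esub> = (\<lambda>\<sigma>. 0)"
  by (simp_all add: cochain_module_def)

context
  fixes S :: "'a topology" and R :: "'r::comm_ring_1 itself"
begin

interpretation Q: quotient_data
  "(cochain_module 1 S)\<lparr>carrier := cocycles 1 S\<rparr> :: ('r, 'a sing_simplex \<Rightarrow> 'r) module" "coboundaries 1 S"
  by (rule cocycle_quotient)

lemma coh_class_cl: "Q.cl f = coh_class S f"
  unfolding Q.cl_def coh_class_def by (simp add: cochain_module_def)

lemma cohomology_Q: "cohomology 1 S = Q.Q"
  by (simp add: cohomology_def)

lemma module_cohomology:
  "module (ring_of_type_algebra :: 'r ring) (cohomology 1 S :: ('r, ('a sing_simplex \<Rightarrow> 'r) set) module)"
  unfolding cohomology_Q by (rule Q.module_Q)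

lemma carrier_cohomology:
  "carrier (cohomology 1 S :: ('r, ('a sing_simplex \<Rightarrow> 'r) set) module) = coh_class S ` cocycles 1 S"
  unfolding cohomology_Q Q.carrier_Q coh_class_cl by simp

lemma coh_class_add:
  fixes f g :: "'a sing_simplex \<Rightarrow> 'r"
  assumes "f \<in> cocycles 1 S" "g \<in> cocycles 1 S"
  shows "coh_class S f \<oplus>\<^bsub>cohomology 1 S\<^esub> coh_class S g = coh_class S (\<lambda>\<sigma>. f \<sigma> + g \<sigma>)"
  using Q.add_Q[of f g] assms
  unfolding cohomology_Q coh_class_cl by (simp add: cochain_module_def)

lemma coh_class_smult:
  fixes f :: "'a sing_simplex \<Rightarrow> 'r"
  assumes "f \<in> cocycles 1 S"
  shows "r \<odot>\<^bsub>cohomology 1 S\<^esub> coh_class S f = coh_class S (\<lambda>\<sigma>. r * f \<sigma>)"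
  using Q.smult_Q[of f r] assms
  unfolding cohomology_Q coh_class_cl by (simp add: cochain_module_def)

lemma coh_class_zero_iff:
  fixes f :: "'a sing_simplex \<Rightarrow> 'r"
  assumes "f \<in> cocycles 1 S"
  shows "coh_class S f = \<zero>\<^bsub>cohomology 1 S\<^esub> \<longleftrightarrow> f \<in> coboundaries 1 S"
  using Q.cl_eq_zero_iff[of f] assms unfolding cohomology_Q coh_class_cl by simp

lemma coh_class_eq_iff:
  fixes f g :: "'a sing_simplex \<Rightarrow> 'r"
  assumes "f \<in> cocycles 1 S" "g \<in> cocycles 1 S"
  shows "coh_class S f = coh_class S g \<longleftrightarrow> (\<lambda>\<sigma>. f \<sigma> - g \<sigma>) \<in> coboundaries 1 S"
proof -
  have "coh_class S f = coh_class S g \<longleftrightarrow> (\<exists>n\<in>coboundaries 1 S. f = (\<lambda>\<sigma>. n \<sigma> + g \<sigma>))"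
    using Q.cl_eq_iff[of f g] assms unfolding coh_class_cl by (simp add: cochain_module_def)
  also have "\<dots> \<longleftrightarrow> (\<lambda>\<sigma>. f \<sigma> - g \<sigma>) \<in> coboundaries 1 S"
    by (force intro: bexI[of _ "\<lambda>\<sigma>. f \<sigma> - g \<sigma>"])
  finally show ?thesis .
qed

end

lemma coh_class_self: "f \<in> coh_class S f"
  unfolding coh_class_def by (rule image_eqI[OF _ coboundaries_closed(1)]) simp

lemma coh_class_cocycle:
  assumes "f \<in> cocycles 1 S" "g \<in> coh_class S f"
  shows "g \<in> cocycles 1 S"
  using assms coboundaries_subset_cocycles[of S] cocycles_closed(2)[of _ S f]
  unfolding coh_class_def by (auto simp del: One_nat_def)

section \<open>The cup product in degree one\<close>

abbreviation cup_cochain :: "'a topology \<Rightarrow> ('a sing_simplex \<Rightarrow> 'r::comm_ring_1) \<Rightarrow>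
    ('a sing_simplex \<Rightarrow> 'r) \<Rightarrow> 'a sing_simplex \<Rightarrow> 'r" where
  "cup_cochain S f g \<equiv> cochain_cup 1 1 S f g"

lemma cup_cochain_faces:
  fixes S :: "'a topology"
  shows "cup_cochain S f g = (\<lambda>\<tau>. if singular_simplex 2 S \<tau>
     then f (singular_face 2 2 \<tau>) * g (singular_face 2 0 \<tau>) else 0)"
proof -
  have "front_face 1 \<tau> = singular_face 2 2 \<tau>" for \<tau> :: "'a sing_simplex"
    unfolding front_face_def singular_face_def
  proof (simp, rule restrict_ext)
    fix x :: "nat \<Rightarrow> real" assume "x \<in> standard_simplex (Suc 0)"
    then have "x i = 0" if "i > 1" for i using that by (simp add: standard_simplex_def)
    then have "x = simplical_face 2 x" by (auto simp: simplical_face_def fun_eq_iff)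
    then show "\<tau> x = (\<tau> \<circ> simplical_face 2) x" by simp
  qed
  moreover have "back_face 1 1 \<tau> = singular_face 2 0 \<tau>" for \<tau> :: "'a sing_simplex"
    unfolding back_face_def singular_face_def
    by (simp, rule restrict_ext) (auto simp: simplical_face_def less_Suc_eq cong: if_cong)
  ultimately show ?thesis
    unfolding cochain_cup_def by (intro ext) (simp add: one_add_one del: One_nat_def)
qed

lemma cocycle_face:
  "f \<in> cocycles 1 S \<Longrightarrow> singular_simplex 2 S \<tau> \<Longrightarrow>
     f (singular_face 2 1 \<tau>) = f (singular_face 2 0 \<tau>) + f (singular_face 2 2 \<tau>)"
proof -
  assume "f \<in> cocycles 1 S" "singular_simplex 2 S \<tau>"
  then have eq: "f (singular_face 2 0 \<tau>) - f (singular_face 2 1 \<tau>) + f (singular_face 2 2 \<tau>) = 0"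
    unfolding in_cocycles_1 by blast
  have "f (singular_face 2 1 \<tau>) = f (singular_face 2 0 \<tau>) + f (singular_face 2 2 \<tau>)
      - (f (singular_face 2 0 \<tau>) - f (singular_face 2 1 \<tau>) + f (singular_face 2 2 \<tau>))"
    by simp
  then show ?thesis unfolding eq by simp
qed

text \<open>With \<open>f = \<delta>h\<close>, the product is the coboundary of \<open>h \<smile> g\<close>. In degree one these Leibniz rules are
identities between the values on the three edges of a triangle.\<close>

lemma cup_coboundary_left:
  assumes "f \<in> coboundaries 1 S" "g \<in> cocycles 1 S"
  shows "cup_cochain S f g \<in> coboundaries 2 S"
proof -
  obtain h where f: "f = (\<lambda>\<sigma>. if singular_simplex 1 S \<sigma> then h (\<sigma> (vertex 1)) - h (\<sigma> (vertex 0)) else 0)"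
    using assms(1) in_coboundaries_1 by blast
  show ?thesis
    unfolding in_coboundaries_2 cup_cochain_faces f
    by (intro exI[of _ "\<lambda>\<sigma>. h (\<sigma> (vertex 0)) * g \<sigma>"] ext)
      (simp add: singular_face_2 vertex_face cocycle_face[OF assms(2)] algebra_simps del: One_nat_def)
qed

lemma cup_coboundary_right:
  assumes "f \<in> cocycles 1 S" "g \<in> coboundaries 1 S"
  shows "cup_cochain S f g \<in> coboundaries 2 S"
proof -
  obtain h where g: "g = (\<lambda>\<sigma>. if singular_simplex 1 S \<sigma> then h (\<sigma> (vertex 1)) - h (\<sigma> (vertex 0)) else 0)"
    using assms(2) in_coboundaries_1 by blast
  show ?thesis
    unfolding in_coboundaries_2 cup_cochain_faces g
    by (intro exI[of _ "\<lambda>\<sigma>. - (f \<sigma> * h (\<sigma> (vertex 1)))"] ext)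
      (simp add: singular_face_2 vertex_face cocycle_face[OF assms(1)] algebra_simps del: One_nat_def)
qed

text \<open>The sum is \<open>- \<delta>(f g)\<close> for the pointwise product \<open>f g\<close>, because \<open>f\<close> and \<open>g\<close> are additive along the edges of
a triangle.\<close>

lemma cup_anticommutes:
  assumes "f \<in> cocycles 1 S" "g \<in> cocycles 1 S"
  shows "(\<lambda>\<tau>. cup_cochain S f g \<tau> + cup_cochain S g f \<tau>) \<in> coboundaries 2 S"
  unfolding in_coboundaries_2 cup_cochain_faces
  by (intro exI[of _ "\<lambda>\<sigma>. - (f \<sigma> * g \<sigma>)"] ext)
    (simp add: cocycle_face[OF assms(1)] cocycle_face[OF assms(2)] algebra_simps del: One_nat_def)

text \<open>On a triangle, \<open>f\<close> takes the value \<open>a + b\<close> on the long edge and \<open>a\<close>, \<open>b\<close> on the others, and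
\<open>q (a + b) - q a - q b = a b\<close> is the value of \<open>f \<smile> f\<close>.\<close>

lemma cup_square:
  fixes f :: "'a sing_simplex \<Rightarrow> 'r::comm_ring_1" and q :: "'r \<Rightarrow> 'r"
  assumes "f \<in> cocycles 1 S" and q: "\<And>a b. q (a + b) = q a + q b + a * b"
  shows "cup_cochain S f f \<in> coboundaries 2 S"
  unfolding in_coboundaries_2 cup_cochain_faces
  by (intro exI[of _ "\<lambda>\<sigma>. - q (f \<sigma>)"] ext)
    (simp add: cocycle_face[OF assms(1)] q algebra_simps del: One_nat_def)

lemma cup_cochain_add_left:
  "cup_cochain S (\<lambda>\<sigma>. f \<sigma> + f' \<sigma>) g = (\<lambda>\<tau>. cup_cochain S f g \<tau> + cup_cochain S f' g \<tau>)"
  unfolding cup_cochain_faces by (auto simp: algebra_simps)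

lemma cup_cochain_add_right:
  "cup_cochain S f (\<lambda>\<sigma>. g \<sigma> + g' \<sigma>) = (\<lambda>\<tau>. cup_cochain S f g \<tau> + cup_cochain S f g' \<tau>)"
  unfolding cup_cochain_faces by (auto simp: algebra_simps)

lemma cup_cochain_smult_left:
  "cup_cochain S (\<lambda>\<sigma>. r * f \<sigma>) g = (\<lambda>\<tau>. r * cup_cochain S f g \<tau>)"
  unfolding cup_cochain_faces by (auto simp: algebra_simps)

text \<open>The cup product of two classes is a union of cosets over all representatives. If one product of
representatives is a coboundary, then so are all of them, and the union collapses to the zero class.\<close>

lemma cup_class_zero_iff:
  fixes f g :: "'a sing_simplex \<Rightarrow> 'r::comm_ring_1"
  assumes f: "f \<in> cocycles 1 S" and g: "g \<in> cocycles 1 S"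
  shows "cup 1 1 S (coh_class S f) (coh_class S g) = \<zero>\<^bsub>cohomology 2 S\<^esub> \<longleftrightarrow>
     cup_cochain S f g \<in> coboundaries 2 S"
proof -
  define co where "co F = (\<lambda>b \<tau>. b \<tau> + F \<tau>) ` (coboundaries 2 S :: ('a sing_simplex \<Rightarrow> 'r) set)" for F
  have co: "coboundaries 2 S +>\<^bsub>cochain_module 2 S\<^esub> F = co F" for F
    by (auto simp: co_def a_r_coset_def' cochain_simps)
  have zero: "\<zero>\<^bsub>cohomology 2 S\<^esub> = (coboundaries 2 S :: ('a sing_simplex \<Rightarrow> 'r) set)"
    by (simp add: cohomology_def quotient_module_def)
  have cup: "cup 1 1 S (coh_class S f) (coh_class S g)
      = (\<Union>f'\<in>coh_class S f. \<Union>g'\<in>coh_class S g. co (cup_cochain S f' g'))"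
    by (simp add: cup_def one_add_one co del: One_nat_def)
  have co_self: "F \<in> co F" for F
    unfolding co_def by (rule image_eqI[OF _ coboundaries_2_closed(1)]) simp
  have co_eq: "co F = coboundaries 2 S" if F: "F \<in> coboundaries 2 S" for F
  proof
    show "co F \<subseteq> coboundaries 2 S" using coboundaries_2_closed(2) F by (auto simp: co_def)
    show "coboundaries 2 S \<subseteq> co F"
    proof
      fix G :: "'a sing_simplex \<Rightarrow> 'r" assume "G \<in> coboundaries 2 S"
      then have "(\<lambda>\<tau>. G \<tau> + (- 1) * F \<tau>) \<in> coboundaries 2 S"
        using coboundaries_2_closed(2)[OF _ coboundaries_2_closed(3)[OF F]] by blast
      then show "G \<in> co F" unfolding co_def by (rule image_eqI[rotated]) simp
    qed
  qed
  show ?thesis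
  proof
    assume "cup 1 1 S (coh_class S f) (coh_class S g) = \<zero>\<^bsub>cohomology 2 S\<^esub>"
    then show "cup_cochain S f g \<in> coboundaries 2 S"
      unfolding zero cup using coh_class_self[of f S] coh_class_self[of g S] co_self by blast
  next
    assume fg: "cup_cochain S f g \<in> coboundaries 2 S"
    have "co (cup_cochain S f' g') = coboundaries 2 S"
      if f': "f' \<in> coh_class S f" and g': "g' \<in> coh_class S g" for f' g'
    proof (rule co_eq)
      obtain a where a: "a \<in> coboundaries 1 S" "f' = (\<lambda>\<sigma>. a \<sigma> + f \<sigma>)"
        using f' by (auto simp: coh_class_def)
      obtain b where b: "b \<in> coboundaries 1 S" "g' = (\<lambda>\<sigma>. b \<sigma> + g \<sigma>)"
        using g' by (auto simp: coh_class_def)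
      have "cup_cochain S f' g' = (\<lambda>\<tau>. cup_cochain S a g' \<tau> + (cup_cochain S f b \<tau> + cup_cochain S f g \<tau>))"
        by (simp only: a(2) b(2) cup_cochain_add_left cup_cochain_add_right)
      also have "\<dots> \<in> coboundaries 2 S"
      proof (intro coboundaries_2_closed(2) fg)
        show "cup_cochain S a g' \<in> coboundaries 2 S"
          by (rule cup_coboundary_left[OF a(1) coh_class_cocycle[OF g g']])
        show "cup_cochain S f b \<in> coboundaries 2 S"
          by (rule cup_coboundary_right[OF f b(1)])
      qed
      finally show "cup_cochain S f' g' \<in> coboundaries 2 S" .
    qed
    then have "cup 1 1 S (coh_class S f) (coh_class S g)
        = (\<Union>f'\<in>coh_class S f. \<Union>g'\<in>coh_class S g. coboundaries 2 S)"
      unfolding cup by (intro SUP_cong refl) blast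
    also have "\<dots> = coboundaries 2 S"
      using coh_class_self[of f S] coh_class_self[of g S] by blast
    finally show "cup 1 1 S (coh_class S f) (coh_class S g) = \<zero>\<^bsub>cohomology 2 S\<^esub>" by (simp add: zero)
  qed
qed

section \<open>Pullback\<close>

lemma face_simplex_map:
  assumes "k \<le> 2"
  shows "singular_face 2 k (simplex_map 2 \<phi> \<tau>) = simplex_map 1 \<phi> (singular_face 2 k \<tau>)"
  using singular_face_simplex_map[of 2 k \<phi> \<tau>] assms
  by (simp add: simplex_map_def singular_face_def fun_eq_iff)

lemma simplex_map_path: "simplex_map 1 \<phi> (path_simplex g) = path_simplex (\<phi> \<circ> g)"
  by (auto simp: simplex_map_def path_simplex_def)

lemma pullback_path:
  "pathin S g \<Longrightarrow> cochain_pullback 1 S \<phi> f (path_simplex g) = f (path_simplex (\<phi> \<circ> g))"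
  unfolding cochain_pullback_def using singular_path_simplex simplex_map_path by metis

lemma pullback_cocycle:
  assumes \<phi>: "continuous_map S T \<phi>" and f: "f \<in> cocycles 1 T"
  shows "cochain_pullback 1 S \<phi> f \<in> cocycles 1 S"
  unfolding in_cocycles_1
proof (intro conjI allI impI)
  fix \<tau> assume \<tau>: "singular_simplex 2 S \<tau>"
  then have "singular_simplex 2 T (simplex_map 2 \<phi> \<tau>)"
    using singular_simplex_simplex_map \<phi> by blast
  then show "cochain_pullback 1 S \<phi> f (singular_face 2 0 \<tau>) - cochain_pullback 1 S \<phi> f (singular_face 2 1 \<tau>)
      + cochain_pullback 1 S \<phi> f (singular_face 2 2 \<tau>) = 0"
    using f \<tau> unfolding in_cocycles_1 cochain_pullback_def
    by (simp add: singular_face_2 flip: face_simplex_map del: One_nat_def)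
qed (simp add: cochain_pullback_def)

lemma pullback_coboundary:
  assumes \<phi>: "continuous_map S T \<phi>" and f: "f \<in> coboundaries 1 T"
  shows "cochain_pullback 1 S \<phi> f \<in> coboundaries 1 S"
proof -
  obtain h where h: "f = (\<lambda>\<sigma>. if singular_simplex 1 T \<sigma> then h (\<sigma> (vertex 1)) - h (\<sigma> (vertex 0)) else 0)"
    using f in_coboundaries_1 by blast
  have v: "simplex_map 1 \<phi> \<sigma> (vertex 0) = \<phi> (\<sigma> (vertex 0))" "simplex_map 1 \<phi> \<sigma> (vertex 1) = \<phi> (\<sigma> (vertex 1))" for \<sigma>
    by (simp_all add: vertex_def simplex_map_def)
  show ?thesis
    unfolding in_coboundaries_1
    by (intro exI[of _ "\<lambda>x. h (\<phi> x)"] ext)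
      (auto simp: cochain_pullback_def h v singular_simplex_simplex_map[OF _ \<phi>] simp del: One_nat_def)
qed

lemma pullback_coboundary_2:
  assumes \<phi>: "continuous_map S T \<phi>" and F: "F \<in> coboundaries 2 T"
  shows "cochain_pullback 2 S \<phi> F \<in> coboundaries 2 S"
proof -
  obtain g where g: "F = (\<lambda>\<tau>. if singular_simplex 2 T \<tau>
     then g (singular_face 2 0 \<tau>) - g (singular_face 2 1 \<tau>) + g (singular_face 2 2 \<tau>) else 0)"
    using F in_coboundaries_2 by blast
  show ?thesis
    unfolding in_coboundaries_2
    by (intro exI[of _ "\<lambda>\<sigma>. g (simplex_map 1 \<phi> \<sigma>)"] ext)
      (simp add: cochain_pullback_def g singular_simplex_simplex_map[OF _ \<phi>] face_simplex_map del: One_nat_def)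
qed

lemma pullback_cup:
  assumes \<phi>: "continuous_map S T \<phi>"
  shows "cochain_pullback 2 S \<phi> (cup_cochain T f g)
    = cup_cochain S (cochain_pullback 1 S \<phi> f) (cochain_pullback 1 S \<phi> g)"
  by (rule ext) (simp add: cochain_pullback_def cup_cochain_faces singular_simplex_simplex_map[OF _ \<phi>]
      face_simplex_map singular_face_2 del: One_nat_def)

lemma pullback_class:
  assumes \<phi>: "continuous_map S T \<phi>" and f: "f \<in> cocycles 1 T"
  shows "pullback 1 S \<phi> (coh_class T f) = coh_class S (cochain_pullback 1 S \<phi> f)"
proof -
  have co: "coboundaries 1 S +>\<^bsub>cochain_module 1 S\<^esub> g = coh_class S g" for g :: "'a sing_simplex \<Rightarrow> 'c"
    by (auto simp: coh_class_def a_r_coset_def' cochain_simps)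
  have "coh_class S (cochain_pullback 1 S \<phi> f') = coh_class S (cochain_pullback 1 S \<phi> f)"
    if f': "f' \<in> coh_class T f" for f'
  proof -
    obtain b where b: "b \<in> coboundaries 1 T" "f' = (\<lambda>\<sigma>. b \<sigma> + f \<sigma>)"
      using f' by (auto simp: coh_class_def)
    have "(\<lambda>\<sigma>. cochain_pullback 1 S \<phi> f' \<sigma> - cochain_pullback 1 S \<phi> f \<sigma>) = cochain_pullback 1 S \<phi> b"
      by (auto simp: b(2) cochain_pullback_def)
    then show ?thesis
      unfolding coh_class_eq_iff[OF pullback_cocycle[OF \<phi> coh_class_cocycle[OF f f']] pullback_cocycle[OF \<phi> f]]
      using pullback_coboundary[OF \<phi> b(1)] by simp
  qed
  then show ?thesis
    unfolding pullback_def co using coh_class_self[of f T] by blast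
qed

section \<open>Evaluation on loops\<close>

definition is_loop :: "'a topology \<Rightarrow> 'a \<Rightarrow> 'a sing_simplex \<Rightarrow> bool" where
  "is_loop S x \<sigma> \<longleftrightarrow> singular_simplex 1 S \<sigma> \<and> \<sigma> (vertex 0) = x \<and> \<sigma> (vertex 1) = x"

lemma is_loop_iff: "is_loop S x \<sigma> \<longleftrightarrow> (\<exists>g. pathin S g \<and> g 0 = x \<and> g 1 = x \<and> \<sigma> = path_simplex g)"
  unfolding is_loop_def singular_simplex_1_iff by (auto simp: One_nat_def)

lemma coboundary_loop: "f \<in> coboundaries 1 S \<Longrightarrow> is_loop S x \<sigma> \<Longrightarrow> f \<sigma> = 0"
  unfolding in_coboundaries_1 is_loop_def by auto

text \<open>Join the base point to every point by a path \<open>p x\<close>, and every point back to the base point by \<open>r x\<close>. Closing up an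
arbitrary path with these gives a loop, so its value is the difference of \<open>h x = f (p x)\<close> at the
end points; the loop formed by \<open>p x\<close> and \<open>r x\<close> shows \<open>f (r x) = - h x\<close>.\<close>

lemma vanishing_on_loops:
  assumes S: "path_connected_space S" "x0 \<in> topspace S" and f: "f \<in> cocycles 1 S"
    and loops: "\<And>\<sigma>. is_loop S x0 \<sigma> \<Longrightarrow> f \<sigma> = 0"
  shows "f \<in> coboundaries 1 S"
proof -
  interpret triangle_additive S f "{0}" by (rule cocycle_triangle_additive[OF f])
  have "\<exists>g. pathin S g \<and> g 0 = x0 \<and> g 1 = x" if "x \<in> topspace S" for x
    using S that unfolding path_connected_space_def by blast
  then obtain p where p: "\<And>x. x \<in> topspace S \<Longrightarrow> pathin S (p x) \<and> p x 0 = x0 \<and> p x 1 = x"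
    by metis
  have "\<exists>g. pathin S g \<and> g 0 = x \<and> g 1 = x0" if "x \<in> topspace S" for x
    using S that unfolding path_connected_space_def by blast
  then obtain r where r: "\<And>x. x \<in> topspace S \<Longrightarrow> pathin S (r x) \<and> r x 0 = x \<and> r x 1 = x0"
    by metis
  define h where "h x = f (path_simplex (p x))" for x
  have loop: "f (path_simplex g) = 0" if "pathin S g" "g 0 = x0" "g 1 = x0" for g
    by (rule loops) (use that in \<open>auto simp: is_loop_iff\<close>)
  have path_ends: "path_join g k 0 = g 0" "path_join g k 1 = k 1" for g k :: "real \<Rightarrow> 'a"
    by (simp_all add: path_join_def)
  have join0: "f (path_simplex (path_join g k)) = f (path_simplex g) + f (path_simplex k)"
    if "pathin S g" "pathin S k" "g 1 = k 0" for g k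
    using join[OF that] by simp
  have r_eq: "f (path_simplex (r x)) = - h x" if x: "x \<in> topspace S" for x
  proof -
    have "f (path_simplex (path_join (p x) (r x))) = 0"
      using p[OF x] r[OF x] by (intro loop pathin_path_join) (simp_all add: path_ends)
    then show ?thesis using join0[of "p x" "r x"] p[OF x] r[OF x]
      by (simp add: h_def add_eq_0_iff)
  qed
  have "f \<sigma> = h (\<sigma> (vertex 1)) - h (\<sigma> (vertex 0))" if \<sigma>: "singular_simplex 1 S \<sigma>" for \<sigma>
  proof -
    obtain g where g: "pathin S g" "\<sigma> = path_simplex g" using \<sigma> singular_simplex_1_iff by blast
    have ends: "g 0 \<in> topspace S" "g 1 \<in> topspace S"
      using path_start_in_topspace[OF g(1)] path_finish_in_topspace[OF g(1)] .
    note pg = p[OF ends(1)] and rg = r[OF ends(2)]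
    have 1: "pathin S (path_join (p (g 0)) g)" using pg g(1) by (intro pathin_path_join) auto
    have 2: "pathin S (path_join (path_join (p (g 0)) g) (r (g 1)))"
      by (rule pathin_path_join) (use 1 rg in \<open>auto simp: path_ends\<close>)
    have "f (path_simplex (path_join (path_join (p (g 0)) g) (r (g 1)))) = 0"
      using 2 pg rg by (intro loop) (simp_all add: path_ends)
    then have "f (path_simplex (p (g 0))) + f (path_simplex g) + f (path_simplex (r (g 1))) = 0"
      using join0[OF 1, of "r (g 1)"] join0[of "p (g 0)" g] pg rg g(1) by (simp add: path_ends)
    then have "h (g 0) + f (path_simplex g) - h (g 1) = 0"
      using r_eq[OF ends(2)] by (simp add: h_def)
    then show ?thesis unfolding g(2) by (simp add: algebra_simps add_eq_0_iff)
  qed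
  then have "f = (\<lambda>\<sigma>. if singular_simplex 1 S \<sigma> then h (\<sigma> (vertex 1)) - h (\<sigma> (vertex 0)) else 0)"
    using f unfolding in_cocycles_1 by auto
  then show ?thesis unfolding in_coboundaries_1 by blast
qed

text \<open>Any representative may be used, as coboundaries vanish on loops.\<close>

definition loop_ev :: "'a topology \<Rightarrow> 'a \<Rightarrow> ('a sing_simplex \<Rightarrow> 'r::comm_ring_1) set \<Rightarrow> 'a sing_simplex \<Rightarrow> 'r" where
  "loop_ev S x c \<sigma> = (if is_loop S x \<sigma> then (SOME f. f \<in> c) \<sigma> else 0)"

lemma loop_ev_class: "loop_ev S x (coh_class S f) \<sigma> = (if is_loop S x \<sigma> then f \<sigma> else 0)"
proof -
  have "(SOME g. g \<in> coh_class S f) \<in> coh_class S f"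
    by (rule someI[of "\<lambda>g. g \<in> coh_class S f", OF coh_class_self])
  then obtain b where "b \<in> coboundaries 1 S" "(SOME g. g \<in> coh_class S f) = (\<lambda>\<sigma>. b \<sigma> + f \<sigma>)"
    by (auto simp: coh_class_def)
  then show ?thesis using coboundary_loop[of b S x \<sigma>] by (auto simp: loop_ev_def)
qed

lemma evaluated_cohomology:
  fixes S :: "'a topology"
  assumes R: "coefficient_ring TYPE('r::comm_ring_1)"
    and S: "path_connected_space S" "x0 \<in> topspace S"
  shows "evaluated_module (cohomology 1 S :: ('r, ('a sing_simplex \<Rightarrow> 'r) set) module) (loop_ev S x0)"
proof -
  interpret coefficient_ring "TYPE('r)" by (rule R)
  show ?thesis
  proof (intro evaluated_module.intro evaluated_module_axioms.intro R)
    show "module (ring_of_type_algebra :: 'r ring) (cohomology 1 S :: ('r, ('a sing_simplex \<Rightarrow> 'r) set) module)"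
      by (rule module_cohomology)
  next
    fix x y :: "('a sing_simplex \<Rightarrow> 'r) set"
    assume x: "x \<in> carrier (cohomology 1 S)" and y: "y \<in> carrier (cohomology 1 S)"
    obtain f where f: "f \<in> cocycles 1 S" "x = coh_class S f" using x carrier_cohomology by blast
    obtain g where g: "g \<in> cocycles 1 S" "y = coh_class S g" using y carrier_cohomology by blast
    show "loop_ev S x0 (x \<oplus>\<^bsub>cohomology 1 S\<^esub> y) l = loop_ev S x0 x l + loop_ev S x0 y l" for l
      using f g by (simp add: coh_class_add loop_ev_class del: One_nat_def)
    assume eq: "loop_ev S x0 x = loop_ev S x0 y"
    have "(\<lambda>\<sigma>. f \<sigma> + (- 1) * g \<sigma>) \<in> cocycles 1 S"
      using cocycles_closed(2)[OF f(1) cocycles_closed(3)[OF g(1)]] .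
    then have cocycle: "(\<lambda>\<sigma>. f \<sigma> - g \<sigma>) \<in> cocycles 1 S" by simp
    have "(\<lambda>\<sigma>. f \<sigma> - g \<sigma>) \<in> coboundaries 1 S"
    proof (rule vanishing_on_loops[OF S cocycle])
      fix \<sigma> assume "is_loop S x0 \<sigma>"
      then show "f \<sigma> - g \<sigma> = 0"
        using fun_cong[OF eq, of \<sigma>] unfolding f(2) g(2) loop_ev_class by simp
    qed
    then show "x = y" using coh_class_eq_iff[OF f(1) g(1)] f g by blast
  next
    fix x :: "('a sing_simplex \<Rightarrow> 'r) set" and r l
    assume x: "x \<in> carrier (cohomology 1 S)"
    obtain f where f: "f \<in> cocycles 1 S" "x = coh_class S f" using x carrier_cohomology by blast
    show "loop_ev S x0 (r \<odot>\<^bsub>cohomology 1 S\<^esub> x) l = r * loop_ev S x0 x l"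
      using f by (simp add: coh_class_smult loop_ev_class del: One_nat_def)
  qed
qed

definition cup_vanishes :: "'a topology \<Rightarrow> ('a sing_simplex \<Rightarrow> 'r::comm_ring_1) set \<Rightarrow>
    ('a sing_simplex \<Rightarrow> 'r) set \<Rightarrow> bool" where
  "cup_vanishes S x y \<longleftrightarrow> cup 1 1 S x y = \<zero>\<^bsub>cohomology 2 S\<^esub>"

lemma cup_form_cohomology:
  fixes S :: "'a topology"
  assumes R: "coefficient_ring TYPE('r::comm_ring_1)"
    and S: "path_connected_space S" "x0 \<in> topspace S"
    and fin: "module_rank (cohomology 1 S :: ('r, ('a sing_simplex \<Rightarrow> 'r) set) module)
      (carrier (cohomology 1 S)) \<noteq> \<infinity>"
  shows "cup_form (cohomology 1 S :: ('r, ('a sing_simplex \<Rightarrow> 'r) set) module) (loop_ev S x0) (cup_vanishes S)"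
proof -
  interpret E: evaluated_module "TYPE('r)" "cohomology 1 S :: ('r, ('a sing_simplex \<Rightarrow> 'r) set) module" "loop_ev S x0"
    by (rule evaluated_cohomology[OF R S])
  have iff: "cup_vanishes S (coh_class S f) (coh_class S g) \<longleftrightarrow> cup_cochain S f g \<in> coboundaries 2 S"
    if "f \<in> cocycles 1 S" "g \<in> cocycles 1 S" for f g :: "'a sing_simplex \<Rightarrow> 'r"
    using cup_class_zero_iff[OF that] by (simp add: cup_vanishes_def)
  have sym: "cup_vanishes S y x" if xy: "x \<in> carrier (cohomology 1 S)" "y \<in> carrier (cohomology 1 S)"
      "cup_vanishes S x y" for x y :: "('a sing_simplex \<Rightarrow> 'r) set"
  proof -
    obtain f where f: "f \<in> cocycles 1 S" "x = coh_class S f" using xy carrier_cohomology by blast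
    obtain g where g: "g \<in> cocycles 1 S" "y = coh_class S g" using xy carrier_cohomology by blast
    have fg: "cup_cochain S f g \<in> coboundaries 2 S" using xy(3) f g iff by blast
    have "(\<lambda>\<tau>. (cup_cochain S f g \<tau> + cup_cochain S g f \<tau>) + (- 1) * cup_cochain S f g \<tau>) \<in> coboundaries 2 S"
      using coboundaries_2_closed(2)[OF cup_anticommutes[OF f(1) g(1)] coboundaries_2_closed(3)[OF fg]] .
    then have "cup_cochain S g f \<in> coboundaries 2 S" by simp
    then show ?thesis using f g iff by blast
  qed
  show ?thesis
  proof (intro cup_form.intro cup_form_axioms.intro E.evaluated_module_axioms)
    show "module_rank (cohomology 1 S :: ('r, ('a sing_simplex \<Rightarrow> 'r) set) module) (carrier (cohomology 1 S)) \<noteq> \<infinity>"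
      by (rule fin)
  next
    fix x y :: "('a sing_simplex \<Rightarrow> 'r) set"
    assume xy: "x \<in> carrier (cohomology 1 S)" "y \<in> carrier (cohomology 1 S)" "cup_vanishes S x y"
    then show "cup_vanishes S y x" by (rule sym)
    obtain f where f: "f \<in> cocycles 1 S" "x = coh_class S f" using xy carrier_cohomology by blast
    obtain g where g: "g \<in> cocycles 1 S" "y = coh_class S g" using xy carrier_cohomology by blast
    have fg: "cup_cochain S f g \<in> coboundaries 2 S" using xy(3) f g iff by blast
    show "cup_vanishes S (r \<odot>\<^bsub>cohomology 1 S\<^esub> x) y" for r
      unfolding f(2) g(2) coh_class_smult[OF f(1)] iff[OF cocycles_closed(3)[OF f(1)] g(1)]
        cup_cochain_smult_left by (rule coboundaries_2_closed(3)[OF fg])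
    fix x' :: "('a sing_simplex \<Rightarrow> 'r) set"
    assume x': "x' \<in> carrier (cohomology 1 S)" "cup_vanishes S x' y"
    obtain f' where f': "f' \<in> cocycles 1 S" "x' = coh_class S f'" using x' carrier_cohomology by blast
    have "cup_cochain S f' g \<in> coboundaries 2 S" using x'(2) f' g iff by blast
    then show "cup_vanishes S (x \<oplus>\<^bsub>cohomology 1 S\<^esub> x') y"
      unfolding f(2) g(2) f'(2) coh_class_add[OF f(1) f'(1)]
        iff[OF cocycles_closed(2)[OF f(1) f'(1)] g(1)] cup_cochain_add_left
      by (rule coboundaries_2_closed(2)[OF fg])
  next
    fix x :: "('a sing_simplex \<Rightarrow> 'r) set"
    assume x: "x \<in> carrier (cohomology 1 S)"
    obtain f where f: "f \<in> cocycles 1 S" "x = coh_class S f" using x carrier_cohomology by blast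
    have "\<zero>\<^bsub>cohomology 1 S\<^esub> = coh_class S (\<lambda>\<sigma>. 0 :: 'r)"
      using coh_class_zero_iff[OF cocycles_closed(1)] coboundaries_closed(1) by metis
    moreover have "cup_cochain S (\<lambda>\<sigma>. 0) f = (\<lambda>\<tau>. 0)" unfolding cup_cochain_faces by auto
    ultimately show "cup_vanishes S \<zero>\<^bsub>cohomology 1 S\<^esub> x"
      using iff[OF cocycles_closed(1) f(1)] f(2) coboundaries_2_closed(1)[of S] by simp
    assume "CHAR('r) \<noteq> 2"
    then obtain q :: "'r \<Rightarrow> 'r" where "\<And>a b. q (a + b) = q a + q b + a * b"
      using E.half_square by blast
    then show "cup_vanishes S x x"
      using cup_square[OF f(1)] iff[OF f(1) f(1)] f(2) by blast
  qed
qed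

section \<open>The product of two spaces\<close>

lemma (in triangle_additive) diagonal:
  assumes "continuous_map (top_of_set ({0..1} \<times> {0..1})) S f"
  shows "u (path_simplex (\<lambda>t. f (t, 0))) + u (path_simplex (\<lambda>t. f (1, t)))
      - u (path_simplex (\<lambda>t. f (t, t))) \<in> L"
proof -
  have conv: "convex ({0..1::real} \<times> {0..1::real})" by (intro convex_Times) auto
  have 1: "f \<circ> linepath (0, 0) (1, 0) = (\<lambda>t. f (t, 0))" "f \<circ> linepath (1, 0) (1, 1) = (\<lambda>t. f (1, t))"
    "f \<circ> linepath (0, 0) (1, 1) = (\<lambda>t. f (t, t))"
    by (auto simp: fun_eq_iff linepath_def)
  show ?thesis
    using triangle[OF assms conv, of "(0, 0)" "(1, 0)" "(1, 1)"] unfolding 1 by simp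
qed

lemma continuous_product_of_paths:
  assumes "pathin S g" "pathin T h"
  shows "continuous_map (top_of_set ({0..1} \<times> {0..1})) (prod_topology S T) (\<lambda>z. (g (fst z), h (snd z)))"
proof -
  have eq: "top_of_set ({0..1} \<times> {0..1}) = prod_topology (top_of_set {0..1::real}) (top_of_set {0..1::real})"
    by (simp add: subtopology_Times)
  show ?thesis
    unfolding eq using assms unfolding pathin_def
    by (intro continuous_map_pairedI continuous_map_compose[OF continuous_map_fst, unfolded o_def]
        continuous_map_compose[OF continuous_map_snd, unfolded o_def])
qed

lemma cocycles_diff:
  "f \<in> cocycles 1 S \<Longrightarrow> g \<in> cocycles 1 S \<Longrightarrow> (\<lambda>\<sigma>. f \<sigma> - g \<sigma>) \<in> cocycles 1 S"
  using cocycles_closed(2)[OF _ cocycles_closed(3)[of g S "- 1"], of f] by simp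

locale pointed_product =
  fixes S :: "'a topology" and T :: "'b topology" and x0 :: 'a and y0 :: 'b and R :: "'r::comm_ring_1 itself"
  assumes S: "path_connected_space S" "x0 \<in> topspace S" and T: "path_connected_space T" "y0 \<in> topspace T"
begin

abbreviation P where "P \<equiv> prod_topology S T"

abbreviation pr1 :: "('a sing_simplex \<Rightarrow> 'r) \<Rightarrow> ('a \<times> 'b) sing_simplex \<Rightarrow> 'r" where
  "pr1 \<equiv> cochain_pullback 1 P fst"
abbreviation pr2 :: "('b sing_simplex \<Rightarrow> 'r) \<Rightarrow> ('a \<times> 'b) sing_simplex \<Rightarrow> 'r" where
  "pr2 \<equiv> cochain_pullback 1 P snd"
abbreviation in1 :: "(('a \<times> 'b) sing_simplex \<Rightarrow> 'r) \<Rightarrow> 'a sing_simplex \<Rightarrow> 'r" where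
  "in1 \<equiv> cochain_pullback 1 S (\<lambda>x. (x, y0))"
abbreviation in2 :: "(('a \<times> 'b) sing_simplex \<Rightarrow> 'r) \<Rightarrow> 'b sing_simplex \<Rightarrow> 'r" where
  "in2 \<equiv> cochain_pullback 1 T (\<lambda>y. (x0, y))"

lemma cont_in: "continuous_map S P (\<lambda>x. (x, y0))" "continuous_map T P (\<lambda>y. (x0, y))"
  using S T by (auto intro!: continuous_map_pairedI)

lemma P_path_connected: "path_connected_space P" "(x0, y0) \<in> topspace P"
  using S T by (auto simp: path_connected_space_prod_topology)

lemma cocycle_constant:
  assumes "f \<in> cocycles 1 V" "x \<in> topspace V"
  shows "f (path_simplex (\<lambda>_. x)) = 0"
  using triangle_additive.constant_path[OF cocycle_triangle_additive[OF assms(1)] assms(2)] by simp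

lemma sum_cocycle:
  assumes "a \<in> cocycles 1 S" "b \<in> cocycles 1 T"
  shows "(\<lambda>\<sigma>. pr1 a \<sigma> + pr2 b \<sigma>) \<in> cocycles 1 P"
  using assms by (intro cocycles_closed(2) pullback_cocycle[OF continuous_map_fst]
      pullback_cocycle[OF continuous_map_snd])

lemma sum_on_path:
  assumes "pathin S g" "pathin T h"
  shows "pr1 a (path_simplex (\<lambda>t. (g t, h t))) + pr2 b (path_simplex (\<lambda>t. (g t, h t)))
    = a (path_simplex g) + b (path_simplex h)"
proof -
  have "pathin P (\<lambda>t. (g t, h t))" using assms by (auto simp: pathin_def intro: continuous_map_pairedI)
  then show ?thesis by (simp add: pullback_path o_def del: One_nat_def)
qed

lemma restrict_sum:
  assumes a: "a \<in> cocycles 1 S" and b: "b \<in> cocycles 1 T"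
  shows "in1 (\<lambda>\<sigma>. pr1 a \<sigma> + pr2 b \<sigma>) = a" "in2 (\<lambda>\<sigma>. pr1 a \<sigma> + pr2 b \<sigma>) = b"
proof -
  show "in1 (\<lambda>\<sigma>. pr1 a \<sigma> + pr2 b \<sigma>) = a"
  proof
    fix \<sigma>
    show "in1 (\<lambda>\<sigma>. pr1 a \<sigma> + pr2 b \<sigma>) \<sigma> = a \<sigma>"
    proof (cases "singular_simplex 1 S \<sigma>")
      case True
      then obtain g where g: "pathin S g" "\<sigma> = path_simplex g" using singular_simplex_1_iff by blast
      have "pathin T (\<lambda>_. y0)" using T by simp
      from sum_on_path[OF g(1) this] show ?thesis
        by (simp add: pullback_path[OF g(1)] cocycle_constant[OF b T(2)] g(2) o_def del: One_nat_def)
    next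
      case False
      then show ?thesis using a by (simp add: cochain_pullback_def in_cocycles_1 del: One_nat_def)
    qed
  qed
  show "in2 (\<lambda>\<sigma>. pr1 a \<sigma> + pr2 b \<sigma>) = b"
  proof
    fix \<sigma>
    show "in2 (\<lambda>\<sigma>. pr1 a \<sigma> + pr2 b \<sigma>) \<sigma> = b \<sigma>"
    proof (cases "singular_simplex 1 T \<sigma>")
      case True
      then obtain g where g: "pathin T g" "\<sigma> = path_simplex g" using singular_simplex_1_iff by blast
      have "pathin S (\<lambda>_. x0)" using S by simp
      from sum_on_path[OF this g(1)] show ?thesis
        by (simp add: pullback_path[OF g(1)] cocycle_constant[OF a S(2)] g(2) o_def del: One_nat_def)
    next
      case False
      then show ?thesis using b by (simp add: cochain_pullback_def in_cocycles_1 del: One_nat_def)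
    qed
  qed
qed

text \<open>It suffices to compare values on a loop \<open>t \<mapsto> (g t, h t)\<close> at the base point. In the square
\<open>(s, t) \<mapsto> (g s, h t)\<close> it is the diagonal, which is homologous to the bottom followed by the right side;
these are the loops \<open>g\<close> and \<open>h\<close> in the two axes.\<close>

lemma kunneth:
  assumes f: "f \<in> cocycles 1 P"
  shows "(\<lambda>\<sigma>. f \<sigma> - (pr1 (in1 f) \<sigma> + pr2 (in2 f) \<sigma>)) \<in> coboundaries 1 P"
proof (rule vanishing_on_loops[OF P_path_connected])
  have a: "in1 f \<in> cocycles 1 S" "in2 f \<in> cocycles 1 T"
    using pullback_cocycle cont_in f by blast+
  show "(\<lambda>\<sigma>. f \<sigma> - (pr1 (in1 f) \<sigma> + pr2 (in2 f) \<sigma>)) \<in> cocycles 1 P"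
    by (rule cocycles_diff[OF f sum_cocycle[OF a]])
  fix \<sigma> assume "is_loop P (x0, y0) \<sigma>"
  then obtain k where k: "pathin P k" "k 0 = (x0, y0)" "k 1 = (x0, y0)" "\<sigma> = path_simplex k"
    unfolding is_loop_iff by blast
  define g h where "g = fst \<circ> k" and "h = snd \<circ> k"
  have kgh: "k = (\<lambda>t. (g t, h t))" by (simp add: g_def h_def)
  have g: "pathin S g" "g 0 = x0" "g 1 = x0" and h: "pathin T h" "h 0 = y0" "h 1 = y0"
    using k(2,3) pathin_compose[OF k(1) continuous_map_fst] pathin_compose[OF k(1) continuous_map_snd]
    by (simp_all add: g_def h_def)
  interpret triangle_additive P f "{0}" by (rule cocycle_triangle_additive[OF f])
  have "f (path_simplex (\<lambda>t. (g t, y0))) + f (path_simplex (\<lambda>t. (x0, h t))) = f \<sigma>"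
    using diagonal[OF continuous_product_of_paths[OF g(1) h(1)]] g h by (simp add: k(4) kgh)
  moreover have "f (path_simplex (\<lambda>t. (g t, y0))) = in1 f (path_simplex g)"
      "f (path_simplex (\<lambda>t. (x0, h t))) = in2 f (path_simplex h)"
    by (simp_all add: pullback_path[OF g(1)] pullback_path[OF h(1)] o_def del: One_nat_def)
  moreover have "pr1 (in1 f) \<sigma> + pr2 (in2 f) \<sigma> = in1 f (path_simplex g) + in2 f (path_simplex h)"
    unfolding k(4) kgh by (rule sum_on_path[OF g(1) h(1)])
  ultimately show "f \<sigma> - (pr1 (in1 f) \<sigma> + pr2 (in2 f) \<sigma>) = 0" by simp
qed

text \<open>The square spanned by the two loops is cut along its diagonal. Opposite sides are equal, so the
values of a coboundary on the two triangles coincide, whereas the cup product takes the values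
\<open>a(\<alpha>) b'(\<beta>)\<close> and \<open>b(\<beta>) a'(\<alpha>)\<close> on them.\<close>

lemma torus:
  assumes a: "a \<in> cocycles 1 S" "a' \<in> cocycles 1 S" and b: "b \<in> cocycles 1 T" "b' \<in> cocycles 1 T"
    and cup: "cup_cochain P (\<lambda>\<sigma>. pr1 a \<sigma> + pr2 b \<sigma>) (\<lambda>\<sigma>. pr1 a' \<sigma> + pr2 b' \<sigma>) \<in> coboundaries 2 P"
    and loops: "is_loop S x0 \<alpha>" "is_loop T y0 \<beta>"
  shows "a \<alpha> * b' \<beta> = a' \<alpha> * b \<beta>"
proof -
  define F where "F = (\<lambda>\<sigma>. pr1 a \<sigma> + pr2 b \<sigma>)"
  define F' where "F' = (\<lambda>\<sigma>. pr1 a' \<sigma> + pr2 b' \<sigma>)"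
  obtain g where g: "pathin S g" "g 0 = x0" "g 1 = x0" "\<alpha> = path_simplex g"
    using loops(1) unfolding is_loop_iff by blast
  obtain h where h: "pathin T h" "h 0 = y0" "h 1 = y0" "\<beta> = path_simplex h"
    using loops(2) unfolding is_loop_iff by blast
  obtain k where k: "cup_cochain P F F' = (\<lambda>\<tau>. if singular_simplex 2 P \<tau>
      then k (singular_face 2 0 \<tau>) - k (singular_face 2 1 \<tau>) + k (singular_face 2 2 \<tau>) else 0)"
    using cup unfolding F_def[symmetric] F'_def[symmetric] in_coboundaries_2 by blast
  have k': "F (singular_face 2 2 \<tau>) * F' (singular_face 2 0 \<tau>)
      = k (singular_face 2 0 \<tau>) - k (singular_face 2 1 \<tau>) + k (singular_face 2 2 \<tau>)"
    if "singular_simplex 2 P \<tau>" for \<tau>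
    using fun_cong[OF k, of \<tau>] that unfolding cup_cochain_faces by simp
  define H where "H = (\<lambda>z::real \<times> real. (g (fst z), h (snd z)))"
  have H: "continuous_map (top_of_set ({0..1} \<times> {0..1})) P H"
    unfolding H_def by (rule continuous_product_of_paths[OF g(1) h(1)])
  have conv: "convex ({0..1::real} \<times> {0..1::real})" by (intro convex_Times) auto
  have s1: "singular_simplex 2 P (triangle_simplex H (0, 0) (1, 0) (1, 1))"
    and s2: "singular_simplex 2 P (triangle_simplex H (0, 0) (0, 1) (1, 1))"
    by (rule singular_triangle_simplex[OF H conv]; simp)+
  have edges: "H \<circ> linepath (0, 0) (1, 0) = (\<lambda>t. (g t, y0))" "H \<circ> linepath (1, 0) (1, 1) = (\<lambda>t. (x0, h t))"
    "H \<circ> linepath (0, 0) (0, 1) = (\<lambda>t. (x0, h t))" "H \<circ> linepath (0, 1) (1, 1) = (\<lambda>t. (g t, y0))"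
    using g h by (auto simp: fun_eq_iff linepath_def H_def)
  have const: "pathin S (\<lambda>_. x0)" "pathin T (\<lambda>_. y0)" using S T by simp_all
  have vals: "F (path_simplex (\<lambda>t. (g t, y0))) = a \<alpha>" "F (path_simplex (\<lambda>t. (x0, h t))) = b \<beta>"
    "F' (path_simplex (\<lambda>t. (g t, y0))) = a' \<alpha>" "F' (path_simplex (\<lambda>t. (x0, h t))) = b' \<beta>"
    unfolding F_def F'_def g(4) h(4)
    using sum_on_path[OF g(1) const(2)] sum_on_path[OF const(1) h(1)] a b
    by (simp_all add: cocycle_constant S T del: One_nat_def)
  have "a \<alpha> * b' \<beta> = b \<beta> * a' \<alpha>"
    using k'[OF s1] k'[OF s2] unfolding triangle_simplex_faces edges vals by simp
  then show ?thesis by (simp add: mult.commute)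
qed

lemma cup_restrict:
  assumes a: "a \<in> cocycles 1 S" "a' \<in> cocycles 1 S" and b: "b \<in> cocycles 1 T" "b' \<in> cocycles 1 T"
    and cup: "cup_cochain P (\<lambda>\<sigma>. pr1 a \<sigma> + pr2 b \<sigma>) (\<lambda>\<sigma>. pr1 a' \<sigma> + pr2 b' \<sigma>) \<in> coboundaries 2 P"
  shows "cup_cochain S a a' \<in> coboundaries 2 S" "cup_cochain T b b' \<in> coboundaries 2 T"
  using pullback_coboundary_2[OF cont_in(1) cup] pullback_coboundary_2[OF cont_in(2) cup]
  unfolding pullback_cup[OF cont_in(1)] pullback_cup[OF cont_in(2)]
    restrict_sum[OF a(1) b(1)] restrict_sum[OF a(2) b(2)] .

text \<open>The mixed terms \<open>a \<smile> b + b \<smile> a\<close> cancel up to a coboundary by anticommutativity, in every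
characteristic.\<close>

lemma cup_square_sum:
  assumes a: "a \<in> cocycles 1 S" "cup_cochain S a a \<in> coboundaries 2 S"
    and b: "b \<in> cocycles 1 T" "cup_cochain T b b \<in> coboundaries 2 T"
  shows "cup_cochain P (\<lambda>\<sigma>. pr1 a \<sigma> + pr2 b \<sigma>) (\<lambda>\<sigma>. pr1 a \<sigma> + pr2 b \<sigma>) \<in> coboundaries 2 P"
proof -
  have sq: "cup_cochain P (pr1 a) (pr1 a) \<in> coboundaries 2 P" "cup_cochain P (pr2 b) (pr2 b) \<in> coboundaries 2 P"
    using pullback_coboundary_2[OF continuous_map_fst a(2)] pullback_coboundary_2[OF continuous_map_snd b(2)]
    unfolding pullback_cup[OF continuous_map_fst] pullback_cup[OF continuous_map_snd] by blast+
  have mixed: "(\<lambda>\<tau>. cup_cochain P (pr1 a) (pr2 b) \<tau> + cup_cochain P (pr2 b) (pr1 a) \<tau>) \<in> coboundaries 2 P"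
    by (intro cup_anticommutes pullback_cocycle[OF continuous_map_fst a(1)] pullback_cocycle[OF continuous_map_snd b(1)])
  have "(\<lambda>\<tau>. (cup_cochain P (pr1 a) (pr1 a) \<tau> + cup_cochain P (pr2 b) (pr2 b) \<tau>)
      + (cup_cochain P (pr1 a) (pr2 b) \<tau> + cup_cochain P (pr2 b) (pr1 a) \<tau>)) \<in> coboundaries 2 P"
    by (rule coboundaries_2_closed(2)[OF coboundaries_2_closed(2)[OF sq] mixed])
  also have "(\<lambda>\<tau>. (cup_cochain P (pr1 a) (pr1 a) \<tau> + cup_cochain P (pr2 b) (pr2 b) \<tau>)
      + (cup_cochain P (pr1 a) (pr2 b) \<tau> + cup_cochain P (pr2 b) (pr1 a) \<tau>))
      = cup_cochain P (\<lambda>\<sigma>. pr1 a \<sigma> + pr2 b \<sigma>) (\<lambda>\<sigma>. pr1 a \<sigma> + pr2 b \<sigma>)"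
    unfolding cup_cochain_add_left cup_cochain_add_right by (simp add: algebra_simps)
  finally show ?thesis .
qed

definition p1 :: "('a sing_simplex \<Rightarrow> 'r) set \<Rightarrow> (('a \<times> 'b) sing_simplex \<Rightarrow> 'r) set" where
  "p1 = pullback 1 P fst"
definition p2 :: "('b sing_simplex \<Rightarrow> 'r) set \<Rightarrow> (('a \<times> 'b) sing_simplex \<Rightarrow> 'r) set" where
  "p2 = pullback 1 P snd"

lemma p1_class: "a \<in> cocycles 1 S \<Longrightarrow> p1 (coh_class S a) = coh_class P (pr1 a)"
  unfolding p1_def by (rule pullback_class[OF continuous_map_fst])
lemma p2_class: "b \<in> cocycles 1 T \<Longrightarrow> p2 (coh_class T b) = coh_class P (pr2 b)"
  unfolding p2_def by (rule pullback_class[OF continuous_map_snd])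

lemma pr_cocycle: "a \<in> cocycles 1 S \<Longrightarrow> pr1 a \<in> cocycles 1 P" "b \<in> cocycles 1 T \<Longrightarrow> pr2 b \<in> cocycles 1 P"
  using pullback_cocycle[OF continuous_map_fst] pullback_cocycle[OF continuous_map_snd] by blast+

lemma p_sum_class:
  assumes "a \<in> cocycles 1 S" "b \<in> cocycles 1 T"
  shows "p1 (coh_class S a) \<oplus>\<^bsub>cohomology 1 P\<^esub> p2 (coh_class T b) = coh_class P (\<lambda>\<sigma>. pr1 a \<sigma> + pr2 b \<sigma>)"
  using assms by (simp add: p1_class p2_class coh_class_add pr_cocycle del: One_nat_def)

lemma product_form_cohomology:
  assumes R: "coefficient_ring TYPE('r)"
    and fS: "module_rank (cohomology 1 S :: ('r, ('a sing_simplex \<Rightarrow> 'r) set) module) (carrier (cohomology 1 S)) \<noteq> \<infinity>"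
    and fT: "module_rank (cohomology 1 T :: ('r, ('b sing_simplex \<Rightarrow> 'r) set) module) (carrier (cohomology 1 T)) \<noteq> \<infinity>"
    and fP: "module_rank (cohomology 1 P :: ('r, (('a \<times> 'b) sing_simplex \<Rightarrow> 'r) set) module) (carrier (cohomology 1 P)) \<noteq> \<infinity>"
  shows "product_form
     (cohomology 1 S :: ('r, ('a sing_simplex \<Rightarrow> 'r) set) module) (loop_ev S x0) (cup_vanishes S)
     (cohomology 1 T :: ('r, ('b sing_simplex \<Rightarrow> 'r) set) module) (loop_ev T y0) (cup_vanishes T)
     (cohomology 1 P :: ('r, (('a \<times> 'b) sing_simplex \<Rightarrow> 'r) set) module) (loop_ev P (x0, y0)) (cup_vanishes P) p1 p2"
proof (intro product_form.intro product_form_axioms.intro cup_form_cohomology R fS fT fP S T P_path_connected)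
  have c1: "\<exists>f. f \<in> cocycles 1 S \<and> x = coh_class S f" if "x \<in> carrier (cohomology 1 S)" for x :: "('a sing_simplex \<Rightarrow> 'r) set"
    using that carrier_cohomology by blast
  have c2: "\<exists>f. f \<in> cocycles 1 T \<and> x = coh_class T f" if "x \<in> carrier (cohomology 1 T)" for x :: "('b sing_simplex \<Rightarrow> 'r) set"
    using that carrier_cohomology by blast
  have cP: "\<exists>f. f \<in> cocycles 1 P \<and> x = coh_class P f" if "x \<in> carrier (cohomology 1 P)" for x :: "(('a \<times> 'b) sing_simplex \<Rightarrow> 'r) set"
    using that carrier_cohomology by blast
  have iff: "cup_vanishes V (coh_class V f) (coh_class V g) \<longleftrightarrow> cup_cochain V f g \<in> coboundaries 2 V"
    if "f \<in> cocycles 1 V" "g \<in> cocycles 1 V" for V :: "'v topology" and f g :: "'v sing_simplex \<Rightarrow> 'r"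
    using cup_class_zero_iff[OF that] by (simp add: cup_vanishes_def)
  fix x x' :: "('a sing_simplex \<Rightarrow> 'r) set" and y y' :: "('b sing_simplex \<Rightarrow> 'r) set" and r :: 'r
  {
    assume x: "x \<in> carrier (cohomology 1 S)"
    obtain a where a: "a \<in> cocycles 1 S" "x = coh_class S a" using c1[OF x] by blast
    show "p1 x \<in> carrier (cohomology 1 P)"
      unfolding a(2) p1_class[OF a(1)] carrier_cohomology using pr_cocycle(1)[OF a(1)] by blast
    have "pr1 (\<lambda>\<sigma>. r * a \<sigma>) = (\<lambda>\<sigma>. r * pr1 a \<sigma>)" by (auto simp: cochain_pullback_def)
    then show "p1 (r \<odot>\<^bsub>cohomology 1 S\<^esub> x) = r \<odot>\<^bsub>cohomology 1 P\<^esub> p1 x"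
      using a by (simp add: coh_class_smult p1_class pr_cocycle cocycles_closed(3) del: One_nat_def)
    assume x': "x' \<in> carrier (cohomology 1 S)"
    obtain a' where a': "a' \<in> cocycles 1 S" "x' = coh_class S a'" using c1[OF x'] by blast
    have "pr1 (\<lambda>\<sigma>. a \<sigma> + a' \<sigma>) = (\<lambda>\<sigma>. pr1 a \<sigma> + pr1 a' \<sigma>)" by (auto simp: cochain_pullback_def)
    then show "p1 (x \<oplus>\<^bsub>cohomology 1 S\<^esub> x') = p1 x \<oplus>\<^bsub>cohomology 1 P\<^esub> p1 x'"
      using a a' by (simp add: coh_class_add p1_class pr_cocycle cocycles_closed(2) del: One_nat_def)
    assume I: "cup_vanishes S x x'"
    then have "cup_cochain S a a' \<in> coboundaries 2 S" using iff a a' by blast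
    from pullback_coboundary_2[OF continuous_map_fst this]
    show "cup_vanishes P (p1 x) (p1 x')"
      unfolding pullback_cup[OF continuous_map_fst] a(2) a'(2) p1_class[OF a(1)] p1_class[OF a'(1)]
      using iff pr_cocycle(1)[OF a(1)] pr_cocycle(1)[OF a'(1)] by blast
  }
  {
    assume y: "y \<in> carrier (cohomology 1 T)"
    obtain b where b: "b \<in> cocycles 1 T" "y = coh_class T b" using c2[OF y] by blast
    show "p2 y \<in> carrier (cohomology 1 P)"
      unfolding b(2) p2_class[OF b(1)] carrier_cohomology using pr_cocycle(2)[OF b(1)] by blast
    have "pr2 (\<lambda>\<sigma>. r * b \<sigma>) = (\<lambda>\<sigma>. r * pr2 b \<sigma>)" by (auto simp: cochain_pullback_def)
    then show "p2 (r \<odot>\<^bsub>cohomology 1 T\<^esub> y) = r \<odot>\<^bsub>cohomology 1 P\<^esub> p2 y"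
      using b by (simp add: coh_class_smult p2_class pr_cocycle cocycles_closed(3) del: One_nat_def)
    assume y': "y' \<in> carrier (cohomology 1 T)"
    obtain b' where b': "b' \<in> cocycles 1 T" "y' = coh_class T b'" using c2[OF y'] by blast
    have "pr2 (\<lambda>\<sigma>. b \<sigma> + b' \<sigma>) = (\<lambda>\<sigma>. pr2 b \<sigma> + pr2 b' \<sigma>)" by (auto simp: cochain_pullback_def)
    then show "p2 (y \<oplus>\<^bsub>cohomology 1 T\<^esub> y') = p2 y \<oplus>\<^bsub>cohomology 1 P\<^esub> p2 y'"
      using b b' by (simp add: coh_class_add p2_class pr_cocycle cocycles_closed(2) del: One_nat_def)
    assume I: "cup_vanishes T y y'"
    then have "cup_cochain T b b' \<in> coboundaries 2 T" using iff b b' by blast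
    from pullback_coboundary_2[OF continuous_map_snd this]
    show "cup_vanishes P (p2 y) (p2 y')"
      unfolding pullback_cup[OF continuous_map_snd] b(2) b'(2) p2_class[OF b(1)] p2_class[OF b'(1)]
      using iff pr_cocycle(2)[OF b(1)] pr_cocycle(2)[OF b'(1)] by blast
  }
  {
    assume x: "x \<in> carrier (cohomology 1 S)" and y: "y \<in> carrier (cohomology 1 T)"
    obtain a where a: "a \<in> cocycles 1 S" "x = coh_class S a" using c1[OF x] by blast
    obtain b where b: "b \<in> cocycles 1 T" "y = coh_class T b" using c2[OF y] by blast
    {
      assume "cup_vanishes S x x" "cup_vanishes T y y"
      then have "cup_cochain S a a \<in> coboundaries 2 S" "cup_cochain T b b \<in> coboundaries 2 T"
        using iff a b by blast+
      from cup_square_sum[OF a(1) this(1) b(1) this(2)]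
      show "cup_vanishes P (p1 x \<oplus>\<^bsub>cohomology 1 P\<^esub> p2 y) (p1 x \<oplus>\<^bsub>cohomology 1 P\<^esub> p2 y)"
        unfolding a(2) b(2) p_sum_class[OF a(1) b(1)]
        using iff sum_cocycle[OF a(1) b(1)] by blast
    }
    assume x': "x' \<in> carrier (cohomology 1 S)" and y': "y' \<in> carrier (cohomology 1 T)"
    obtain a' where a': "a' \<in> cocycles 1 S" "x' = coh_class S a'" using c1[OF x'] by blast
    obtain b' where b': "b' \<in> cocycles 1 T" "y' = coh_class T b'" using c2[OF y'] by blast
    let ?F = "\<lambda>\<sigma>. pr1 a \<sigma> + pr2 b \<sigma>" and ?F' = "\<lambda>\<sigma>. pr1 a' \<sigma> + pr2 b' \<sigma>"
    note F = sum_cocycle[OF a(1) b(1)] and F' = sum_cocycle[OF a'(1) b'(1)]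
    {
      assume "p1 x \<oplus>\<^bsub>cohomology 1 P\<^esub> p2 y = p1 x' \<oplus>\<^bsub>cohomology 1 P\<^esub> p2 y'"
      then have "coh_class P ?F = coh_class P ?F'"
        unfolding a(2) b(2) a'(2) b'(2) p_sum_class[OF a(1) b(1)] p_sum_class[OF a'(1) b'(1)] .
      then have B: "(\<lambda>\<sigma>. ?F \<sigma> - ?F' \<sigma>) \<in> coboundaries 1 P" unfolding coh_class_eq_iff[OF F F'] .
      have "in1 (\<lambda>\<sigma>. ?F \<sigma> - ?F' \<sigma>) = (\<lambda>\<sigma>. in1 ?F \<sigma> - in1 ?F' \<sigma>)"
          "in2 (\<lambda>\<sigma>. ?F \<sigma> - ?F' \<sigma>) = (\<lambda>\<sigma>. in2 ?F \<sigma> - in2 ?F' \<sigma>)"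
        by (auto simp: cochain_pullback_def)
      then have "in1 (\<lambda>\<sigma>. ?F \<sigma> - ?F' \<sigma>) = (\<lambda>\<sigma>. a \<sigma> - a' \<sigma>)" "in2 (\<lambda>\<sigma>. ?F \<sigma> - ?F' \<sigma>) = (\<lambda>\<sigma>. b \<sigma> - b' \<sigma>)"
        unfolding restrict_sum[OF a(1) b(1)] restrict_sum[OF a'(1) b'(1)] by blast+
      then have "(\<lambda>\<sigma>. a \<sigma> - a' \<sigma>) \<in> coboundaries 1 S" "(\<lambda>\<sigma>. b \<sigma> - b' \<sigma>) \<in> coboundaries 1 T"
        using pullback_coboundary[OF cont_in(1) B] pullback_coboundary[OF cont_in(2) B] by metis+
      then show "x = x' \<and> y = y'"
        unfolding a(2) b(2) a'(2) b'(2) coh_class_eq_iff[OF a(1) a'(1)] coh_class_eq_iff[OF b(1) b'(1)]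
        by blast
    }
    assume "cup_vanishes P (p1 x \<oplus>\<^bsub>cohomology 1 P\<^esub> p2 y) (p1 x' \<oplus>\<^bsub>cohomology 1 P\<^esub> p2 y')"
    then have cup: "cup_cochain P ?F ?F' \<in> coboundaries 2 P"
      unfolding a(2) b(2) a'(2) b'(2) p_sum_class[OF a(1) b(1)] p_sum_class[OF a'(1) b'(1)]
      using iff[OF F F'] by blast
    have "cup_vanishes S x x'" "cup_vanishes T y y'"
      using cup_restrict[OF a(1) a'(1) b(1) b'(1) cup] iff a b a' b' by blast+
    moreover have "loop_ev S x0 x s * loop_ev T y0 y' t = loop_ev S x0 x' s * loop_ev T y0 y t" for s t
      using torus[OF a(1) a'(1) b(1) b'(1) cup, of s t] by (simp add: a(2) b(2) a'(2) b'(2) loop_ev_class)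
    ultimately show "cup_vanishes S x x' \<and> cup_vanishes T y y' \<and>
        (\<forall>s t. loop_ev S x0 x s * loop_ev T y0 y' t = loop_ev S x0 x' s * loop_ev T y0 y t)" by blast
  }
  fix z :: "(('a \<times> 'b) sing_simplex \<Rightarrow> 'r) set"
  assume "z \<in> carrier (cohomology 1 P)"
  then obtain f where f: "f \<in> cocycles 1 P" "z = coh_class P f" using cP by blast
  have c: "in1 f \<in> cocycles 1 S" "in2 f \<in> cocycles 1 T"
    using pullback_cocycle cont_in f(1) by blast+
  have "z = p1 (coh_class S (in1 f)) \<oplus>\<^bsub>cohomology 1 P\<^esub> p2 (coh_class T (in2 f))"
    unfolding f(2) p_sum_class[OF c] coh_class_eq_iff[OF f(1) sum_cocycle[OF c]] by (rule kunneth[OF f(1)])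
  then show "\<exists>a\<in>carrier (cohomology 1 S). \<exists>b\<in>carrier (cohomology 1 T). z = p1 a \<oplus>\<^bsub>cohomology 1 P\<^esub> p2 b"
    unfolding carrier_cohomology using c by blast
qed

end

section \<open>Linear algebra over a domain\<close>

context coefficient_ring
begin

text \<open>Gaussian elimination without division: a vector \<open>v i\<close> with nonzero entry at \<open>e\<close> serves to clear this entry
in all others, at the cost of multiplying them by \<open>v i e\<close>.\<close>

lemma dependent_vectors:
  fixes v :: "'j \<Rightarrow> 'e \<Rightarrow> 'r"
  assumes "finite E" "finite J" "card E < card J"
  shows "\<exists>a. (\<exists>j\<in>J. a j \<noteq> 0) \<and> (\<forall>e\<in>E. (\<Sum>j\<in>J. a j * v j e) = 0)"
  using assms
proof (induction E arbitrary: J v rule: finite_induct)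
  case empty
  then have "J \<noteq> {}" by auto
  then show ?case by (intro exI[of _ "\<lambda>_. 1"]) auto
next
  case (insert e E)
  show ?case
  proof (cases "\<forall>j\<in>J. v j e = 0")
    case True
    have "card E < card J" using insert by simp
    from insert.IH[OF insert.prems(1) this, of v] obtain a where
      "\<exists>j\<in>J. a j \<noteq> 0" "\<forall>e\<in>E. (\<Sum>j\<in>J. a j * v j e) = 0" by blast
    then show ?thesis using True by (intro exI[of _ a]) auto
  next
    case False
    then obtain i where i: "i \<in> J" "v i e \<noteq> 0" by blast
    define J' where "J' = J - {i}"
    have J': "finite J'" "J = insert i J'" "i \<notin> J'" using insert.prems i by (auto simp: J'_def)
    then have "card E < card J'" using insert.prems insert.hyps by simp
    from insert.IH[OF J'(1) this, of "\<lambda>j x. v i e * v j x - v j e * v i x"] obtain a where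
      a: "\<exists>j\<in>J'. a j \<noteq> 0" "\<forall>x\<in>E. (\<Sum>j\<in>J'. a j * (v i e * v j x - v j e * v i x)) = 0" by blast
    define b where "b j = (if j = i then - (\<Sum>j\<in>J'. a j * v j e) else v i e * a j)" for j
    have sum_b: "(\<Sum>j\<in>J. b j * v j x) = (\<Sum>j\<in>J'. a j * (v i e * v j x - v j e * v i x))" for x
    proof -
      have "(\<Sum>j\<in>J'. b j * v j x) = (\<Sum>j\<in>J'. v i e * a j * v j x)"
        by (rule sum.cong) (use J'(3) in \<open>auto simp: b_def\<close>)
      then have "(\<Sum>j\<in>J. b j * v j x) = - (\<Sum>j\<in>J'. a j * v j e) * v i x + (\<Sum>j\<in>J'. v i e * a j * v j x)"
        using J' by (simp add: b_def)
      also have "\<dots> = (\<Sum>j\<in>J'. a j * (v i e * v j x - v j e * v i x))"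
        by (simp add: right_diff_distrib sum_subtractf sum_distrib_left sum_distrib_right mult_ac)
      finally show ?thesis .
    qed
    obtain j where "j \<in> J'" "a j \<noteq> 0" using a(1) by blast
    then have "b j \<noteq> 0" using no_zero_divisors i(2) J'(3) by (auto simp: b_def)
    moreover have "(\<Sum>j\<in>J. b j * v j e) = 0" unfolding sum_b by (simp add: algebra_simps)
    ultimately show ?thesis
      using a(2) sum_b \<open>j \<in> J'\<close> J'(2) by (intro exI[of _ b]) auto
  qed
qed

text \<open>If \<open>z\<close> is not torsion modulo the submodule \<open>B\<close> of \<open>R\<^sup>E\<close>, some functional kills \<open>B\<close> but not \<open>z\<close>.
The induction removes a coordinate \<open>e\<close>. If some \<open>b \<in> B\<close> has \<open>b e \<noteq> 0\<close>, replace each vector \<open>w\<close> by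
\<open>b e * w - w e * b\<close>, whose entry at \<open>e\<close> is zero; pulling back along this map avoids any
division, so the argument is valid over the integers. Finiteness of \<open>E\<close> is essential there: the
rational numbers are torsion-free but have no nonzero functional to the integers.\<close>

lemma separating_functional:
  fixes B :: "('e \<Rightarrow> 'r) set" and z :: "'e \<Rightarrow> 'r"
  assumes "finite E" and zero: "(\<lambda>_. 0) \<in> B"
    and closed: "\<And>v w s t. v \<in> B \<Longrightarrow> w \<in> B \<Longrightarrow> (\<lambda>e. s * v e + t * w e) \<in> B"
    and nontorsion: "\<And>r w. r \<noteq> 0 \<Longrightarrow> w \<in> B \<Longrightarrow> \<exists>e\<in>E. w e \<noteq> r * z e"
  shows "\<exists>\<phi>. (\<forall>w\<in>B. (\<Sum>e\<in>E. \<phi> e * w e) = 0) \<and> (\<Sum>e\<in>E. \<phi> e * z e) \<noteq> 0"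
  using assms
proof (induction E arbitrary: B z rule: finite_induct)
  case empty
  from empty.prems(3)[of 1 "\<lambda>_. 0"] empty.prems(1) show ?case by simp
next
  case (insert e E)
  show ?case
  proof (cases "\<forall>b\<in>B. b e = 0")
    case True
    show ?thesis
    proof (cases "z e = 0")
      case False
      have "(\<Sum>x\<in>insert e E. (if x = e then 1 else 0) * w x) = w e" for w :: "'e \<Rightarrow> 'r"
        using insert.hyps by (simp add: sum.remove[of _ e] if_distrib[of "\<lambda>c. c * _"] cong: if_cong)
      then show ?thesis using True False by (intro exI[of _ "\<lambda>x. if x = e then 1 else 0"]) simp
    next
      case z0: True
      have "\<exists>\<phi>. (\<forall>w\<in>B. (\<Sum>e\<in>E. \<phi> e * w e) = 0) \<and> (\<Sum>e\<in>E. \<phi> e * z e) \<noteq> 0"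
      proof (rule insert.IH[OF insert.prems(1,2)])
        fix r w assume r: "r \<noteq> (0::'r)" and w: "w \<in> B"
        then obtain x where "x \<in> insert e E" "w x \<noteq> r * z x" using insert.prems(3) by blast
        then show "\<exists>e\<in>E. w e \<noteq> r * z e" using z0 True w by auto
      qed
      then obtain \<phi> where \<phi>: "\<forall>w\<in>B. (\<Sum>e\<in>E. \<phi> e * w e) = 0" "(\<Sum>e\<in>E. \<phi> e * z e) \<noteq> 0" by blast
      then show ?thesis using insert.hyps True z0 by (intro exI[of _ \<phi>]) auto
    qed
  next
    case False
    then obtain b where b: "b \<in> B" "b e \<noteq> 0" by blast
    define B' where "B' = {w \<in> B. w e = 0}"
    define z' where "z' x = b e * z x - z e * b x" for x
    have "\<exists>\<phi>. (\<forall>w\<in>B'. (\<Sum>e\<in>E. \<phi> e * w e) = 0) \<and> (\<Sum>e\<in>E. \<phi> e * z' e) \<noteq> 0"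
    proof (rule insert.IH)
      show "(\<lambda>_. 0) \<in> B'" using insert.prems(1) by (simp add: B'_def)
      show "(\<lambda>e. s * v e + t * w e) \<in> B'" if "v \<in> B'" "w \<in> B'" for v w s t
        using that insert.prems(2) by (simp add: B'_def)
      fix r w assume r: "r \<noteq> (0::'r)" and w: "w \<in> B'"
      show "\<exists>x\<in>E. w x \<noteq> r * z' x"
      proof (rule ccontr)
        assume "\<not> (\<exists>x\<in>E. w x \<noteq> r * z' x)"
        then have eq: "w x = r * z' x" if "x \<in> insert e E" for x
          using that w by (auto simp: B'_def z'_def mult.commute)
        have "(\<lambda>x. 1 * w x + (r * z e) * b x) \<in> B"
          using w b(1) by (intro insert.prems(2)) (simp_all add: B'_def)
        moreover have "r * b e \<noteq> 0" using r b no_zero_divisors by blast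
        ultimately obtain x where "x \<in> insert e E" "1 * w x + (r * z e) * b x \<noteq> (r * b e) * z x"
          using insert.prems(3) by blast
        then show False using eq[of x] by (simp add: z'_def algebra_simps)
      qed
    qed
    then obtain \<psi> where \<psi>: "\<And>w. w \<in> B' \<Longrightarrow> (\<Sum>e\<in>E. \<psi> e * w e) = 0" "(\<Sum>e\<in>E. \<psi> e * z' e) \<noteq> 0" by blast
    define \<phi> where "\<phi> x = (if x = e then - (\<Sum>y\<in>E. \<psi> y * b y) else b e * \<psi> x)" for x
    have sum_\<phi>: "(\<Sum>x\<in>insert e E. \<phi> x * w x) = (\<Sum>x\<in>E. \<psi> x * (b e * w x - w e * b x))" for w
    proof -
      have "(\<Sum>x\<in>E. \<phi> x * w x) = (\<Sum>x\<in>E. b e * \<psi> x * w x)"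
        by (rule sum.cong) (use insert.hyps in \<open>auto simp: \<phi>_def\<close>)
      then have "(\<Sum>x\<in>insert e E. \<phi> x * w x) = - (\<Sum>y\<in>E. \<psi> y * b y) * w e + (\<Sum>x\<in>E. b e * \<psi> x * w x)"
        using insert.hyps by (simp add: \<phi>_def)
      also have "\<dots> = (\<Sum>x\<in>E. \<psi> x * (b e * w x - w e * b x))"
        by (simp add: right_diff_distrib sum_subtractf sum_distrib_left sum_distrib_right mult_ac)
      finally show ?thesis .
    qed
    have "(\<Sum>x\<in>insert e E. \<phi> x * w x) = 0" if "w \<in> B" for w
    proof -
      have "(\<lambda>x. b e * w x + (- w e) * b x) \<in> B" using insert.prems(2)[OF that b(1)] .
      then have "(\<lambda>x. b e * w x - w e * b x) \<in> B'" by (simp add: B'_def mult.commute)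
      then show ?thesis using \<psi>(1) sum_\<phi> by simp
    qed
    then show ?thesis using \<psi>(2) sum_\<phi>[of z] by (intro exI[of _ \<phi>]) (simp add: z'_def)
  qed
qed

end

section \<open>Singular chains\<close>

abbreviation smul :: "'r::comm_ring_1 \<Rightarrow> ('x \<Rightarrow>\<^sub>0 'r) \<Rightarrow> ('x \<Rightarrow>\<^sub>0 'r)" where
  "smul r \<equiv> Poly_Mapping.map (\<lambda>a. r * a)"

lemma lookup_smul [simp]: "Poly_Mapping.lookup (smul r c) x = r * Poly_Mapping.lookup c x"
  by (simp add: Poly_Mapping.map.rep_eq when_def)

lemma keys_smul: "Poly_Mapping.keys (smul r c) \<subseteq> Poly_Mapping.keys c"
  by (auto simp: in_keys_iff)

lemma smul_zero [simp]: "smul r 0 = 0"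
  by (rule poly_mapping_eqI) simp

lemma smul_simps [simp]:
  "Poly_Mapping.map (\<lambda>a. 0) c = 0" "Poly_Mapping.map (\<lambda>a. a) c = c"
  "Poly_Mapping.map uminus d = - (d :: 'x \<Rightarrow>\<^sub>0 'r::comm_ring_1)"
  by (rule poly_mapping_eqI; simp add: Poly_Mapping.map.rep_eq when_def)+

lemma smul_minus_one: "smul (- 1) c = - c"
  by simp

lemma smul_sum: "smul r (\<Sum>i\<in>A. c i) = (\<Sum>i\<in>A. smul r (c i))"
  by (rule poly_mapping_eqI) (simp add: lookup_sum sum_distrib_left)

lemma smul_single: "smul r (Poly_Mapping.single x a) = Poly_Mapping.single x (r * a)"
  by (rule poly_mapping_eqI) (simp add: lookup_single when_def)

text \<open>The additive extension to chains of a function on simplices with coefficients. The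
boundary, the pairing with a cochain and the sums over end points of edges are all of this form.\<close>

definition extend :: "('x \<Rightarrow> 'r::comm_ring_1 \<Rightarrow> 'c::ab_group_add) \<Rightarrow> ('x \<Rightarrow>\<^sub>0 'r) \<Rightarrow> 'c" where
  "extend h c = (\<Sum>x\<in>Poly_Mapping.keys c. h x (Poly_Mapping.lookup c x))"

lemma extend_superset:
  assumes "\<And>x. h x 0 = 0" "finite A" "Poly_Mapping.keys c \<subseteq> A"
  shows "extend h c = (\<Sum>x\<in>A. h x (Poly_Mapping.lookup c x))"
  unfolding extend_def
  by (rule sum.mono_neutral_left) (use assms in \<open>auto simp: in_keys_iff\<close>)

lemma extend_add:
  assumes "\<And>x a b. h x (a + b) = h x a + h x b"
  shows "extend h (c + d) = extend h c + extend h d"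
proof -
  have 0: "h x 0 = 0" for x using assms[of x 0 0] by simp
  let ?A = "Poly_Mapping.keys c \<union> Poly_Mapping.keys d"
  have fin: "finite ?A" by simp
  show ?thesis
    using extend_superset[of h, OF 0 fin keys_add] extend_superset[of h, OF 0 fin Un_upper1]
      extend_superset[of h, OF 0 fin Un_upper2]
    by (simp add: lookup_add assms sum.distrib)
qed

lemma extend_zero [simp]: "extend h 0 = 0"
  by (simp add: extend_def)

lemma extend_sum:
  assumes "\<And>x a b. h x (a + b) = h x a + h x b"
  shows "extend h (\<Sum>i\<in>A. c i) = (\<Sum>i\<in>A. extend h (c i))"
  by (induction A rule: infinite_finite_induct) (simp_all add: extend_add[OF assms])

lemma extend_single: "h x 0 = 0 \<Longrightarrow> extend h (Poly_Mapping.single x a) = h x a"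
  by (cases "a = 0") (simp_all add: extend_def)

lemma chain_eq_sum: "c = (\<Sum>x\<in>Poly_Mapping.keys c. Poly_Mapping.single x (Poly_Mapping.lookup c x))"
  by (rule poly_mapping_eqI) (simp add: lookup_sum lookup_single when_def in_keys_iff)

definition pairing :: "('x \<Rightarrow> 'r::comm_ring_1) \<Rightarrow> ('x \<Rightarrow>\<^sub>0 'r) \<Rightarrow> 'r" where
  "pairing f = extend (\<lambda>x a. a * f x)"

lemma pairing_simps [simp]:
  "pairing f 0 = 0" "pairing f (c + d) = pairing f c + pairing f d" "pairing f (- c) = - pairing f c"
  "pairing f (c - d) = pairing f c - pairing f d"
  "pairing f (Poly_Mapping.single x a) = a * f x" "pairing f (smul r c) = r * pairing f c"
proof -
  show add: "pairing f (c + d) = pairing f c + pairing f d" for c d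
    unfolding pairing_def by (rule extend_add) (simp add: algebra_simps)
  show zero: "pairing f 0 = 0" by (simp add: pairing_def)
  show neg: "pairing f (- c) = - pairing f c" for c
    using add[of c "- c"] zero by (simp add: add_eq_0_iff)
  show "pairing f (c - d) = pairing f c - pairing f d" using add[of c "- d"] neg by simp
  show "pairing f (Poly_Mapping.single x a) = a * f x"
    unfolding pairing_def by (rule extend_single) simp
  have "pairing f (smul r c) = (\<Sum>x\<in>Poly_Mapping.keys c. Poly_Mapping.lookup (smul r c) x * f x)"
    unfolding pairing_def by (rule extend_superset) (simp_all add: keys_smul)
  then show "pairing f (smul r c) = r * pairing f c"
    by (simp add: pairing_def extend_def sum_distrib_left mult.assoc)
qed

lemma pairing_sum: "pairing f (\<Sum>i\<in>A. c i) = (\<Sum>i\<in>A. pairing f (c i))"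
  by (induction A rule: infinite_finite_induct) auto

lemma boundary_extend:
  "n > 0 \<Longrightarrow> boundary n c = extend (\<lambda>\<sigma> a. \<Sum>k\<le>n. Poly_Mapping.single (singular_face n k \<sigma>) ((- 1) ^ k * a)) c"
  by (simp add: boundary_def extend_def)

lemma boundary_add: "boundary n (c + d) = boundary n c + boundary n d"
proof (cases "n > 0")
  case True
  show ?thesis
    unfolding boundary_extend[OF True]
    by (rule extend_add) (simp add: distrib_left single_add sum.distrib)
qed (simp add: boundary_def)

lemma boundary_zero [simp]: "boundary n 0 = 0"
  by (simp add: boundary_def)

lemma boundary_smul: "boundary n (smul r c) = smul r (boundary n c)"
proof (cases "n > 0")
  case True
  have "boundary n (smul r c) = (\<Sum>\<sigma>\<in>Poly_Mapping.keys c. \<Sum>k\<le>n.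
      Poly_Mapping.single (singular_face n k \<sigma>) ((- 1) ^ k * Poly_Mapping.lookup (smul r c) \<sigma>))"
    unfolding boundary_extend[OF True] by (rule extend_superset) (simp_all add: keys_smul)
  then show ?thesis
    using True by (simp add: boundary_def smul_sum smul_single mult.left_commute)
qed (simp add: boundary_def)

lemma boundary_2_single:
  "boundary 2 (Poly_Mapping.single \<tau> a) = Poly_Mapping.single (singular_face 2 0 \<tau>) a
     - Poly_Mapping.single (singular_face 2 1 \<tau>) a + Poly_Mapping.single (singular_face 2 2 \<tau>) a"
  by (simp add: boundary_extend extend_single numeral_2_eq_2 single_uminus[symmetric])

lemma boundary_1_single:
  assumes "singular_simplex 1 S \<sigma>"
  shows "boundary 1 (Poly_Mapping.single \<sigma> a) = Poly_Mapping.single (point_simplex (\<sigma> (vertex 1))) a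
     - Poly_Mapping.single (point_simplex (\<sigma> (vertex 0))) a"
  using face_1[OF assms]
  by (simp add: boundary_extend extend_single single_uminus[symmetric])

lemma boundary_diff: "boundary n (c - d) = boundary n c - boundary n d"
  using boundary_add[of n "c - d" d] by simp

lemma boundary_sum: "boundary n (\<Sum>i\<in>A. c i) = (\<Sum>i\<in>A. boundary n (c i))"
  by (induction A rule: infinite_finite_induct) (simp_all add: boundary_add)

lemma boundary_boundary:
  assumes "Poly_Mapping.keys c \<subseteq> singular_simplex_set 2 S"
  shows "boundary 1 (boundary 2 c) = 0"
proof -
  have "boundary 1 (boundary 2 (Poly_Mapping.single \<tau> a)) = 0" if \<tau>: "singular_simplex 2 S \<tau>"
    for \<tau> and a :: 'b
    unfolding boundary_2_single boundary_add boundary_diff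
      boundary_1_single[OF singular_face_2(1)[OF \<tau>]] boundary_1_single[OF singular_face_2(2)[OF \<tau>]]
      boundary_1_single[OF singular_face_2(3)[OF \<tau>]] vertex_face[OF \<tau>] by simp
  then have "(\<Sum>\<tau>\<in>Poly_Mapping.keys c. boundary 1 (boundary 2
      (Poly_Mapping.single \<tau> (Poly_Mapping.lookup c \<tau>)))) = 0"
    using assms by (intro sum.neutral) blast
  then show ?thesis
    by (subst chain_eq_sum[of c]) (simp only: boundary_sum)
qed

lemma keys_boundary_2:
  assumes "Poly_Mapping.keys c \<subseteq> singular_simplex_set 2 S"
  shows "Poly_Mapping.keys (boundary 2 c) \<subseteq> singular_simplex_set 1 S"
proof -
  have "Poly_Mapping.keys (boundary 2 (Poly_Mapping.single \<tau> a)) \<subseteq> singular_simplex_set 1 S"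
    if \<tau>: "singular_simplex 2 S \<tau>" for \<tau> and a :: 'b
  proof -
    have "Poly_Mapping.keys (boundary 2 (Poly_Mapping.single \<tau> a))
        \<subseteq> {singular_face 2 0 \<tau>, singular_face 2 1 \<tau>, singular_face 2 2 \<tau>}"
      unfolding boundary_2_single
      by (intro subset_trans[OF keys_add] Un_least subset_trans[OF keys_diff]) simp_all
    then show ?thesis using singular_face_2[OF \<tau>] by blast
  qed
  then have "(\<Union>\<tau>\<in>Poly_Mapping.keys c. Poly_Mapping.keys (boundary 2
      (Poly_Mapping.single \<tau> (Poly_Mapping.lookup c \<tau>)))) \<subseteq> singular_simplex_set 1 S"
    using assms by blast
  from order_trans[OF keys_sum this]
  have "Poly_Mapping.keys (\<Sum>\<tau>\<in>Poly_Mapping.keys c. boundary 2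
      (Poly_Mapping.single \<tau> (Poly_Mapping.lookup c \<tau>))) \<subseteq> singular_simplex_set 1 S" .
  moreover have "boundary 2 c = (\<Sum>\<tau>\<in>Poly_Mapping.keys c. boundary 2 (Poly_Mapping.single \<tau> (Poly_Mapping.lookup c \<tau>)))"
    by (subst chain_eq_sum[of c]) (simp only: boundary_sum)
  ultimately show ?thesis by (simp only:)
qed

section \<open>First homology\<close>

definition cycles_1 :: "'a topology \<Rightarrow> ('a sing_simplex \<Rightarrow>\<^sub>0 'r::comm_ring_1) set" where
  "cycles_1 S = {c \<in> carrier (chain_module 1 S). boundary 1 c = 0}"

definition boundaries_1 :: "'a topology \<Rightarrow> ('a sing_simplex \<Rightarrow>\<^sub>0 'r::comm_ring_1) set" where
  "boundaries_1 S = boundary 2 ` carrier (chain_module 2 S)"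

lemma homology_1: "homology 1 S = quotient_module ((chain_module 1 S)\<lparr>carrier := cycles_1 S\<rparr>) (boundaries_1 S)"
  by (simp add: homology_def cycles_1_def boundaries_1_def numeral_2_eq_2)

lemma in_chain_module: "c \<in> carrier (chain_module n S) \<longleftrightarrow> Poly_Mapping.keys c \<subseteq> singular_simplex_set n S"
  by (simp add: chain_module_def)

lemma chain_closed:
  "0 \<in> carrier (chain_module n S)"
  "c \<in> carrier (chain_module n S) \<Longrightarrow> d \<in> carrier (chain_module n S) \<Longrightarrow> c + d \<in> carrier (chain_module n S)"
  "c \<in> carrier (chain_module n S) \<Longrightarrow> smul r c \<in> carrier (chain_module n S)"
  using keys_add[of c d] keys_smul[of r c] unfolding in_chain_module by auto

lemma cycles_closed:
  "0 \<in> cycles_1 S" "c \<in> cycles_1 S \<Longrightarrow> d \<in> cycles_1 S \<Longrightarrow> c + d \<in> cycles_1 S"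
  "c \<in> cycles_1 S \<Longrightarrow> smul r c \<in> cycles_1 S"
  unfolding cycles_1_def
  by (auto simp: chain_closed boundary_add boundary_smul simp del: One_nat_def)

lemma boundaries_closed:
  fixes S :: "'a topology" and c d :: "'a sing_simplex \<Rightarrow>\<^sub>0 'r::comm_ring_1"
  shows "(0 :: 'a sing_simplex \<Rightarrow>\<^sub>0 'r) \<in> boundaries_1 S"
    and "c \<in> boundaries_1 S \<Longrightarrow> d \<in> boundaries_1 S \<Longrightarrow> c + d \<in> boundaries_1 S"
  "c \<in> boundaries_1 S \<Longrightarrow> smul r c \<in> boundaries_1 S"
  "c \<in> boundaries_1 S \<Longrightarrow> d \<in> boundaries_1 S \<Longrightarrow> c - d \<in> boundaries_1 S"
proof -
  show "(0 :: 'a sing_simplex \<Rightarrow>\<^sub>0 'r) \<in> boundaries_1 S"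
    unfolding boundaries_1_def by (rule image_eqI[OF _ chain_closed(1)]) simp
  show add: "c + d \<in> boundaries_1 S" if "c \<in> boundaries_1 S" "d \<in> boundaries_1 S" for c d :: "'a sing_simplex \<Rightarrow>\<^sub>0 'r"
    using that unfolding boundaries_1_def by (auto simp flip: boundary_add intro!: imageI chain_closed)
  show smul: "smul r c \<in> boundaries_1 S" if "c \<in> boundaries_1 S" for r and c :: "'a sing_simplex \<Rightarrow>\<^sub>0 'r"
    using that unfolding boundaries_1_def by (auto simp flip: boundary_smul intro!: imageI chain_closed)
  assume c: "c \<in> boundaries_1 S" and d: "d \<in> boundaries_1 S"
  then show "c - d \<in> boundaries_1 S" using add[OF c smul[OF d, of "- 1"]] by (simp only: smul_minus_one) simp
qed

lemma boundaries_subset_cycles: "boundaries_1 S \<subseteq> cycles_1 S"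
proof
  fix c assume "c \<in> boundaries_1 S"
  then obtain d where "Poly_Mapping.keys d \<subseteq> singular_simplex_set 2 S" "c = boundary 2 d"
    unfolding boundaries_1_def in_chain_module by (auto simp: in_chain_module)
  then show "c \<in> cycles_1 S"
    using boundary_boundary[of d S] keys_boundary_2[of d S] by (simp add: cycles_1_def in_chain_module)
qed

lemma homology_quotient:
  "quotient_data ((chain_module 1 S)\<lparr>carrier := cycles_1 S\<rparr> :: ('r::comm_ring_1, 'a sing_simplex \<Rightarrow>\<^sub>0 'r) module)
     (boundaries_1 S)"
proof -
  have simps: "add (chain_module 1 S) = (+)" "zero (chain_module 1 S) = 0"
    "Module.smult (chain_module 1 S) = (\<lambda>r. smul r)"
    by (simp_all add: chain_module_def)
  have "module (ring_of_type_algebra :: 'r ring)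
     ((chain_module 1 S)\<lparr>carrier := cycles_1 S\<rparr> :: ('r, 'a sing_simplex \<Rightarrow>\<^sub>0 'r) module)"
  proof (rule moduleI)
    show "cring (ring_of_type_algebra :: 'r ring)" by (rule cring_from_type_algebra)
    show "abelian_group ((chain_module 1 S)\<lparr>carrier := cycles_1 S\<rparr> :: ('r, 'a sing_simplex \<Rightarrow>\<^sub>0 'r) module)"
    proof (rule abelian_groupI)
      fix x :: "'a sing_simplex \<Rightarrow>\<^sub>0 'r"
      assume x: "x \<in> carrier ((chain_module 1 S)\<lparr>carrier := cycles_1 S\<rparr>)"
      have "- x \<in> cycles_1 S" using x cycles_closed(3)[of x S "- 1"] unfolding smul_minus_one by simp
      then show "\<exists>y\<in>carrier ((chain_module 1 S)\<lparr>carrier := cycles_1 S\<rparr>).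
          y \<oplus>\<^bsub>(chain_module 1 S)\<lparr>carrier := cycles_1 S\<rparr>\<^esub> x = \<zero>\<^bsub>(chain_module 1 S)\<lparr>carrier := cycles_1 S\<rparr>\<^esub>"
        by (auto simp: simps simp del: One_nat_def intro!: bexI[of _ "- x"])
    qed (auto simp: simps cycles_closed add_ac simp del: One_nat_def)
  qed (auto simp: simps cycles_closed lookup_add algebra_simps simp del: One_nat_def intro!: poly_mapping_eqI)
  then interpret M: module "ring_of_type_algebra :: 'r ring"
     "(chain_module 1 S)\<lparr>carrier := cycles_1 S\<rparr> :: ('r, 'a sing_simplex \<Rightarrow>\<^sub>0 'r) module" .
  show ?thesis
    by unfold_locales
      (use boundaries_subset_cycles boundaries_closed in \<open>auto simp: simps simp del: One_nat_def\<close>)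
qed

section \<open>Betti numbers\<close>

context
  fixes V :: "('r::comm_ring_1, 'm) module"
  assumes V: "module (ring_of_type_algebra :: 'r ring) V"
begin

interpretation M: module "ring_of_type_algebra :: 'r ring" V by (rule V)

lemma lin_indep_singleton_iff:
  assumes "x \<in> carrier V"
  shows "lin_indep V {x} \<longleftrightarrow> (\<forall>r. r \<odot>\<^bsub>V\<^esub> x = \<zero>\<^bsub>V\<^esub> \<longrightarrow> r = 0)"
proof -
  have "(\<Oplus>\<^bsub>V\<^esub>b\<in>{x}. a b \<odot>\<^bsub>V\<^esub> b) = a x \<odot>\<^bsub>V\<^esub> x" for a :: "'m \<Rightarrow> 'r"
    using assms by simp
  then have "lin_indep V {x} \<longleftrightarrow> (\<forall>a :: 'm \<Rightarrow> 'r. a x \<odot>\<^bsub>V\<^esub> x = \<zero>\<^bsub>V\<^esub> \<longrightarrow> a x = 0)"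
    by (simp add: lin_indep_def)
  also have "\<dots> \<longleftrightarrow> (\<forall>r. r \<odot>\<^bsub>V\<^esub> x = \<zero>\<^bsub>V\<^esub> \<longrightarrow> r = 0)"
  proof (intro iffI allI impI)
    fix r assume *: "\<forall>a :: 'm \<Rightarrow> 'r. a x \<odot>\<^bsub>V\<^esub> x = \<zero>\<^bsub>V\<^esub> \<longrightarrow> a x = 0" "r \<odot>\<^bsub>V\<^esub> x = \<zero>\<^bsub>V\<^esub>"
    from *(1)[rule_format, of "\<lambda>_. r"] *(2) show "r = 0" by simp
  qed blast
  finally show ?thesis .
qed

lemma lin_dep_pair:
  assumes "x \<in> carrier V" "y \<in> carrier V" "x \<noteq> y" "\<not> lin_indep V {x, y}"
  shows "\<exists>a b. (a \<noteq> 0 \<or> b \<noteq> 0) \<and> a \<odot>\<^bsub>V\<^esub> x \<oplus>\<^bsub>V\<^esub> b \<odot>\<^bsub>V\<^esub> y = \<zero>\<^bsub>V\<^esub>"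
proof -
  have "(\<Oplus>\<^bsub>V\<^esub>b\<in>{x, y}. a b \<odot>\<^bsub>V\<^esub> b) = a x \<odot>\<^bsub>V\<^esub> x \<oplus>\<^bsub>V\<^esub> a y \<odot>\<^bsub>V\<^esub> y" for a :: "'m \<Rightarrow> 'r"
    using assms(1-3) by simp
  then show ?thesis using assms(4) unfolding lin_indep_def by auto
qed

lemma lin_indep_member:
  assumes B: "finite B" "B \<subseteq> carrier V" "lin_indep V B" "x \<in> B"
  shows "lin_indep V {x}"
proof -
  have x: "x \<in> carrier V" using B by blast
  have "r = 0" if r: "r \<odot>\<^bsub>V\<^esub> x = \<zero>\<^bsub>V\<^esub>" for r
  proof -
    define a where "a b = (if b = x then r else 0)" for b
    have "a b \<odot>\<^bsub>V\<^esub> b = \<zero>\<^bsub>V\<^esub>" if "b \<in> B" for b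
      using r that B(2) M.smult_l_null[of b] by (auto simp: a_def)
    then have "(\<Oplus>\<^bsub>V\<^esub>b\<in>B. a b \<odot>\<^bsub>V\<^esub> b) = (\<Oplus>\<^bsub>V\<^esub>b\<in>B. \<zero>\<^bsub>V\<^esub>)"
      by (intro M.finsum_cong') auto
    then have "a x = 0" using B(3,4) unfolding lin_indep_def by simp
    then show ?thesis by (simp add: a_def)
  qed
  then show ?thesis using lin_indep_singleton_iff[OF x] by blast
qed

lemma module_rank_0_iff:
  "module_rank V (carrier V) = 0 \<longleftrightarrow> (\<forall>x\<in>carrier V. \<exists>r. r \<noteq> 0 \<and> r \<odot>\<^bsub>V\<^esub> x = \<zero>\<^bsub>V\<^esub>)"
proof
  assume 0: "module_rank V (carrier V) = 0"
  show "\<forall>x\<in>carrier V. \<exists>r. r \<noteq> 0 \<and> r \<odot>\<^bsub>V\<^esub> x = \<zero>\<^bsub>V\<^esub>"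
  proof
    fix x assume x: "x \<in> carrier V"
    have "\<not> lin_indep V {x}"
    proof
      assume "lin_indep V {x}"
      then have "enat (card {x}) \<le> module_rank V (carrier V)"
        unfolding module_rank_def using x by (intro SUP_upper) auto
      then show False using 0 by (simp add: zero_enat_def)
    qed
    then show "\<exists>r. r \<noteq> 0 \<and> r \<odot>\<^bsub>V\<^esub> x = \<zero>\<^bsub>V\<^esub>" using lin_indep_singleton_iff[OF x] by blast
  qed
next
  assume *: "\<forall>x\<in>carrier V. \<exists>r. r \<noteq> 0 \<and> r \<odot>\<^bsub>V\<^esub> x = \<zero>\<^bsub>V\<^esub>"
  have "module_rank V (carrier V) \<le> 0"
    unfolding module_rank_def
  proof (rule SUP_least)
    fix B assume B: "B \<in> {B. finite B \<and> B \<subseteq> carrier V \<and> lin_indep V B}"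
    have "B = {}"
    proof (rule ccontr)
      assume "B \<noteq> {}"
      then obtain x where "x \<in> B" by blast
      then show False using B * lin_indep_member[of B x] lin_indep_singleton_iff[of x] by blast
    qed
    then show "enat (card B) \<le> 0" by (simp add: zero_enat_def)
  qed
  then show "module_rank V (carrier V) = 0" by simp
qed

lemma module_rank_1D:
  assumes 1: "module_rank V (carrier V) = 1"
  obtains x where "x \<in> carrier V" "\<And>r. r \<odot>\<^bsub>V\<^esub> x = \<zero>\<^bsub>V\<^esub> \<Longrightarrow> r = 0"
    "\<And>y. y \<in> carrier V \<Longrightarrow> \<exists>a b. b \<noteq> 0 \<and> a \<odot>\<^bsub>V\<^esub> x \<oplus>\<^bsub>V\<^esub> b \<odot>\<^bsub>V\<^esub> y = \<zero>\<^bsub>V\<^esub>"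
proof -
  have "module_rank V (carrier V) \<noteq> 0" using 1 by simp
  then obtain x where x: "x \<in> carrier V" "\<And>r. r \<odot>\<^bsub>V\<^esub> x = \<zero>\<^bsub>V\<^esub> \<Longrightarrow> r = 0"
    using module_rank_0_iff by blast
  have "\<exists>a b. b \<noteq> 0 \<and> a \<odot>\<^bsub>V\<^esub> x \<oplus>\<^bsub>V\<^esub> b \<odot>\<^bsub>V\<^esub> y = \<zero>\<^bsub>V\<^esub>" if y: "y \<in> carrier V" for y
  proof (cases "x = y")
    case True
    have "(1 + (- 1)) \<odot>\<^bsub>V\<^esub> x = 1 \<odot>\<^bsub>V\<^esub> x \<oplus>\<^bsub>V\<^esub> (- 1) \<odot>\<^bsub>V\<^esub> x"
      using M.smult_l_distr[of 1 "- 1" x] x(1) by simp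
    then have "1 \<odot>\<^bsub>V\<^esub> x \<oplus>\<^bsub>V\<^esub> (- 1) \<odot>\<^bsub>V\<^esub> x = \<zero>\<^bsub>V\<^esub>"
      using M.smult_l_null[OF x(1)] by simp
    moreover have "(- 1 :: 'r) \<noteq> 0" by simp
    ultimately show ?thesis using True by blast
  next
    case False
    have "\<not> lin_indep V {x, y}"
    proof
      assume "lin_indep V {x, y}"
      then have "enat (card {x, y}) \<le> module_rank V (carrier V)"
        unfolding module_rank_def using x y by (intro SUP_upper) auto
      then show False using 1 False by (simp add: one_enat_def)
    qed
    then obtain a b where ab: "a \<noteq> 0 \<or> b \<noteq> 0" "a \<odot>\<^bsub>V\<^esub> x \<oplus>\<^bsub>V\<^esub> b \<odot>\<^bsub>V\<^esub> y = \<zero>\<^bsub>V\<^esub>"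
      using lin_dep_pair[OF x(1) y False] by blast
    have "b \<noteq> 0"
    proof
      assume "b = 0"
      then have "a \<odot>\<^bsub>V\<^esub> x = \<zero>\<^bsub>V\<^esub>" using ab(2) x(1) M.smult_l_null[OF y] by simp
      then show False using ab(1) x(2) \<open>b = 0\<close> by blast
    qed
    then show ?thesis using ab(2) by blast
  qed
  then show thesis using that x by blast
qed

end

context
  fixes S :: "'a topology" and R :: "'r::comm_ring_1 itself"
begin

interpretation Q: quotient_data
  "(chain_module 1 S)\<lparr>carrier := cycles_1 S\<rparr> :: ('r, 'a sing_simplex \<Rightarrow>\<^sub>0 'r) module" "boundaries_1 S"
  by (rule homology_quotient)

lemma betti_Q: "betti R 1 S = module_rank Q.Q (carrier Q.Q)"
  unfolding betti_def homology_1 ..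

lemma smult_class_zero: "z \<in> cycles_1 S \<Longrightarrow> r \<odot>\<^bsub>Q.Q\<^esub> Q.cl z = \<zero>\<^bsub>Q.Q\<^esub> \<longleftrightarrow> smul r z \<in> boundaries_1 S"
  using Q.smult_Q[of z r] Q.cl_eq_zero_iff[of "smul r z"] cycles_closed(3)[of z S r]
  by (simp add: chain_module_def)

lemma combination_class_zero:
  assumes "z \<in> cycles_1 S" "w \<in> cycles_1 S"
  shows "a \<odot>\<^bsub>Q.Q\<^esub> Q.cl z \<oplus>\<^bsub>Q.Q\<^esub> b \<odot>\<^bsub>Q.Q\<^esub> Q.cl w = \<zero>\<^bsub>Q.Q\<^esub> \<longleftrightarrow> smul a z + smul b w \<in> boundaries_1 S"
proof -
  note c = cycles_closed(3)[OF assms(1), of a] cycles_closed(3)[OF assms(2), of b]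
  show ?thesis
    using Q.smult_Q[of z a] Q.smult_Q[of w b] Q.add_Q[of "smul a z" "smul b w"]
      Q.cl_eq_zero_iff[of "smul a z + smul b w"] assms c cycles_closed(2)[OF c]
    by (simp add: chain_module_def)
qed

lemma betti_eq_0_iff:
  "betti R 1 S = 0 \<longleftrightarrow> (\<forall>z\<in>cycles_1 S. \<exists>r::'r. r \<noteq> 0 \<and> smul r z \<in> boundaries_1 S)"
  unfolding betti_Q module_rank_0_iff[OF Q.module_Q]
  unfolding Q.carrier_Q by (auto simp: smult_class_zero simp del: One_nat_def)

lemma betti_eq_1D:
  assumes "betti R 1 S = 1"
  obtains z :: "'a sing_simplex \<Rightarrow>\<^sub>0 'r" where "z \<in> cycles_1 S"
    "\<And>w. w \<in> cycles_1 S \<Longrightarrow> \<exists>a b. b \<noteq> 0 \<and> smul a z + smul b w \<in> boundaries_1 S"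
proof -
  obtain x where x: "x \<in> carrier Q.Q"
      "\<And>y. y \<in> carrier Q.Q \<Longrightarrow> \<exists>a b. b \<noteq> 0 \<and> a \<odot>\<^bsub>Q.Q\<^esub> x \<oplus>\<^bsub>Q.Q\<^esub> b \<odot>\<^bsub>Q.Q\<^esub> y = \<zero>\<^bsub>Q.Q\<^esub>"
    using module_rank_1D[OF Q.module_Q] assms unfolding betti_Q by metis
  then obtain z where z: "z \<in> cycles_1 S" "x = Q.cl z" unfolding Q.carrier_Q by auto
  have "\<exists>a b. b \<noteq> 0 \<and> smul a z + smul b w \<in> boundaries_1 S" if w: "w \<in> cycles_1 S" for w
  proof -
    have "Q.cl w \<in> carrier Q.Q" unfolding Q.carrier_Q using w by simp
    from x(2)[OF this] show ?thesis
      unfolding z(2) combination_class_zero[OF z(1) w] .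
  qed
  then show thesis using that z(1) by blast
qed

end

section \<open>Pairing cocycles with cycles\<close>

lemma chains_triangle_additive:
  "triangle_additive S (\<lambda>\<sigma>. Poly_Mapping.single \<sigma> (1::'r::comm_ring_1)) (boundaries_1 S)"
proof
  fix \<tau> :: "'a sing_simplex" assume \<tau>: "singular_simplex 2 S \<tau>"
  then have "Poly_Mapping.single \<tau> (1::'r) \<in> carrier (chain_module 2 S)" by (simp add: in_chain_module)
  then show "Poly_Mapping.single (singular_face 2 0 \<tau>) (1::'r) - Poly_Mapping.single (singular_face 2 1 \<tau>) 1
      + Poly_Mapping.single (singular_face 2 2 \<tau>) 1 \<in> boundaries_1 S"
    unfolding boundaries_1_def boundary_2_single[symmetric] by blast
qed (use boundaries_closed in blast)+

lemma pairing_boundary: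
  assumes f: "f \<in> cocycles 1 S" and c: "c \<in> boundaries_1 S"
  shows "pairing f c = 0"
proof -
  obtain d where d: "Poly_Mapping.keys d \<subseteq> singular_simplex_set 2 S" "c = boundary 2 d"
    using c unfolding boundaries_1_def by (auto simp: in_chain_module)
  have "pairing f (boundary 2 (Poly_Mapping.single \<tau> a)) = 0" if "singular_simplex 2 S \<tau>" for \<tau> and a
  proof -
    have "pairing f (boundary 2 (Poly_Mapping.single \<tau> a)) = a * (f (singular_face 2 0 \<tau>)
        - f (singular_face 2 1 \<tau>) + f (singular_face 2 2 \<tau>))"
      unfolding boundary_2_single by (simp add: algebra_simps)
    then show ?thesis using f that unfolding in_cocycles_1 by simp
  qed
  then have "(\<Sum>\<tau>\<in>Poly_Mapping.keys d. pairing f (boundary 2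
      (Poly_Mapping.single \<tau> (Poly_Mapping.lookup d \<tau>)))) = 0"
    using d(1) by (intro sum.neutral) blast
  then show ?thesis
    unfolding d(2) by (subst chain_eq_sum[of d]) (simp only: boundary_sum pairing_sum)
qed

text \<open>The sum is the additive extension of \<open>h\<close>, regarded as a function on 0-simplices, applied to
the boundary of \<open>z\<close>.\<close>

lemma cycle_vertex_sum:
  fixes h :: "'a \<Rightarrow> 'r::comm_ring_1 \<Rightarrow> 'c::ab_group_add"
  assumes z: "z \<in> cycles_1 S" and h: "\<And>x a b. h x (a + b) = h x a + h x b"
  shows "(\<Sum>\<sigma>\<in>Poly_Mapping.keys z. h (\<sigma> (vertex 1)) (Poly_Mapping.lookup z \<sigma>)
     - h (\<sigma> (vertex 0)) (Poly_Mapping.lookup z \<sigma>)) = 0"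
proof -
  have h0: "h x 0 = 0" for x using h[of x 0 0] by simp
  define H where "H = (\<lambda>\<rho>::'a sing_simplex. h (\<rho> (vertex 0)))"
  have H_add: "H \<rho> (a + b) = H \<rho> a + H \<rho> b" for \<rho> a b by (simp add: H_def h)
  have neg: "extend H (c - d) = extend H c - extend H d" for c d
    using extend_add[of H, OF H_add, of "c - d" d] by (simp add: eq_diff_eq)
  have "point_simplex x (vertex 0) = x" for x :: 'a
    by (simp add: point_simplex_def standard_simplex_0_vertex)
  then have point: "extend H (Poly_Mapping.single (point_simplex x) a) = h x a" for x a
    by (simp add: extend_single H_def h0)
  have "0 = extend H (boundary 1 z)" using z by (simp add: cycles_1_def del: One_nat_def)
  also have "boundary 1 z = (\<Sum>\<sigma>\<in>Poly_Mapping.keys z. boundary 1 (Poly_Mapping.single \<sigma> (Poly_Mapping.lookup z \<sigma>)))"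
    by (subst chain_eq_sum[of z]) (simp only: boundary_sum)
  also have "extend H \<dots> = (\<Sum>\<sigma>\<in>Poly_Mapping.keys z. extend H (boundary 1 (Poly_Mapping.single \<sigma> (Poly_Mapping.lookup z \<sigma>))))"
    by (rule extend_sum[OF H_add])
  also have "\<dots> = (\<Sum>\<sigma>\<in>Poly_Mapping.keys z. h (\<sigma> (vertex 1)) (Poly_Mapping.lookup z \<sigma>)
     - h (\<sigma> (vertex 0)) (Poly_Mapping.lookup z \<sigma>))"
  proof (rule sum.cong[OF refl])
    fix \<sigma> assume "\<sigma> \<in> Poly_Mapping.keys z"
    then have "singular_simplex 1 S \<sigma>" using z by (auto simp: cycles_1_def in_chain_module)
    then show "extend H (boundary 1 (Poly_Mapping.single \<sigma> (Poly_Mapping.lookup z \<sigma>))) =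
        h (\<sigma> (vertex 1)) (Poly_Mapping.lookup z \<sigma>) - h (\<sigma> (vertex 0)) (Poly_Mapping.lookup z \<sigma>)"
      by (simp add: boundary_1_single neg point del: One_nat_def)
  qed
  finally show ?thesis by simp
qed

lemma pairing_coboundary_cycle:
  assumes f: "f \<in> coboundaries 1 S" and z: "z \<in> cycles_1 S"
  shows "pairing f z = 0"
proof -
  obtain h where h: "f = (\<lambda>\<sigma>. if singular_simplex 1 S \<sigma> then h (\<sigma> (vertex 1)) - h (\<sigma> (vertex 0)) else 0)"
    using f in_coboundaries_1 by blast
  have "pairing f z = (\<Sum>\<sigma>\<in>Poly_Mapping.keys z. Poly_Mapping.lookup z \<sigma> * h (\<sigma> (vertex 1))
      - Poly_Mapping.lookup z \<sigma> * h (\<sigma> (vertex 0)))"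
    unfolding pairing_def extend_def
    by (rule sum.cong[OF refl])
      (use z in \<open>auto simp: h cycles_1_def in_chain_module right_diff_distrib simp del: One_nat_def\<close>)
  also have "\<dots> = 0"
    by (rule cycle_vertex_sum[OF z, of "\<lambda>x a. a * h x"]) (simp add: distrib_right)
  finally show ?thesis .
qed

lemma loop_is_cycle: "is_loop S x \<sigma> \<Longrightarrow> Poly_Mapping.single \<sigma> a \<in> cycles_1 S"
  unfolding is_loop_def cycles_1_def in_chain_module
  by (auto simp: boundary_1_single simp del: One_nat_def)

section \<open>Finiteness for closed manifolds\<close>

lemma manifold_generators:
  assumes "closed_manifold n S"
  obtains E l where "finite E" "\<And>e. e \<in> E \<Longrightarrow> singular_simplex 1 S e"
    "\<And>y. y \<in> topspace S \<Longrightarrow> singular_simplex 1 S (l y)"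
    "\<And>L \<sigma>. triangle_additive S (\<lambda>\<sigma>. Poly_Mapping.single \<sigma> (1::'r::comm_ring_1)) L \<Longrightarrow> boundaries_1 S \<subseteq> L \<Longrightarrow>
       (\<lambda>\<sigma>. Poly_Mapping.single \<sigma> 1) ` E \<subseteq> L \<Longrightarrow> singular_simplex 1 S \<sigma> \<Longrightarrow>
       Poly_Mapping.single \<sigma> 1 - Poly_Mapping.single (l (\<sigma> (vertex 1))) 1 + Poly_Mapping.single (l (\<sigma> (vertex 0))) 1 \<in> L"
proof (rule triangle_additive.finitely_generated[OF chains_triangle_additive[of S, where 'r = 'r]])
  show "compact_space S" "Hausdorff_space S" using assms by (auto simp: closed_manifold_def)
  show "locally_path_connected_space S" by (rule manifold_locally_path_connected[OF assms])
  show "\<exists>W. openin S W \<and> x \<in> W \<and> contracts_to S W x" if "x \<in> topspace S" for x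
    using manifold_contractible_neighbourhood[OF assms openin_topspace that] by metis
qed (rule that)

text \<open>A finite detecting set bounds the rank of \<open>H\<^sup>1\<close>, and detecting sets of the factors of a product combine
to one of the product; finite rank of the product follows without a generating set for it.\<close>

definition detecting :: "'r::comm_ring_1 itself \<Rightarrow> 'a topology \<Rightarrow> 'a sing_simplex set \<Rightarrow> bool" where
  "detecting R S D \<longleftrightarrow> (\<forall>f::'a sing_simplex \<Rightarrow> 'r. f \<in> cocycles 1 S \<longrightarrow> (\<forall>e\<in>D. f e = 0) \<longrightarrow> f \<in> coboundaries 1 S)"

lemma manifold_detecting:
  assumes "closed_manifold n S"
  obtains D where "finite D" "detecting TYPE('r::comm_ring_1) S D"
proof -
  obtain E l where E: "finite E"
    "\<And>L \<sigma>. triangle_additive S (\<lambda>\<sigma>. Poly_Mapping.single \<sigma> (1::'r)) L \<Longrightarrow> boundaries_1 S \<subseteq> L \<Longrightarrow>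
       (\<lambda>\<sigma>. Poly_Mapping.single \<sigma> 1) ` E \<subseteq> L \<Longrightarrow> singular_simplex 1 S \<sigma> \<Longrightarrow>
       Poly_Mapping.single \<sigma> 1 - Poly_Mapping.single (l (\<sigma> (vertex 1))) 1 + Poly_Mapping.single (l (\<sigma> (vertex 0))) 1 \<in> L"
    by (rule manifold_generators[OF assms, where 'r = 'r]) blast
  have "f \<in> coboundaries 1 S" if f: "f \<in> cocycles 1 S" and 0: "\<forall>e\<in>E. f e = 0" for f :: "'a sing_simplex \<Rightarrow> 'r"
  proof -
    have B: "boundaries_1 S \<subseteq> {c. pairing f c = 0}" using pairing_boundary[OF f] by blast
    have add: "triangle_additive S (\<lambda>\<sigma>. Poly_Mapping.single \<sigma> (1::'r)) {c. pairing f c = 0}"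
      using f unfolding in_cocycles_1 by unfold_locales (simp_all del: One_nat_def)
    have "f \<sigma> = f (l (\<sigma> (vertex 1))) - f (l (\<sigma> (vertex 0)))" if "singular_simplex 1 S \<sigma>" for \<sigma>
    proof -
      have "(\<lambda>\<sigma>. Poly_Mapping.single \<sigma> (1::'r)) ` E \<subseteq> {c. pairing f c = 0}" using 0 by auto
      from E(2)[OF add B this that] show ?thesis by (simp add: algebra_simps)
    qed
    then have "f = (\<lambda>\<sigma>. if singular_simplex 1 S \<sigma> then f (l (\<sigma> (vertex 1))) - f (l (\<sigma> (vertex 0))) else 0)"
      using f unfolding in_cocycles_1 by auto
    then show ?thesis unfolding in_coboundaries_1 by (rule exI[of _ "\<lambda>x. f (l x)"])
  qed
  then show thesis using that[OF E(1)] unfolding detecting_def by blast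
qed

lemma cocycles_sum:
  "(\<And>i. i \<in> A \<Longrightarrow> f i \<in> cocycles 1 S) \<Longrightarrow> (\<lambda>\<sigma>. \<Sum>i\<in>A. a i * f i \<sigma>) \<in> cocycles 1 S"
proof (induction A rule: infinite_finite_induct)
  case (insert i A)
  then have "f i \<in> cocycles 1 S" "(\<lambda>\<sigma>. \<Sum>i\<in>A. a i * f i \<sigma>) \<in> cocycles 1 S" by auto
  from cocycles_closed(2)[OF cocycles_closed(3)[OF this(1)] this(2)] show ?case
    using insert.hyps by simp
qed (use cocycles_closed(1) in auto)

text \<open>For more than \<open>card D\<close> classes, some nontrivial combination of representing cocycles vanishes on \<open>D\<close>
and is therefore a coboundary.\<close>

lemma detecting_finite_rank:
  fixes S :: "'a topology"
  assumes R: "coefficient_ring TYPE('r::comm_ring_1)"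
    and S: "path_connected_space S" "x0 \<in> topspace S" and D: "finite D" "detecting TYPE('r) S D"
  shows "module_rank (cohomology 1 S :: ('r, ('a sing_simplex \<Rightarrow> 'r) set) module) (carrier (cohomology 1 S)) \<noteq> \<infinity>"
proof -
  interpret E: evaluated_module "TYPE('r)" "cohomology 1 S :: ('r, ('a sing_simplex \<Rightarrow> 'r) set) module" "loop_ev S x0"
    by (rule evaluated_cohomology[OF R S])
  have "module_rank (cohomology 1 S :: ('r, ('a sing_simplex \<Rightarrow> 'r) set) module) (carrier (cohomology 1 S))
      \<le> enat (card D)"
  proof (rule E.rank_leI)
    fix B :: "('a sing_simplex \<Rightarrow> 'r) set set"
    assume B: "finite B" "B \<subseteq> carrier (cohomology 1 S)" "lin_indep (cohomology 1 S) B"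
    have "\<exists>f. f \<in> cocycles 1 S \<and> b = coh_class S f" if "b \<in> B" for b
      using B(2) that carrier_cohomology by blast
    then obtain f where f: "\<And>b. b \<in> B \<Longrightarrow> f b \<in> cocycles 1 S \<and> b = coh_class S (f b)" by metis
    show "card B \<le> card D"
    proof (rule ccontr)
      assume "\<not> card B \<le> card D"
      then obtain a where a: "\<exists>b\<in>B. a b \<noteq> 0" "\<forall>e\<in>D. (\<Sum>b\<in>B. a b * f b e) = 0"
        using E.dependent_vectors[OF D(1) B(1), of f] by (auto simp: not_le)
      define F where "F = (\<lambda>\<sigma>. \<Sum>b\<in>B. a b * f b \<sigma>)"
      have "F \<in> cocycles 1 S" unfolding F_def using f by (intro cocycles_sum) blast
      moreover have "\<forall>e\<in>D. F e = 0" unfolding F_def by (rule a(2))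
      ultimately have co: "F \<in> coboundaries 1 S" using D(2) unfolding detecting_def by blast
      have loops: "F \<sigma> = 0" if "is_loop S x0 \<sigma>" for \<sigma> by (rule coboundary_loop[OF co that])
      have "(\<Sum>b\<in>B. a b * loop_ev S x0 b \<sigma>) = 0" for \<sigma>
      proof (cases "is_loop S x0 \<sigma>")
        case True
        have "(\<Sum>b\<in>B. a b * loop_ev S x0 b \<sigma>) = F \<sigma>"
          unfolding F_def
        proof (rule sum.cong[OF refl])
          fix b assume "b \<in> B"
          then show "a b * loop_ev S x0 b \<sigma> = a b * f b \<sigma>"
            using f[of b] loop_ev_class[of S x0 "f b" \<sigma>] True by simp
        qed
        then show ?thesis using loops[OF True] by simp
      qed (simp add: loop_ev_def)
      then show False using E.lin_indep_iff[OF B(1,2)] B(3) a(1) by blast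
    qed
  qed
  then show ?thesis using enat_ile by force
qed

context pointed_product
begin

lemma product_detecting:
  assumes D: "detecting TYPE('r) S D" and E: "detecting TYPE('r) T E"
  shows "detecting TYPE('r) P (simplex_map 1 (\<lambda>x. (x, y0)) ` D \<union> simplex_map 1 (\<lambda>y. (x0, y)) ` E)"
  unfolding detecting_def
proof (intro allI impI)
  fix f :: "('a \<times> 'b) sing_simplex \<Rightarrow> 'r"
  assume f: "f \<in> cocycles 1 P"
    and 0: "\<forall>e\<in>simplex_map 1 (\<lambda>x. (x, y0)) ` D \<union> simplex_map 1 (\<lambda>y. (x0, y)) ` E. f e = 0"
  have "in1 f \<in> coboundaries 1 S"
    using D pullback_cocycle[OF cont_in(1) f] 0 unfolding detecting_def
    by (auto simp: cochain_pullback_def)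
  moreover have "in2 f \<in> coboundaries 1 T"
    using E pullback_cocycle[OF cont_in(2) f] 0 unfolding detecting_def
    by (auto simp: cochain_pullback_def)
  ultimately have "(\<lambda>\<sigma>. pr1 (in1 f) \<sigma> + pr2 (in2 f) \<sigma>) \<in> coboundaries 1 P"
    by (intro coboundaries_closed(2) pullback_coboundary[OF continuous_map_fst] pullback_coboundary[OF continuous_map_snd])
  from coboundaries_closed(2)[OF kunneth[OF f] this] show "f \<in> coboundaries 1 P" by simp
qed

end

section \<open>Betti number and cohomology\<close>

lemma cohomology_zero_of_betti_0:
  fixes f :: "'a sing_simplex \<Rightarrow> 'r::comm_ring_1"
  assumes R: "coefficient_ring TYPE('r::comm_ring_1)"
    and S: "path_connected_space S" "x0 \<in> topspace S" and b: "betti TYPE('r) 1 S = 0"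
    and f: "f \<in> cocycles 1 S"
  shows "f \<in> coboundaries 1 S"
proof (rule vanishing_on_loops[OF S f])
  fix \<sigma> assume "is_loop S x0 \<sigma>"
  then have "Poly_Mapping.single \<sigma> (1::'r) \<in> cycles_1 S" by (rule loop_is_cycle)
  then obtain r :: 'r where r: "r \<noteq> 0" "smul r (Poly_Mapping.single \<sigma> 1) \<in> boundaries_1 S"
    using b betti_eq_0_iff[of "TYPE('r)" S] by blast
  have "r * f \<sigma> = 0" using pairing_boundary[OF f r(2)] by simp
  then show "f \<sigma> = 0" using coefficient_ring.no_zero_divisors[OF R] r(1) by blast
qed

text \<open>Modulo boundaries, \<open>\<sigma> - l(\<sigma>\<^sub>1) + l(\<sigma>\<^sub>0)\<close> is a combination of the finite set \<open>E\<close> with coefficient vector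
\<open>W \<sigma>\<close>, for every edge \<open>\<sigma>\<close> from \<open>\<sigma>\<^sub>0\<close> to \<open>\<sigma>\<^sub>1\<close>. In a cycle the end point terms cancel, so a non-torsion cycle \<open>z\<close>
has a coefficient vector \<open>zc\<close> that is not torsion modulo the relations \<open>B\<close>. A functional \<open>\<phi>\<close> that kills
\<open>B\<close> and not \<open>zc\<close> yields the cocycle \<open>\<sigma> \<mapsto> \<phi>(W \<sigma>)\<close>, whose value on \<open>z\<close> is \<open>\<phi>(zc)\<close>.\<close>

lemma nonzero_cohomology_of_betti:
  assumes R: "coefficient_ring TYPE('r::comm_ring_1)"
    and S: "closed_manifold n S" and b: "betti TYPE('r) 1 S \<noteq> 0"
  obtains f :: "'a sing_simplex \<Rightarrow> 'r::comm_ring_1" where "f \<in> cocycles 1 S" "f \<notin> coboundaries 1 S"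
proof -
  interpret coefficient_ring "TYPE('r)" by (rule R)
  define u where "u = (\<lambda>\<sigma>::'a sing_simplex. Poly_Mapping.single \<sigma> (1::'r))"
  obtain z :: "'a sing_simplex \<Rightarrow>\<^sub>0 'r" where z: "z \<in> cycles_1 S" "\<And>r. r \<noteq> 0 \<Longrightarrow> smul r z \<notin> boundaries_1 S"
    using b betti_eq_0_iff[of "TYPE('r)" S] by blast
  obtain E l where E: "finite E" "\<And>e. e \<in> E \<Longrightarrow> singular_simplex 1 S e"
    "\<And>L \<sigma>. triangle_additive S u L \<Longrightarrow> boundaries_1 S \<subseteq> L \<Longrightarrow> u ` E \<subseteq> L \<Longrightarrow> singular_simplex 1 S \<sigma> \<Longrightarrow>
       u \<sigma> - u (l (\<sigma> (vertex 1))) + u (l (\<sigma> (vertex 0))) \<in> L"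
    unfolding u_def by (rule manifold_generators[OF S, where 'r = 'r]) blast
  interpret T: triangle_additive S u "boundaries_1 S"
    unfolding u_def by (rule chains_triangle_additive)
  define comb where "comb w = (\<Sum>e\<in>E. smul (w e) (u e))" for w :: "'a sing_simplex \<Rightarrow> 'r"
  have comb_lin: "comb (\<lambda>e. s * v e + t * w e) = smul s (comb v) + smul t (comb w)" for s t v w
    unfolding comb_def smul_sum sum.distrib[symmetric]
    by (rule sum.cong[OF refl], rule poly_mapping_eqI) (simp add: lookup_add algebra_simps)
  have comb_0: "comb (\<lambda>_. 0) = 0" by (simp add: comb_def)
  define K where "K = {c. \<exists>w. c - comb w \<in> boundaries_1 S}"
  have KB: "boundaries_1 S \<subseteq> K"
  proof
    fix c :: "'a sing_simplex \<Rightarrow>\<^sub>0 'r" assume "c \<in> boundaries_1 S"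
    then show "c \<in> K" unfolding K_def by (intro CollectI exI[of _ "\<lambda>_. 0"]) (simp add: comb_0)
  qed
  have K_diff: "x - y \<in> K" if "x \<in> K" "y \<in> K" for x y
  proof -
    obtain v w where vw: "x - comb v \<in> boundaries_1 S" "y - comb w \<in> boundaries_1 S"
      using \<open>x \<in> K\<close> \<open>y \<in> K\<close> unfolding K_def by blast
    have "comb (\<lambda>e. 1 * v e + (- 1) * w e) = comb v - comb w"
      unfolding comb_lin smul_minus_one by (simp add: poly_mapping_eqI)
    then have "x - y - comb (\<lambda>e. 1 * v e + (- 1) * w e) = (x - comb v) - (y - comb w)" by simp
    then show ?thesis unfolding K_def using boundaries_closed(4)[OF vw] by (metis (mono_tags, lifting) mem_Collect_eq)
  qed
  have "triangle_additive S u K"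
    using T.additive KB boundaries_closed(1) K_diff by unfold_locales blast+
  moreover have "u ` E \<subseteq> K"
  proof
    fix c assume "c \<in> u ` E"
    then obtain e where e: "e \<in> E" "c = u e" by blast
    have "comb (\<lambda>x. if x = e then 1 else 0) = (\<Sum>x\<in>E. if x = e then u x else 0)"
      unfolding comb_def by (rule sum.cong[OF refl]) (auto intro!: poly_mapping_eqI)
    also have "\<dots> = u e" using E(1) e(1) by simp
    finally show "c \<in> K" unfolding K_def e(2) using boundaries_closed(1)
      by (intro CollectI exI[of _ "\<lambda>x. if x = e then 1 else 0"]) simp
  qed
  ultimately have "u \<sigma> - u (l (\<sigma> (vertex 1))) + u (l (\<sigma> (vertex 0))) \<in> K" if "singular_simplex 1 S \<sigma>" for \<sigma>
    using E(3) KB that by blast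
  then have "\<exists>w. u \<sigma> - u (l (\<sigma> (vertex 1))) + u (l (\<sigma> (vertex 0))) - comb w \<in> boundaries_1 S"
    if "singular_simplex 1 S \<sigma>" for \<sigma> using that unfolding K_def by blast
  then obtain W where W: "\<And>\<sigma>. singular_simplex 1 S \<sigma> \<Longrightarrow>
      u \<sigma> - u (l (\<sigma> (vertex 1))) + u (l (\<sigma> (vertex 0))) - comb (W \<sigma>) \<in> boundaries_1 S" by metis
  define B where "B = {w. comb w \<in> boundaries_1 S}"
  define zc where "zc e = (\<Sum>\<sigma>\<in>Poly_Mapping.keys z. Poly_Mapping.lookup z \<sigma> * W \<sigma> e)" for e
  have B_sum: "(\<Sum>i\<in>A. c i) \<in> boundaries_1 S" if "\<And>i. i \<in> A \<Longrightarrow> c i \<in> boundaries_1 S" for A and c :: "'a sing_simplex \<Rightarrow> 'a sing_simplex \<Rightarrow>\<^sub>0 'r"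
    using that by (induction A rule: infinite_finite_induct) (auto intro: boundaries_closed)
  have z_comb: "z - comb zc \<in> boundaries_1 S"
  proof -
    let ?z = "Poly_Mapping.lookup z"
    have "(\<Sum>\<sigma>\<in>Poly_Mapping.keys z. smul (?z \<sigma>) (u \<sigma> - u (l (\<sigma> (vertex 1))) + u (l (\<sigma> (vertex 0))) - comb (W \<sigma>))) \<in> boundaries_1 S"
      using z(1) by (intro B_sum boundaries_closed(3) W) (auto simp: cycles_1_def in_chain_module)
    also have "(\<Sum>\<sigma>\<in>Poly_Mapping.keys z. smul (?z \<sigma>) (u \<sigma> - u (l (\<sigma> (vertex 1))) + u (l (\<sigma> (vertex 0))) - comb (W \<sigma>)))
      = (\<Sum>\<sigma>\<in>Poly_Mapping.keys z. smul (?z \<sigma>) (u \<sigma>))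
        - (\<Sum>\<sigma>\<in>Poly_Mapping.keys z. smul (?z \<sigma>) (u (l (\<sigma> (vertex 1)))) - smul (?z \<sigma>) (u (l (\<sigma> (vertex 0)))))
        - (\<Sum>\<sigma>\<in>Poly_Mapping.keys z. smul (?z \<sigma>) (comb (W \<sigma>)))"
      unfolding sum_subtractf[symmetric]
      by (rule sum.cong[OF refl], rule poly_mapping_eqI)
        (simp add: lookup_add lookup_minus distrib_left right_diff_distrib)
    also have "(\<Sum>\<sigma>\<in>Poly_Mapping.keys z. smul (?z \<sigma>) (u (l (\<sigma> (vertex 1)))) - smul (?z \<sigma>) (u (l (\<sigma> (vertex 0))))) = 0"
      by (rule cycle_vertex_sum[OF z(1), of "\<lambda>x a. smul a (u (l x))"])
        (rule poly_mapping_eqI, unfold lookup_add lookup_smul, rule distrib_right)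
    also have "(\<Sum>\<sigma>\<in>Poly_Mapping.keys z. smul (?z \<sigma>) (u \<sigma>)) = z"
      unfolding u_def smul_single by (simp flip: chain_eq_sum)
    also have "(\<Sum>\<sigma>\<in>Poly_Mapping.keys z. smul (?z \<sigma>) (comb (W \<sigma>))) = comb zc"
      unfolding comb_def smul_sum zc_def
      by (subst sum.swap, rule sum.cong[OF refl], rule poly_mapping_eqI)
        (simp add: lookup_sum sum_distrib_right mult.assoc)
    finally show ?thesis by simp
  qed
  have "\<exists>\<phi>. (\<forall>w\<in>B. (\<Sum>e\<in>E. \<phi> e * w e) = 0) \<and> (\<Sum>e\<in>E. \<phi> e * zc e) \<noteq> 0"
  proof (rule separating_functional[OF E(1)])
    show "(\<lambda>_. 0) \<in> B" by (simp add: B_def comb_0 boundaries_closed(1))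
    show "(\<lambda>e. s * v e + t * w e) \<in> B" if "v \<in> B" "w \<in> B" for v w s t
      using that by (simp add: B_def comb_lin boundaries_closed)
    show "\<exists>e\<in>E. w e \<noteq> r * zc e" if r: "r \<noteq> 0" and w: "w \<in> B" for r w
    proof (rule ccontr)
      assume "\<not> (\<exists>e\<in>E. w e \<noteq> r * zc e)"
      then have "comb w = comb (\<lambda>e. r * zc e + 0 * zc e)"
        unfolding comb_def by (intro sum.cong) auto
      also have "\<dots> = smul r (comb zc)" unfolding comb_lin by (rule poly_mapping_eqI) (simp add: lookup_add)
      finally have 1: "smul r (comb zc) \<in> boundaries_1 S" using w by (simp add: B_def)
      have "smul r z = smul r (z - comb zc) + smul r (comb zc)"
        by (rule poly_mapping_eqI) (simp add: lookup_add lookup_minus right_diff_distrib)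
      then have "smul r z \<in> boundaries_1 S"
        using boundaries_closed(2)[OF boundaries_closed(3)[OF z_comb] 1] by simp
      then show False using z(2)[OF r] by blast
    qed
  qed
  then obtain \<phi> where \<phi>: "\<And>w. w \<in> B \<Longrightarrow> (\<Sum>e\<in>E. \<phi> e * w e) = 0" "(\<Sum>e\<in>E. \<phi> e * zc e) \<noteq> 0" by blast
  define f where "f \<sigma> = (if singular_simplex 1 S \<sigma> then \<Sum>e\<in>E. \<phi> e * W \<sigma> e else 0)" for \<sigma>
  have f: "f \<in> cocycles 1 S"
    unfolding in_cocycles_1
  proof (intro conjI allI impI)
    fix \<tau> assume \<tau>: "singular_simplex 2 S \<tau>"
    define w where "w e = W (singular_face 2 0 \<tau>) e - W (singular_face 2 1 \<tau>) e + W (singular_face 2 2 \<tau>) e" for e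
    let ?d = "\<lambda>k. u (singular_face 2 k \<tau>)"
    let ?v = "\<lambda>k. u (l (\<tau> (vertex k)))"
    note W0 = W[OF singular_face_2(1)[OF \<tau>], unfolded vertex_face[OF \<tau>]]
    note W1 = W[OF singular_face_2(2)[OF \<tau>], unfolded vertex_face[OF \<tau>]]
    note W2 = W[OF singular_face_2(3)[OF \<tau>], unfolded vertex_face[OF \<tau>]]
    have "comb w = comb (W (singular_face 2 0 \<tau>)) - comb (W (singular_face 2 1 \<tau>)) + comb (W (singular_face 2 2 \<tau>))"
      unfolding comb_def w_def sum_subtractf[symmetric] sum.distrib[symmetric]
      by (rule sum.cong[OF refl], rule poly_mapping_eqI) (simp add: lookup_add lookup_minus algebra_simps)
    then have "comb w = (?d 0 - ?d 1 + ?d 2) - (((?d 0 - ?v 2 + ?v 1 - comb (W (singular_face 2 0 \<tau>)))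
        - (?d 1 - ?v 2 + ?v 0 - comb (W (singular_face 2 1 \<tau>)))) + (?d 2 - ?v 1 + ?v 0 - comb (W (singular_face 2 2 \<tau>))))"
      by (simp add: algebra_simps)
    also have "\<dots> \<in> boundaries_1 S"
      by (intro boundaries_closed(4)[OF T.additive[OF \<tau>]] boundaries_closed(2)[OF boundaries_closed(4)[OF W0 W1] W2])
    finally have "w \<in> B" by (simp add: B_def)
    then have "(\<Sum>e\<in>E. \<phi> e * w e) = 0" by (rule \<phi>(1))
    then show "f (singular_face 2 0 \<tau>) - f (singular_face 2 1 \<tau>) + f (singular_face 2 2 \<tau>) = 0"
      using singular_face_2[OF \<tau>]
      by (simp add: f_def w_def algebra_simps sum.distrib sum_subtractf del: One_nat_def)
  qed (simp add: f_def)
  have "pairing f z = (\<Sum>\<sigma>\<in>Poly_Mapping.keys z. Poly_Mapping.lookup z \<sigma> * (\<Sum>e\<in>E. \<phi> e * W \<sigma> e))"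
    unfolding pairing_def extend_def
    by (rule sum.cong[OF refl]) (use z(1) in \<open>auto simp: f_def cycles_1_def in_chain_module\<close>)
  also have "\<dots> = (\<Sum>e\<in>E. \<phi> e * zc e)"
    unfolding zc_def sum_distrib_left by (subst sum.swap) (simp add: mult_ac)
  finally have "pairing f z \<noteq> 0" using \<phi>(2) by simp
  then have "f \<notin> coboundaries 1 S" using pairing_coboundary_cycle[OF _ z(1)] by blast
  then show thesis using that f by blast
qed

text \<open>Every cycle has a nonzero multiple that is homologous to a multiple of a fixed cycle \<open>z\<close>. The
values of a cocycle on loops are thus governed by its value on \<open>z\<close>, so the combination
of \<open>f\<close> and \<open>g\<close> that vanishes on \<open>z\<close> vanishes on all loops.\<close>

lemma dependent_of_betti_1:
  fixes S :: "'a topology"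
  assumes R: "coefficient_ring TYPE('r::comm_ring_1)"
    and S: "path_connected_space S" "x0 \<in> topspace S" and b: "betti TYPE('r) 1 S = 1"
    and x: "x \<in> carrier (cohomology 1 S :: ('r, ('a sing_simplex \<Rightarrow> 'r) set) module)"
    and y: "y \<in> carrier (cohomology 1 S :: ('r, ('a sing_simplex \<Rightarrow> 'r) set) module)"
  shows "\<exists>l m. (l \<noteq> 0 \<or> m \<noteq> 0) \<and> (\<forall>i. l * loop_ev S x0 y i = m * loop_ev S x0 x i)"
proof -
  interpret coefficient_ring "TYPE('r)" by (rule R)
  obtain f where f: "f \<in> cocycles 1 S" "x = coh_class S f" using x carrier_cohomology by blast
  obtain g where g: "g \<in> cocycles 1 S" "y = coh_class S g" using y carrier_cohomology by blast
  obtain z :: "'a sing_simplex \<Rightarrow>\<^sub>0 'r" where z: "z \<in> cycles_1 S"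
    "\<And>w. w \<in> cycles_1 S \<Longrightarrow> \<exists>a b. b \<noteq> 0 \<and> smul a z + smul b w \<in> boundaries_1 S"
    by (rule betti_eq_1D[OF b]) blast
  have rel: "\<exists>a b. b \<noteq> 0 \<and> b * f \<sigma> = - (a * pairing f z) \<and> b * g \<sigma> = - (a * pairing g z)"
    if loop: "is_loop S x0 \<sigma>" for \<sigma>
  proof -
    obtain a b where ab: "b \<noteq> 0" "smul a z + smul b (Poly_Mapping.single \<sigma> 1) \<in> boundaries_1 S"
      using z(2)[OF loop_is_cycle[OF loop]] by blast
    have "a * pairing f z + b * f \<sigma> = 0" "a * pairing g z + b * g \<sigma> = 0"
      using pairing_boundary[OF f(1) ab(2)] pairing_boundary[OF g(1) ab(2)] by simp_all
    then show ?thesis using ab(1) by (metis add_eq_0_iff)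
  qed
  show ?thesis
  proof (cases "pairing f z = 0 \<and> pairing g z = 0")
    case True
    have "f \<sigma> = 0 \<and> g \<sigma> = 0" if "is_loop S x0 \<sigma>" for \<sigma>
      using rel[OF that] True no_zero_divisors by (metis mult_zero_right neg_0_equal_iff_equal)
    then show ?thesis unfolding f(2) g(2) loop_ev_class by (intro exI[of _ 1]) simp
  next
    case False
    have "pairing f z * g \<sigma> = pairing g z * f \<sigma>" if loop: "is_loop S x0 \<sigma>" for \<sigma>
    proof -
      obtain a b where ab: "b \<noteq> 0" "b * f \<sigma> = - (a * pairing f z)" "b * g \<sigma> = - (a * pairing g z)"
        using rel[OF loop] by blast
      have "b * (pairing f z * g \<sigma> - pairing g z * f \<sigma>) = pairing f z * (b * g \<sigma>) - pairing g z * (b * f \<sigma>)"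
        by (simp add: algebra_simps)
      also have "\<dots> = 0" unfolding ab by (simp add: algebra_simps)
      finally show ?thesis using no_zero_divisors ab(1) by fastforce
    qed
    then show ?thesis unfolding f(2) g(2) loop_ev_class using False
      by (intro exI[of _ "pairing f z"] exI[of _ "pairing g z"]) auto
  qed
qed

section \<open>Isotropy of a product of closed manifolds\<close>

lemma isotropic_eq: "isotropic S H \<longleftrightarrow> isotropic_for (cohomology 1 S) (cup_vanishes S) H"
  by (simp add: isotropic_def isotropic_for_def cup_vanishes_def)

lemma isotropy_index_eq:
  fixes R :: "'r::comm_ring_1 itself" and S :: "'a topology"
  shows "isotropic_ranks R S
      = isotropic_ranks_for (cohomology 1 S :: ('r, ('a sing_simplex \<Rightarrow> 'r) set) module) (cup_vanishes S)"
    "isotropy_index R S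
      = Max (isotropic_ranks_for (cohomology 1 S :: ('r, ('a sing_simplex \<Rightarrow> 'r) set) module) (cup_vanishes S))"
  unfolding isotropy_index_def isotropic_ranks_def isotropic_ranks_for_def
    maximal_isotropic_def maximal_isotropic_for_def isotropic_eq by simp_all

lemma coefficient_ring_of_assms:
  assumes "field (ring_of_type_algebra :: 'r::comm_ring_1 ring) \<or> (ring_of_type_algebra :: 'r ring) \<simeq> \<Z>"
  shows "coefficient_ring TYPE('r)"
  using assms coefficient_ring_field coefficient_ring_int by blast

lemma isotropy_index_eq_0_iff_betti:
  fixes S :: "'a topology" and R :: "'r::comm_ring_1 itself"
  assumes R: "coefficient_ring TYPE('r)" and S: "connected_closed_manifold S"
  shows "isotropy_index R S = 0 \<longleftrightarrow>
     betti R 1 S = 0 \<or>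
     (betti R 1 S = 1 \<and> CHAR('r) = 2 \<and>
       (\<exists>x\<in>carrier (cohomology 1 S). \<exists>y\<in>carrier (cohomology 1 S).
          (cup 1 1 S x y :: ('a sing_simplex \<Rightarrow> 'r) set) \<noteq> \<zero>\<^bsub>cohomology 2 S\<^esub>)) \<or>
     (betti R 1 S > 1 \<and> CHAR('r) = 2 \<and>
       (\<forall>x\<in>carrier (cohomology 1 S). x \<noteq> \<zero>\<^bsub>cohomology 1 S\<^esub> \<longrightarrow>
          (cup 1 1 S x x :: ('a sing_simplex \<Rightarrow> 'r) set) \<noteq> \<zero>\<^bsub>cohomology 2 S\<^esub>))"
proof -
  have TR: "betti TYPE('r) 1 S = betti R 1 S" by (simp add: betti_def)
  obtain n where n: "closed_manifold n S" using S by (auto simp: connected_closed_manifold_def)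
  then obtain x0 where x0: "x0 \<in> topspace S" unfolding closed_manifold_def by blast
  note pc = connected_closed_manifold_path_connected[OF S]
  obtain D where D: "finite D" "detecting TYPE('r) S D" by (rule manifold_detecting[OF n])
  interpret cup_form "TYPE('r)" "cohomology 1 S :: ('r, ('a sing_simplex \<Rightarrow> 'r) set) module" "loop_ev S x0" "cup_vanishes S"
    by (rule cup_form_cohomology[OF R pc x0 detecting_finite_rank[OF R pc x0 D]])
  have "betti R 1 S = 0 \<longleftrightarrow>
      carrier (cohomology 1 S :: ('r, ('a sing_simplex \<Rightarrow> 'r) set) module) \<subseteq> {\<zero>\<^bsub>cohomology 1 S\<^esub>}"
  proof
    assume "betti R 1 S = 0"
    then have "f \<in> coboundaries 1 S" if "f \<in> cocycles 1 S" for f :: "'a sing_simplex \<Rightarrow> 'r"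
      using cohomology_zero_of_betti_0[OF R pc x0 _ that] TR by simp
    then show "carrier (cohomology 1 S :: ('r, ('a sing_simplex \<Rightarrow> 'r) set) module) \<subseteq> {\<zero>\<^bsub>cohomology 1 S\<^esub>}"
      unfolding carrier_cohomology using coh_class_zero_iff by blast
  next
    assume zero: "carrier (cohomology 1 S :: ('r, ('a sing_simplex \<Rightarrow> 'r) set) module) \<subseteq> {\<zero>\<^bsub>cohomology 1 S\<^esub>}"
    show "betti R 1 S = 0"
    proof (rule ccontr)
      assume "betti R 1 S \<noteq> 0"
      then obtain f :: "'a sing_simplex \<Rightarrow> 'r" where f: "f \<in> cocycles 1 S" "f \<notin> coboundaries 1 S"
        using nonzero_cohomology_of_betti[OF R n] TR by metis
      have "coh_class S f \<in> carrier (cohomology 1 S)" unfolding carrier_cohomology using f(1) by blast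
      then show False using zero f coh_class_zero_iff[OF f(1)] by blast
    qed
  qed
  moreover have "\<forall>x\<in>carrier (cohomology 1 S). \<forall>y\<in>carrier (cohomology 1 S). dependent x y"
    if "betti R 1 S = 1"
    unfolding dependent_def using dependent_of_betti_1[OF R pc x0] that TR by simp
  ultimately show ?thesis
    unfolding isotropy_index_eq by (subst index_eq_0_iff_betti) (auto simp: cup_vanishes_def)
qed

theorem theorem27:
  fixes M1 :: "'a topology" and M2 :: "'b topology" and R :: "'r::comm_ring_1 itself"
  assumes "field (ring_of_type_algebra :: 'r ring) \<or> (ring_of_type_algebra :: 'r ring) \<simeq> \<Z>"
    and "connected_closed_manifold M1"
    and "connected_closed_manifold M2"
  shows
    "(\<forall>H :: (('a \<times> 'b) sing_simplex \<Rightarrow> 'r) set set.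
        submodule H (ring_of_type_algebra :: 'r ring) (cohomology 1 (prod_topology M1 M2)) \<longrightarrow>
        (isotropic (prod_topology M1 M2) H \<longleftrightarrow>
           (module_rank (cohomology 1 (prod_topology M1 M2)) H = 1 \<and>
             (CHAR('r) = 2 \<longrightarrow>
                (\<forall>x\<in>H. cup 1 1 (prod_topology M1 M2) x x =
                   \<zero>\<^bsub>cohomology 2 (prod_topology M1 M2)\<^esub>))) \<or>
           (\<exists>H1. isotropic M1 H1 \<and> H = pullback 1 (prod_topology M1 M2) fst ` H1) \<or>
           (\<exists>H2. isotropic M2 H2 \<and> H = pullback 1 (prod_topology M1 M2) snd ` H2)))
     \<and>
     ((isotropy_index R M1 \<noteq> 0 \<and> isotropy_index R M2 \<noteq> 0 \<longrightarrow>
         isotropic_ranks R (prod_topology M1 M2) =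
           {1} \<union> isotropic_ranks R M1 \<union> isotropic_ranks R M2) \<and>
      (isotropy_index R M2 = 0 \<longrightarrow>
         isotropic_ranks R (prod_topology M1 M2) = isotropic_ranks R M1) \<and>
      (isotropy_index R M1 = 0 \<longrightarrow>
         isotropic_ranks R (prod_topology M1 M2) = isotropic_ranks R M2) \<and>
      (isotropy_index R M1 = 0 \<longleftrightarrow>
         betti R 1 M1 = 0 \<or>
         (betti R 1 M1 = 1 \<and> CHAR('r) = 2 \<and>
           (\<exists>x\<in>carrier (cohomology 1 M1). \<exists>y\<in>carrier (cohomology 1 M1).
              (cup 1 1 M1 x y :: ('a sing_simplex \<Rightarrow> 'r) set) \<noteq> \<zero>\<^bsub>cohomology 2 M1\<^esub>)) \<or>
         (betti R 1 M1 > 1 \<and> CHAR('r) = 2 \<and>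
           (\<forall>x\<in>carrier (cohomology 1 M1). x \<noteq> \<zero>\<^bsub>cohomology 1 M1\<^esub> \<longrightarrow>
              (cup 1 1 M1 x x :: ('a sing_simplex \<Rightarrow> 'r) set) \<noteq> \<zero>\<^bsub>cohomology 2 M1\<^esub>))) \<and>
      (isotropy_index R M2 = 0 \<longleftrightarrow>
         betti R 1 M2 = 0 \<or>
         (betti R 1 M2 = 1 \<and> CHAR('r) = 2 \<and>
           (\<exists>x\<in>carrier (cohomology 1 M2). \<exists>y\<in>carrier (cohomology 1 M2).
              (cup 1 1 M2 x y :: ('b sing_simplex \<Rightarrow> 'r) set) \<noteq> \<zero>\<^bsub>cohomology 2 M2\<^esub>)) \<or>
         (betti R 1 M2 > 1 \<and> CHAR('r) = 2 \<and>
           (\<forall>x\<in>carrier (cohomology 1 M2). x \<noteq> \<zero>\<^bsub>cohomology 1 M2\<^esub> \<longrightarrow>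
              (cup 1 1 M2 x x :: ('b sing_simplex \<Rightarrow> 'r) set) \<noteq> \<zero>\<^bsub>cohomology 2 M2\<^esub>))))
     \<and>
     isotropy_index R (prod_topology M1 M2) = max (isotropy_index R M1) (isotropy_index R M2)"
proof -
  note coeff = coefficient_ring_of_assms[OF assms(1)]
  obtain n1 where n1: "closed_manifold n1 M1" using assms(2) by (auto simp: connected_closed_manifold_def)
  obtain n2 where n2: "closed_manifold n2 M2" using assms(3) by (auto simp: connected_closed_manifold_def)
  obtain x0 where x0: "x0 \<in> topspace M1" using n1 unfolding closed_manifold_def by blast
  obtain y0 where y0: "y0 \<in> topspace M2" using n2 unfolding closed_manifold_def by blast
  note pc1 = connected_closed_manifold_path_connected[OF assms(2)]
  note pc2 = connected_closed_manifold_path_connected[OF assms(3)]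
  obtain D1 where D1: "finite D1" "detecting TYPE('r) M1 D1" by (rule manifold_detecting[OF n1])
  obtain D2 where D2: "finite D2" "detecting TYPE('r) M2 D2" by (rule manifold_detecting[OF n2])
  interpret PP: pointed_product M1 M2 x0 y0 "TYPE('r)"
    by unfold_locales (rule pc1 x0 pc2 y0)+
  have D: "finite (simplex_map 1 (\<lambda>x. (x, y0)) ` D1 \<union> simplex_map 1 (\<lambda>y. (x0, y)) ` D2)"
    using D1 D2 by simp
  note fin1 = detecting_finite_rank[OF coeff pc1 x0 D1]
    and fin2 = detecting_finite_rank[OF coeff pc2 y0 D2]
    and fin = detecting_finite_rank[OF coeff PP.P_path_connected D PP.product_detecting[OF D1(2) D2(2)]]
  interpret K: product_form "TYPE('r)"
    "cohomology 1 M1 :: ('r, ('a sing_simplex \<Rightarrow> 'r) set) module" "loop_ev M1 x0" "cup_vanishes M1"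
    "cohomology 1 M2 :: ('r, ('b sing_simplex \<Rightarrow> 'r) set) module" "loop_ev M2 y0" "cup_vanishes M2"
    "cohomology 1 (prod_topology M1 M2) :: ('r, (('a \<times> 'b) sing_simplex \<Rightarrow> 'r) set) module"
    "loop_ev (prod_topology M1 M2) (x0, y0)" "cup_vanishes (prod_topology M1 M2)"
    "pullback 1 (prod_topology M1 M2) fst" "pullback 1 (prod_topology M1 M2) snd"
    using PP.product_form_cohomology[OF coeff fin1 fin2 fin] unfolding PP.p1_def PP.p2_def .
  show ?thesis
  proof (intro conjI)
    show "\<forall>H :: (('a \<times> 'b) sing_simplex \<Rightarrow> 'r) set set.
        submodule H (ring_of_type_algebra :: 'r ring) (cohomology 1 (prod_topology M1 M2)) \<longrightarrow>
        (isotropic (prod_topology M1 M2) H \<longleftrightarrow>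
           (module_rank (cohomology 1 (prod_topology M1 M2)) H = 1 \<and>
             (CHAR('r) = 2 \<longrightarrow>
                (\<forall>x\<in>H. cup 1 1 (prod_topology M1 M2) x x =
                   \<zero>\<^bsub>cohomology 2 (prod_topology M1 M2)\<^esub>))) \<or>
           (\<exists>H1. isotropic M1 H1 \<and> H = pullback 1 (prod_topology M1 M2) fst ` H1) \<or>
           (\<exists>H2. isotropic M2 H2 \<and> H = pullback 1 (prod_topology M1 M2) snd ` H2))"
      unfolding isotropic_eq using K.isotropic_classification unfolding cup_vanishes_def by blast
    show "isotropy_index R M1 \<noteq> 0 \<and> isotropy_index R M2 \<noteq> 0 \<longrightarrow>
         isotropic_ranks R (prod_topology M1 M2) =
           {1} \<union> isotropic_ranks R M1 \<union> isotropic_ranks R M2"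
      unfolding isotropy_index_eq using K.ranks_product by blast
    show "isotropy_index R M2 = 0 \<longrightarrow> isotropic_ranks R (prod_topology M1 M2) = isotropic_ranks R M1"
      unfolding isotropy_index_eq using K.ranks_anisotropic_factor by blast
    show "isotropy_index R M1 = 0 \<longrightarrow> isotropic_ranks R (prod_topology M1 M2) = isotropic_ranks R M2"
      unfolding isotropy_index_eq using product_form.ranks_anisotropic_factor[OF K.swap] by blast
    show "isotropy_index R (prod_topology M1 M2) = max (isotropy_index R M1) (isotropy_index R M2)"
      unfolding isotropy_index_eq by (rule K.index_product)
  qed (rule isotropy_index_eq_0_iff_betti[OF coeff assms(2)] isotropy_index_eq_0_iff_betti[OF coeff assms(3)])+
qed

end
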